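(* Let $d\ge 1$ and $t\ge 0$ be integers and let $f(n)=dn+t$. Let $\psi:\mathbb{N}\to[1,\infty)$ be a function, and define $B$ and $b$ by $$\log B=\liminf_{n\to\infty}\frac{\log\psi(n)}{dn}\qquad\text{and}\qquad \log b=\liminf_{n\to\infty}\frac{\log\log\psi(n)}{dn^2}.$$ Let $$E_f(\psi)=\left\{x\in[0,1): \sqrt[n]{a_{f(n)}(x)\,a_{2f(n)}(x)\cdots a_{nf(n)}(x)}\ge\psi(n)\ \text{for infinitely many } n\in\mathbb{N}\right\}.$$ Then the Hausdorff dimension of $E_f(\psi)$ is $$\dim_{\mathcal H}E_f(\psi)=\begin{cases}\inf\left\{s\ge 0:\mathsf{P}\left(-s\log|T'|-(2s-1)\log B\right)\le 0\right\} & \text{if } 1\le B<\infty,\\[1ex] \dfrac{1}{1+b} & \text{if } B=\infty.\end{cases}$$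
   Context: $T:[0,1)\to[0,1)$ is the Gauss map: $T(0)=0$ and $T(x)=\frac1x-\lfloor\frac1x\rfloor$ for $x\in(0,1)$; $T'$ is its derivative, so $|T'(x)|=x^{-2}$. For irrational $x\in(0,1)$ the continued fraction expansion is $x=[a_1(x),a_2(x),\ldots]$ with partial quotients $a_1(x)=\lfloor 1/x\rfloor$ and $a_n(x)=a_1(T^{n-1}(x))$ for $n\ge 2$. (Rational $x$ form a countable set and do not affect the dimension.) Pressure function: for a real function $\phi$ on $[0,1)$, $$\mathsf{P}(\phi)=\mathsf{P}(T,\phi)=\lim_{n\to\infty}\frac1n\log\sum_{(a_1,\ldots,a_n)\in\mathbb{N}^n}\ \sup_{x\in X} e^{S_n\phi([a_1,\ldots,a_n+x])},$$ where $\mathbb{N}=\{1,2,\ldots\}$ in the sum, $X$ is the set of $x\in[0,1)$ with $a_n(x)\in\mathbb{N}$ for all $n\ge1$, $[a_1,\ldots,a_n+x]$ is the finite continued fraction $\cfrac{1}{a_1+\cfrac{1}{\ddots+\cfrac{1}{a_n+x}}}$, and $S_n\phi(y)=\phi(y)+\phi(Ty)+\cdots+\phi(T^{n-1}y)$. The value $+\infty$ is allowed for $\mathsf P$. Conventions: $B=\infty$ or $b=\infty$ if the corresponding liminf is $+\infty$, and $\frac{1}{1+b}=0$ when $b=\infty$. *)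

theory Defs
  imports "HOL-Analysis.Analysis"
begin

section \<open>Hausdorff dimension\<close>

text \<open>
  The empty set contributes 0 and, for nonempty sets, \<open>0\<^sup>0 = 1\<close>, so that
  \<open>s = 0\<close> yields the counting measure (note that \<open>0 powr 0 = 0\<close> in HOL).
\<close>
definition diam_power :: "real \<Rightarrow> 'a::metric_space set \<Rightarrow> ennreal" where
  "diam_power s U =
    (if U = {} then 0 else if s = 0 then 1 else ennreal (diameter U powr s))"

text \<open>
  The requirement \<open>bounded (U i)\<close> is needed because \<^const>\<open>diameter\<close> is unspecified on
  unbounded sets.
\<close>
definition hausdorff_premeasure :: "real \<Rightarrow> real \<Rightarrow> 'a::metric_space set \<Rightarrow> ennreal" where
  "hausdorff_premeasure s \<delta> A =
    (INF U\<in>{U :: nat \<Rightarrow> 'a set. A \<subseteq> (\<Union>i. U i) \<and> (\<forall>i. bounded (U i) \<and> diameter (U i) \<le> \<delta>)}.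
       \<Sum>i. diam_power s (U i))"

definition hausdorff_measure :: "real \<Rightarrow> 'a::metric_space set \<Rightarrow> ennreal" where
  "hausdorff_measure s A = (SUP \<delta>\<in>{0<..}. hausdorff_premeasure s \<delta> A)"

definition hausdorff_dim :: "'a::metric_space set \<Rightarrow> ennreal" where
  "hausdorff_dim A = (INF s\<in>{s :: real. 0 \<le> s \<and> hausdorff_measure s A = 0}. ennreal s)"


section \<open>Continued fractions\<close>

definition gauss_map :: "real \<Rightarrow> real" where
  "gauss_map x = (if x = 0 then 0 else 1 / x - of_int \<lfloor>1 / x\<rfloor>)"

text \<open>
  The \<open>n\<close>-th partial quotient, for \<open>n \<ge> 1\<close>. For rational \<open>x\<close> in \<open>[0,1)\<close> the orbit reaches
  \<open>0\<close>, and from then on the partial quotients take the dummy value \<open>0\<close>, since \<open>1 / 0 = 0\<close>.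
\<close>
definition partial_quotient :: "nat \<Rightarrow> real \<Rightarrow> nat" where
  "partial_quotient n x = nat \<lfloor>1 / (gauss_map ^^ (n - 1)) x\<rfloor>"

text \<open>\<open>cf_eval [a\<^sub>1, \<dots>, a\<^sub>n] x\<close> is the finite continued fraction \<open>[a\<^sub>1, \<dots>, a\<^sub>n + x]\<close>.\<close>
fun cf_eval :: "nat list \<Rightarrow> real \<Rightarrow> real" where
  "cf_eval [] x = x"
| "cf_eval (a # as) x = 1 / (real a + cf_eval as x)"


section \<open>Pressure\<close>

text \<open>The logarithm as a bijection from \<open>[0,\<infinity>]\<close> onto \<open>[-\<infinity>,\<infinity>]\<close>.\<close>
definition ln_ennreal :: "ennreal \<Rightarrow> ereal" where
  "ln_ennreal x = (if x = 0 then -\<infinity> else if x = \<infinity> then \<infinity> else ereal (ln (enn2real x)))"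

definition cf_domain :: "real set" where
  "cf_domain = {x \<in> {0..<1}. \<forall>n\<ge>1. partial_quotient n x \<ge> 1}"

definition birkhoff_sum :: "(real \<Rightarrow> real) \<Rightarrow> nat \<Rightarrow> real \<Rightarrow> real" where
  "birkhoff_sum \<phi> n y = (\<Sum>k<n. \<phi> ((gauss_map ^^ k) y))"

definition partition_sum :: "(real \<Rightarrow> real) \<Rightarrow> nat \<Rightarrow> ennreal" where
  "partition_sum \<phi> n =
    (\<Sum>\<^sub>\<infinity>as\<in>{as :: nat list. length as = n \<and> set as \<subseteq> {1..}}.
       SUP x\<in>cf_domain. ennreal (exp (birkhoff_sum \<phi> n (cf_eval as x))))"

definition pressure :: "(real \<Rightarrow> real) \<Rightarrow> ereal" where
  "pressure \<phi> = lim (\<lambda>n. ln_ennreal (partition_sum \<phi> n) / ereal (real n))"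


section \<open>The exceptional set\<close>

definition E_set :: "(nat \<Rightarrow> nat) \<Rightarrow> (nat \<Rightarrow> real) \<Rightarrow> real set" where
  "E_set f \<psi> = {x \<in> {0..<1}.
     \<exists>\<^sub>\<infinity>n. n \<ge> 1 \<and> root n (\<Prod>i=1..n. real (partial_quotient (i * f n) x)) \<ge> \<psi> n}"

end

theory Submission
  imports Defs "HOL-Probability.Probability"
begin

text \<open>
  Write \<open>q(w)\<close> for the denominator of the finite continued fraction with digits \<open>w\<close>. Cylinders have
  length comparable to \<open>q(w)\<^sup>-\<^sup>2\<close> and \<open>q\<close> is multiplicative up to a factor 2, so the pressure of
  \<open>- s log |T'|\<close> is the growth rate of the sums of \<open>q(w)\<^sup>-\<^sup>2\<^sup>s\<close> over words of length \<open>n\<close>.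

  Upper bounds: for finite \<open>B\<close> the cylinders of length \<open>n f(n) \<approx> d n\<^sup>2\<close> with a large product are summed
  with Chebyshev's inequality. The \<open>n\<close> distinguished digits contribute \<open>B\<close> to the power
  \<open>- (2s - 1) d n\<^sup>2\<close> up to a factor \<open>exp (O(n))\<close>, and the other digits contribute the pressure. For
  \<open>B = \<infinity>\<close> some distinguished digit \<open>a\<^sub>p\<close> exceeds \<open>exp (c\<^sup>p)\<close>, for every \<open>c < b\<close>. This forces
  \<open>q\<^sub>m\<^sub>+\<^sub>1 \<ge> q\<^sub>m powr c'\<close> infinitely often, for every \<open>c' < c\<close>.

  Lower bounds: a random continued fraction whose digits are grouped into independent blocks, each
  consisting of a word \<open>w\<close> over a finite alphabet with probability proportional to \<open>q(w)\<^sup>-\<^sup>2\<^sup>s\<close> and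
  one digit uniform in \<open>[V, 2V)\<close>, almost surely lies in the exceptional set, and its distribution satisfies
  a Hoelder condition.
\<close>

text \<open>The exponent 2s - 1 is the price of a large digit: about V digits lie in [V, 2V), each
  contributing V^(-2s), so such a digit costs V^(1-2s). With n digits of size B^(dn) against about d
  n^2 unrestricted ones, cost and gain balance when P(s) = (2s-1) log B; both are exponential in
  n^2, so a constant may be lost in every block. For s <= 1/2 even the sum over one digit diverges,
  hence the dimension does not drop below 1/2 for finite B. The lower bound meets a second obstacle:
  after a prefix with denominator q the digits in [V, 2V) fill an interval of length about 1/(V
  q^2), much shorter than the cylinder, and the mass must be controlled at this scale as well. If
  all digits are about exp(b^j), this scale alone decides: the mass of a prefix is about
  exp(-b^j/(b-1)), the interval has length about exp(-b^j (b+1)/(b-1)), and the quotient of the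
  exponents is 1/(1+b).\<close>

section \<open>Continuants\<close>

text \<open>
  \<open>cfq [a\<^sub>1, \<dots>, a\<^sub>n] x\<close> is \<open>q\<^sub>n + x q\<^sub>n\<^sub>-\<^sub>1\<close>, the denominator of \<open>[a\<^sub>1, \<dots>, a\<^sub>n + x]\<close>.
\<close>
fun cfq :: "nat list \<Rightarrow> real \<Rightarrow> real" where
  "cfq [] x = 1"
| "cfq [a] x = real a + x"
| "cfq (a # b # as) x = real a * cfq (b # as) x + cfq as x"

abbreviation positive_word :: "nat list \<Rightarrow> bool" where
  "positive_word w \<equiv> set w \<subseteq> {1..}"

lemma cfq_ge_1: "positive_word w \<Longrightarrow> 0 \<le> x \<Longrightarrow> 1 \<le> cfq w x"
proof (induction w x rule: cfq.induct)
  case (3 a b as x)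
  have "1 * 1 \<le> real a * cfq (b # as) x" using 3 by (intro mult_mono) auto
  moreover have "1 \<le> cfq as x" using 3 by auto
  ultimately show ?case by simp
qed auto

lemma cf_eval_nonneg: "0 \<le> x \<Longrightarrow> 0 \<le> cf_eval w x"
  by (induction w) auto

lemma cf_eval_le_1: "positive_word w \<Longrightarrow> 0 \<le> x \<Longrightarrow> x \<le> 1 \<Longrightarrow> cf_eval w x \<le> 1"
proof (cases w)
  case (Cons a w')
  assume "positive_word w" "0 \<le> x" "x \<le> 1"
  then have "1 \<le> real a" "0 \<le> cf_eval w' x" using Cons cf_eval_nonneg by auto
  then show ?thesis using Cons by simp
qed auto

lemma cf_eval_gt_0: "positive_word w \<Longrightarrow> 0 < x \<Longrightarrow> 0 < cf_eval w x"
  by (induction w) (auto intro!: add_pos_pos divide_pos_pos)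

lemma cf_eval_less_1: "positive_word w \<Longrightarrow> 0 < x \<Longrightarrow> x < 1 \<Longrightarrow> cf_eval w x < 1"
proof (cases w)
  case (Cons a w')
  assume "positive_word w" "0 < x" "x < 1"
  then have "1 \<le> real a" "0 < cf_eval w' x" using Cons cf_eval_gt_0[of w' x] by auto
  then show ?thesis using Cons by simp
qed auto

text \<open>Dividing the three-term recurrence by \<open>cfq w x\<close> gives the recursion of the
  reciprocal of \<open>cf_eval\<close>, so the denominator is the product of the reciprocals of all
  tails of the fraction.\<close>

lemma cfq_Cons: "positive_word (a # w) \<Longrightarrow> 0 \<le> x \<Longrightarrow> cfq (a # w) x = (real a + cf_eval w x) * cfq w x"
proof (induction w arbitrary: a)
  case (Cons b w)
  have "cfq (b # w) x = (real b + cf_eval w x) * cfq w x" using Cons by auto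
  moreover have "real b + cf_eval w x > 0" using Cons cf_eval_nonneg[of x w] by auto
  ultimately show ?case by (simp add: field_simps)
qed auto

lemma cf_eval_append: "cf_eval (u @ v) x = cf_eval u (cf_eval v x)"
  by (induction u) auto

text \<open>The chain rule for Moebius maps: the denominator of a composition is the product of the
  denominators, the outer one taken at the image point. Both quasi-multiplicativity bounds follow
  because that point lies between 0 and 1.\<close>

lemma cfq_append: "positive_word (u @ v) \<Longrightarrow> 0 \<le> x \<Longrightarrow> cfq (u @ v) x = cfq u (cf_eval v x) * cfq v x"
proof (induction u)
  case (Cons a u)
  then have "cfq ((a # u) @ v) x = (real a + cf_eval (u @ v) x) * cfq (u @ v) x"
    using cfq_Cons[of a "u @ v" x] by simp
  also have "\<dots> = (real a + cf_eval u (cf_eval v x)) * cfq u (cf_eval v x) * cfq v x"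
    using Cons by (simp add: cf_eval_append)
  also have "\<dots> = cfq (a # u) (cf_eval v x) * cfq v x"
    using Cons cfq_Cons[of a u "cf_eval v x"] cf_eval_nonneg[of x v] by simp
  finally show ?case .
qed auto

lemma cfq_mono: "positive_word w \<Longrightarrow> 0 \<le> x \<Longrightarrow> x \<le> y \<Longrightarrow> cfq w x \<le> cfq w y"
  by (induction w x rule: cfq.induct) (auto intro!: add_mono mult_left_mono)

text \<open>The quantity is q_n + x q_{n-1} with q_{n-1} at most q_n. This is the source of the
  constants 2 and 4 in the distortion estimates.\<close>

lemma cfq_le_twice: "positive_word w \<Longrightarrow> 0 \<le> x \<Longrightarrow> x \<le> 1 \<Longrightarrow> cfq w x \<le> 2 * cfq w 0"
proof (induction w x rule: cfq.induct)
  case (3 a b as x)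
  have "real a * cfq (b # as) x \<le> real a * (2 * cfq (b # as) 0)"
    using 3 by (intro mult_left_mono) auto
  moreover have "cfq as x \<le> 2 * cfq as 0" using 3 by auto
  ultimately show ?case by (simp add: algebra_simps)
qed auto

lemma cfq_append_ge:
  assumes "positive_word u" "positive_word v"
  shows "cfq u 0 * cfq v 0 \<le> cfq (u @ v) 0"
proof -
  have "cfq u 0 \<le> cfq u (cf_eval v 0)" using assms cfq_mono cf_eval_nonneg by simp
  then show ?thesis using assms cfq_ge_1[of v 0] by (simp add: cfq_append mult_right_mono)
qed

lemma cfq_append_le:
  assumes "positive_word u" "positive_word v"
  shows "cfq (u @ v) 0 \<le> 2 * cfq u 0 * cfq v 0"
proof -
  have "cfq u (cf_eval v 0) \<le> 2 * cfq u 0" using assms cfq_le_twice cf_eval_nonneg cf_eval_le_1 by simp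
  then show ?thesis using assms cfq_ge_1[of v 0] by (simp add: cfq_append mult_right_mono)
qed

text \<open>\<open>cf_eval w\<close> is a Moebius map of determinant 1 or -1 with denominator
  \<open>cfq w\<close>, so a difference is divided by exactly the product of the denominators at the
  two points.\<close>

lemma cf_eval_diff:
  assumes "positive_word w" "0 \<le> x" "0 \<le> y"
  shows "\<bar>cf_eval w x - cf_eval w y\<bar> = \<bar>x - y\<bar> / (cfq w x * cfq w y)"
  using assms(1)
proof (induction w)
  case (Cons a w)
  define X Y where "X = real a + cf_eval w x" and "Y = real a + cf_eval w y"
  have pos: "X > 0" "Y > 0" using Cons cf_eval_nonneg[of x w] cf_eval_nonneg[of y w] assms
    unfolding X_def Y_def by auto
  have "cf_eval (a # w) x - cf_eval (a # w) y = (cf_eval w y - cf_eval w x) / (X * Y)"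
    using pos by (simp add: X_def[symmetric] Y_def[symmetric] field_simps) (simp add: X_def Y_def)
  then have "\<bar>cf_eval (a # w) x - cf_eval (a # w) y\<bar> = \<bar>cf_eval w x - cf_eval w y\<bar> / (X * Y)"
    using pos by (simp add: abs_mult abs_minus_commute)
  also have "\<dots> = \<bar>x - y\<bar> / (cfq w x * cfq w y) / (X * Y)" using Cons by simp
  also have "\<dots> = \<bar>x - y\<bar> / ((X * cfq w x) * (Y * cfq w y))" by (simp add: field_simps)
  also have "\<dots> = \<bar>x - y\<bar> / (cfq (a # w) x * cfq (a # w) y)"
    using Cons assms unfolding X_def Y_def by (simp add: cfq_Cons)
  finally show ?case .
qed auto

lemma cf_eval_diff_le:
  assumes "positive_word w" "0 \<le> x" "x \<le> 1" "0 \<le> y" "y \<le> 1"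
  shows "\<bar>cf_eval w x - cf_eval w y\<bar> \<le> \<bar>x - y\<bar> / (cfq w 0)\<^sup>2"
proof -
  have "cfq w 0 * cfq w 0 \<le> cfq w x * cfq w y" "cfq w 0 > 0"
    using assms cfq_mono[of w 0] cfq_ge_1[of w 0] cfq_ge_1[of w x] by (auto intro!: mult_mono)
  moreover from this have "cfq w x * cfq w y > 0" by (smt (verit) mult_pos_pos)
  ultimately show ?thesis unfolding cf_eval_diff[OF assms(1,2,4)] power2_eq_square
    by (intro divide_left_mono) (auto simp: mult_pos_pos)
qed

lemma cf_eval_diff_ge:
  assumes "positive_word w" "0 \<le> x" "x \<le> 1" "0 \<le> y" "y \<le> 1"
  shows "\<bar>x - y\<bar> / (4 * (cfq w 0)\<^sup>2) \<le> \<bar>cf_eval w x - cf_eval w y\<bar>"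
proof -
  have pos: "cfq w x > 0" "cfq w y > 0" "cfq w 0 > 0"
    using assms cfq_ge_1[of w y] cfq_ge_1[of w x] cfq_ge_1[of w 0] by auto
  have "cfq w x * cfq w y \<le> (2 * cfq w 0) * (2 * cfq w 0)"
    using assms cfq_le_twice[of w] pos by (intro mult_mono) auto
  then show ?thesis unfolding cf_eval_diff[OF assms(1,2,4)] power2_eq_square
    using pos by (intro divide_left_mono) auto
qed

text \<open>Two further digits at least double the denominator. For its square this is one factor 2
  per digit; the extra 2 on the right pays for odd lengths, with equality at
  \<open>[1]\<close>.\<close>

lemma cfq_growth: "positive_word w \<Longrightarrow> 2 ^ length w \<le> 2 * (cfq w 0)\<^sup>2"
proof (induction w "0::real" rule: cfq.induct)
  case (2 a)
  then have "1 \<le> (real a)\<^sup>2" by auto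
  then show ?case by simp
next
  case (3 a b as)
  have q1: "cfq as 0 \<ge> 1" using 3 cfq_ge_1 by auto
  have "1 * cfq as 0 \<le> real b * cfq as 0" using 3 q1 by (intro mult_right_mono) auto
  also have "\<dots> \<le> cfq (b # as) 0" using cfq_append_ge[of "[b]" as] 3 by simp
  finally have "cfq as 0 \<le> cfq (b # as) 0" by simp
  then have "1 * cfq as 0 \<le> real a * cfq (b # as) 0" using 3 q1 by (intro mult_mono) auto
  then have "2 * cfq as 0 \<le> cfq (a # b # as) 0" by simp
  then have "(2 * cfq as 0)\<^sup>2 \<le> (cfq (a # b # as) 0)\<^sup>2" using q1 by (intro power_mono) auto
  moreover have "2 ^ length as \<le> 2 * (cfq as 0)\<^sup>2" using 3 by auto
  ultimately show ?case by (simp add: power_mult_distrib)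
qed auto

section \<open>Infinite continued fractions\<close>

definition cf_val :: "(nat \<Rightarrow> nat) \<Rightarrow> real" where
  "cf_val a = lim (\<lambda>n. cf_eval (map a [0..<n]) 0)"

lemma map_upt_shift: "map a [0..<m + n] = map a [0..<m] @ map (\<lambda>i. a (i + m)) [0..<n]"
  by (rule nth_equalityI) (auto simp: nth_append)

text \<open>All later approximants lie in the closed cylinder of the first m digits, whose length is
  at most 1 / q_m^2, and this decays geometrically by \<open>cfq_growth\<close>.\<close>

lemma cf_eval_prefix_tendsto:
  assumes "\<forall>i. a i \<ge> (1::nat)"
  shows "(\<lambda>n. cf_eval (map a [0..<n]) 0) \<longlonglongrightarrow> cf_val a"
proof -
  have pw: "positive_word (map b [0..<n])" if "\<forall>i. b i \<ge> (1::nat)" for b n using that by auto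
  have bd: "\<bar>cf_eval (map a [0..<m + n]) 0 - cf_eval (map a [0..<m]) 0\<bar> \<le> 2 / 2 ^ m" for m n
  proof -
    define t where "t = cf_eval (map (\<lambda>i. a (i + m)) [0..<n]) 0"
    have t: "0 \<le> t" "t \<le> 1" unfolding t_def using pw assms by (intro cf_eval_nonneg cf_eval_le_1; simp)+
    have q: "2 ^ m \<le> 2 * (cfq (map a [0..<m]) 0)\<^sup>2" "cfq (map a [0..<m]) 0 \<ge> 1"
      using cfq_growth[OF pw[of a m]] cfq_ge_1[OF pw[of a m], of 0] assms by auto
    have "\<bar>cf_eval (map a [0..<m + n]) 0 - cf_eval (map a [0..<m]) 0\<bar> \<le> \<bar>t - 0\<bar> / (cfq (map a [0..<m]) 0)\<^sup>2"
      unfolding map_upt_shift cf_eval_append t_def[symmetric] using t assms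
      by (intro cf_eval_diff_le) auto
    also have "\<dots> \<le> 1 / (cfq (map a [0..<m]) 0)\<^sup>2" using t by (intro divide_right_mono) auto
    also have "\<dots> \<le> 2 / 2 ^ m" using q by (simp add: field_simps)
    finally show ?thesis .
  qed
  have "Cauchy (\<lambda>n. cf_eval (map a [0..<n]) 0)"
  proof (rule metric_CauchyI)
    fix e :: real assume "e > 0"
    then obtain M where M: "(1 / 2) ^ M < e / 4" using real_arch_pow_inv[of "e / 4" "1 / 2"] by auto
    then have M': "2 / 2 ^ M < e / 2" by (simp add: field_simps)
    show "\<exists>M. \<forall>m\<ge>M. \<forall>n\<ge>M. dist (cf_eval (map a [0..<m]) 0) (cf_eval (map a [0..<n]) 0) < e"
    proof (intro exI[of _ M] allI impI)
      fix m n assume mn: "m \<ge> M" "n \<ge> M"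
      have "\<bar>cf_eval (map a [0..<m]) 0 - cf_eval (map a [0..<M]) 0\<bar> \<le> 2 / 2 ^ M"
        "\<bar>cf_eval (map a [0..<n]) 0 - cf_eval (map a [0..<M]) 0\<bar> \<le> 2 / 2 ^ M"
        using bd[of M "m - M"] bd[of M "n - M"] mn by simp_all
      then show "dist (cf_eval (map a [0..<m]) 0) (cf_eval (map a [0..<n]) 0) < e"
        unfolding dist_real_def using M' by linarith
    qed
  qed
  then show ?thesis unfolding cf_val_def by (simp add: Cauchy_convergent_iff convergent_LIMSEQ_iff)
qed

lemma cf_val_unfold:
  assumes "\<forall>i. a i \<ge> (1::nat)"
  shows "cf_val a = 1 / (real (a 0) + cf_val (\<lambda>i. a (Suc i)))"
    and "0 < cf_val a" and "cf_val a < 1"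
proof -
  \<comment> \<open>Proved for every positive sequence, because the strict bounds apply it to
    shifted sequences as well.\<close>
  have A: "cf_val a \<ge> 0 \<and> cf_val a = 1 / (real (a 0) + cf_val (\<lambda>i. a (Suc i)))"
    if a: "\<forall>i. a i \<ge> (1::nat)" for a
  proof -
    have lim: "(\<lambda>n. cf_eval (map a [0..<n]) 0) \<longlonglongrightarrow> cf_val a"
      and lim': "(\<lambda>n. cf_eval (map (\<lambda>i. a (Suc i)) [0..<n]) 0) \<longlonglongrightarrow> cf_val (\<lambda>i. a (Suc i))"
      using a cf_eval_prefix_tendsto by auto
    have nn: "cf_val a \<ge> 0" by (rule LIMSEQ_le_const[OF lim]) (auto intro!: cf_eval_nonneg)
    have nn': "cf_val (\<lambda>i. a (Suc i)) \<ge> 0" by (rule LIMSEQ_le_const[OF lim']) (auto intro!: cf_eval_nonneg)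
    have "(\<lambda>n. cf_eval (map a [0..<Suc n]) 0) = (\<lambda>n. 1 / (real (a 0) + cf_eval (map (\<lambda>i. a (Suc i)) [0..<n]) 0))"
    proof
      fix n show "cf_eval (map a [0..<Suc n]) 0 = 1 / (real (a 0) + cf_eval (map (\<lambda>i. a (Suc i)) [0..<n]) 0)"
        using map_upt_shift[of a 1 n] by simp
    qed
    moreover have "(\<lambda>n. 1 / (real (a 0) + cf_eval (map (\<lambda>i. a (Suc i)) [0..<n]) 0))
        \<longlonglongrightarrow> 1 / (real (a 0) + cf_val (\<lambda>i. a (Suc i)))"
      using a nn' by (intro tendsto_intros lim') (auto simp: add_nonneg_eq_0_iff dest: spec[of _ 0])
    ultimately have "(\<lambda>n. cf_eval (map a [0..<Suc n]) 0) \<longlonglongrightarrow> 1 / (real (a 0) + cf_val (\<lambda>i. a (Suc i)))" by simp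
    then show ?thesis using LIMSEQ_Suc[OF lim] LIMSEQ_unique nn by blast
  qed
  have pos: "0 < cf_val a" if a: "\<forall>i. a i \<ge> (1::nat)" for a
  proof -
    have "cf_val (\<lambda>i. a (Suc i)) \<ge> 0" using conjunct1[OF A[of "\<lambda>i. a (Suc i)"]] a by simp
    moreover have "real (a 0) \<ge> 1" using a by simp
    moreover have "cf_val a = 1 / (real (a 0) + cf_val (\<lambda>i. a (Suc i)))" using conjunct2[OF A[of a]] a by simp
    ultimately show ?thesis by simp
  qed
  show 1: "cf_val a = 1 / (real (a 0) + cf_val (\<lambda>i. a (Suc i)))" using conjunct2[OF A[of a]] assms by simp
  show "0 < cf_val a" using pos[of a] assms by simp
  have "cf_val (\<lambda>i. a (Suc i)) > 0" using pos[of "\<lambda>i. a (Suc i)"] assms by simp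
  moreover have "real (a 0) \<ge> 1" using assms by simp
  ultimately show "cf_val a < 1" unfolding 1 by simp
qed

lemma gauss_map_cf:
  assumes "a \<ge> (1::nat)" "0 < z" "z < 1"
  shows "gauss_map (1 / (real a + z)) = z" "nat \<lfloor>1 / (1 / (real a + z))\<rfloor> = a"
proof -
  have "\<lfloor>real a + z\<rfloor> = int a" using assms by (simp add: floor_eq_iff)
  then show "gauss_map (1 / (real a + z)) = z" "nat \<lfloor>1 / (1 / (real a + z))\<rfloor> = a"
    using assms by (auto simp: gauss_map_def)
qed

lemma gauss_map_cf_val:
  assumes "\<forall>i. a i \<ge> (1::nat)"
  shows "(gauss_map ^^ n) (cf_val a) = cf_val (\<lambda>i. a (i + n))"
  using assms
proof (induction n arbitrary: a)
  case (Suc n)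
  have "gauss_map (cf_val a) = cf_val (\<lambda>i. a (Suc i))"
    using gauss_map_cf[of "a 0" "cf_val (\<lambda>i. a (Suc i))"] Suc.prems
      cf_val_unfold(1)[of a] cf_val_unfold(2,3)[of "\<lambda>i. a (Suc i)"] by simp
  then show ?case using Suc.IH[of "\<lambda>i. a (Suc i)"] Suc.prems by (simp add: funpow_swap1)
qed auto

lemma partial_quotient_cf_val:
  assumes "\<forall>i. a i \<ge> (1::nat)"
  shows "partial_quotient (Suc n) (cf_val a) = a n"
proof -
  have "cf_val (\<lambda>i. a (i + n)) = 1 / (real (a n) + cf_val (\<lambda>i. a (Suc i + n)))"
    using cf_val_unfold(1)[of "\<lambda>i. a (i + n)"] assms by simp
  then show ?thesis
    using gauss_map_cf(2)[of "a n" "cf_val (\<lambda>i. a (Suc i + n))"] assms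
      cf_val_unfold(2,3)[of "\<lambda>i. a (Suc i + n)"]
    by (simp add: partial_quotient_def gauss_map_cf_val[OF assms])
qed

lemma cf_val_in_cf_domain:
  assumes "\<forall>i. a i \<ge> (1::nat)"
  shows "cf_val a \<in> cf_domain"
proof -
  have "partial_quotient n (cf_val a) \<ge> 1" if "n \<ge> 1" for n
    using partial_quotient_cf_val[OF assms, of "n - 1"] assms that by simp
  moreover have "0 < cf_val a" "cf_val a < 1" using cf_val_unfold(2,3)[of a, OF assms] by blast+
  ultimately show ?thesis by (auto simp: cf_domain_def)
qed

lemma cf_val_split:
  assumes "\<forall>i. a i \<ge> (1::nat)"
  shows "cf_val a = cf_eval (map a [0..<n]) (cf_val (\<lambda>i. a (i + n)))"
  using assms
proof (induction n arbitrary: a)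
  case (Suc n)
  have "cf_val a = 1 / (real (a 0) + cf_val (\<lambda>i. a (Suc i)))"
    using cf_val_unfold(1)[of a] Suc.prems by simp
  also have "cf_val (\<lambda>i. a (Suc i)) = cf_eval (map (\<lambda>i. a (Suc i)) [0..<n]) (cf_val (\<lambda>i. a (Suc (i + n))))"
    using Suc.IH[of "\<lambda>i. a (Suc i)"] Suc.prems by simp
  finally show ?case using map_upt_shift[of a 1 n] by simp
qed auto

lemma cf_domain_pos: "x \<in> cf_domain \<Longrightarrow> 0 < x \<and> x < 1"
proof -
  assume x: "x \<in> cf_domain"
  have "x \<noteq> 0"
  proof
    assume "x = 0"
    then have "partial_quotient 1 x = 0" by (simp add: partial_quotient_def)
    then show False using x by (auto simp: cf_domain_def)
  qed
  then show ?thesis using x by (auto simp: cf_domain_def)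
qed

lemma gauss_map_range: "0 \<le> gauss_map x" "gauss_map x < 1"
  by (auto simp: gauss_map_def frac_def[symmetric] frac_lt_1)

lemma gauss_map_cf_domain: "x \<in> cf_domain \<Longrightarrow> gauss_map x \<in> cf_domain"
proof -
  assume x: "x \<in> cf_domain"
  have "partial_quotient n (gauss_map x) = partial_quotient (Suc n) x" if "n \<ge> 1" for n
    using that by (cases n) (auto simp: partial_quotient_def funpow_swap1)
  then show ?thesis using x gauss_map_range by (auto simp: cf_domain_def)
qed

lemma cf_domain_step:
  assumes "x \<in> cf_domain"
  shows "x = 1 / (real (partial_quotient 1 x) + gauss_map x)"
proof -
  have x: "0 < x" "x < 1" using cf_domain_pos assms by auto
  then have "1 < 1 / x" by simp
  then have "\<lfloor>1 / x\<rfloor> \<ge> 0" by linarith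
  then have "real (nat \<lfloor>1 / x\<rfloor>) = of_int \<lfloor>1 / x\<rfloor>" by simp
  then show ?thesis using x by (simp add: partial_quotient_def gauss_map_def)
qed

lemma funpow_gauss_map_cf_domain: "x \<in> cf_domain \<Longrightarrow> (gauss_map ^^ n) x \<in> cf_domain"
  by (induction n) (auto intro: gauss_map_cf_domain)

lemma cf_domain_split:
  assumes "x \<in> cf_domain"
  shows "x = cf_eval (map (\<lambda>k. partial_quotient (Suc k) x) [0..<n]) ((gauss_map ^^ n) x)"
proof (induction n)
  case (Suc n)
  define y where "y = (gauss_map ^^ n) x"
  have "y = 1 / (real (partial_quotient 1 y) + gauss_map y)"
    using cf_domain_step funpow_gauss_map_cf_domain assms unfolding y_def by blast
  also have "partial_quotient 1 y = partial_quotient (Suc n) x" by (simp add: y_def partial_quotient_def)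
  finally have "y = cf_eval [partial_quotient (Suc n) x] (gauss_map y)" by simp
  then show ?case using Suc unfolding y_def by (simp add: cf_eval_append)
qed auto

lemma gauss_map_cf_eval:
  assumes "positive_word w" "0 < x" "x < 1" "k \<le> length w"
  shows "(gauss_map ^^ k) (cf_eval w x) = cf_eval (drop k w) x"
  using assms(4)
proof (induction k)
  case (Suc k)
  define a where "a = w ! k"
  have d: "drop k w = a # drop (Suc k) w" using Suc a_def by (simp add: Cons_nth_drop_Suc)
  have "w ! k \<in> set w" using Suc by simp
  then have pw: "positive_word (drop (Suc k) w)" "a \<ge> 1" using assms(1) a_def set_drop_subset[of "Suc k" w] by auto
  have "gauss_map (cf_eval (drop k w) x) = cf_eval (drop (Suc k) w) x"
    unfolding d cf_eval.simps using pw assms by (intro gauss_map_cf cf_eval_gt_0 cf_eval_less_1) auto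
  then show ?case using Suc by simp
qed auto

section \<open>Sums over words\<close>

text \<open>Truncating the alphabet keeps the sums finite; the full alphabet is recovered by letting
  \<open>M\<close> tend to infinity.\<close>

definition words :: "nat \<Rightarrow> nat \<Rightarrow> nat list set" where
  "words M n = {w. set w \<subseteq> {1..M} \<and> length w = n}"

lemma finite_words [simp]: "finite (words M n)"
  unfolding words_def by (rule finite_lists_length_eq) simp

lemma words_positive: "w \<in> words M n \<Longrightarrow> positive_word w"
  by (auto simp: words_def)

lemma words_0 [simp]: "words M 0 = {[]}"
  by (auto simp: words_def)

lemma words_mono: "M \<le> N \<Longrightarrow> words M n \<subseteq> words N n"
  by (fastforce simp: words_def)

lemma sum_words_add: "sum g (words M (m + n)) = (\<Sum>u\<in>words M m. \<Sum>v\<in>words M n. g (u @ v))"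
proof -
  have "bij_betw (\<lambda>(u, v). u @ v) (words M m \<times> words M n) (words M (m + n))"
  proof (rule bij_betw_byWitness[where f' = "\<lambda>w. (take m w, drop m w)"])
    show "(\<lambda>w. (take m w, drop m w)) ` words M (m + n) \<subseteq> words M m \<times> words M n"
      by (auto simp: words_def dest!: in_set_takeD in_set_dropD)
  qed (auto simp: words_def subset_iff)
  then have "sum g (words M (m + n)) = (\<Sum>(u, v)\<in>words M m \<times> words M n. g (u @ v))"
    by (simp add: sum.reindex_bij_betw[symmetric] case_prod_beta)
  then show ?thesis by (simp add: sum.cartesian_product)
qed

lemma words_1: "words M (Suc 0) = (\<lambda>a. [a]) ` {1..M}"
  by (auto simp: words_def length_Suc_conv)

lemma sum_words_1: "sum g (words M (Suc 0)) = (\<Sum>a=1..M. g [a])"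
  unfolding words_1 by (subst sum.reindex) (auto simp: inj_on_def)

lemma sum_words_Suc: "sum g (words M (Suc n)) = (\<Sum>u\<in>words M n. \<Sum>a=1..M. g (u @ [a]))"
  using sum_words_add[of g M n 1] by (simp add: sum_words_1)

definition word_sum :: "nat \<Rightarrow> real \<Rightarrow> nat \<Rightarrow> real" where
  "word_sum M s n = (\<Sum>w\<in>words M n. cfq w 0 powr (- 2 * s))"

lemma word_sum_nonneg: "0 \<le> word_sum M s n"
  unfolding word_sum_def by (intro sum_nonneg) auto

lemma word_sum_0 [simp]: "word_sum M s 0 = 1"
  by (simp add: word_sum_def)

lemma word_sum_1: "word_sum M s (Suc 0) = (\<Sum>a=1..M. real a powr (- 2 * s))"
  by (simp add: word_sum_def sum_words_1)

lemma word_sum_mono: "M \<le> N \<Longrightarrow> word_sum M s n \<le> word_sum N s n"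
  unfolding word_sum_def by (intro sum_mono2 words_mono) auto

lemma word_sum_add_le:
  assumes "s \<ge> 0"
  shows "word_sum M s (m + n) \<le> word_sum M s m * word_sum M s n"
proof -
  have "cfq (u @ v) 0 powr (- 2 * s) \<le> cfq u 0 powr (- 2 * s) * cfq v 0 powr (- 2 * s)"
    if "u \<in> words M m" "v \<in> words M n" for u v
  proof -
    have p: "positive_word u" "positive_word v" using that words_positive by auto
    then have q: "cfq u 0 \<ge> 1" "cfq v 0 \<ge> 1" using cfq_ge_1 by auto
    have "cfq (u @ v) 0 powr (- 2 * s) \<le> (cfq u 0 * cfq v 0) powr (- 2 * s)"
      using assms q cfq_append_ge[OF p] by (intro powr_mono2') auto
    then show ?thesis using q by (simp add: powr_mult)
  qed
  then show ?thesis unfolding word_sum_def sum_words_add sum_product by (intro sum_mono) auto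
qed

text \<open>The factor \<open>4 powr (- s)\<close> is the 2 of \<open>cfq_append_le\<close> raised
  to the power \<open>- 2 * s\<close>.\<close>

lemma word_sum_add_ge:
  assumes "s \<ge> 0"
  shows "4 powr (- s) * word_sum M s m * word_sum M s n \<le> word_sum M s (m + n)"
proof -
  have "4 powr (- s) * cfq u 0 powr (- 2 * s) * cfq v 0 powr (- 2 * s) \<le> cfq (u @ v) 0 powr (- 2 * s)"
    if "u \<in> words M m" "v \<in> words M n" for u v
  proof -
    have p: "positive_word u" "positive_word v" using that words_positive by auto
    then have q: "cfq u 0 \<ge> 1" "cfq v 0 \<ge> 1" "cfq (u @ v) 0 \<ge> 1" using cfq_ge_1 by auto
    have "(2 * cfq u 0 * cfq v 0) powr (- 2 * s) \<le> cfq (u @ v) 0 powr (- 2 * s)"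
      using assms q cfq_append_le[OF p] by (intro powr_mono2') auto
    moreover have "(2::real) powr (- 2 * s) = 4 powr (- s)"
      using powr_powr[of 2 2 "- s"] by simp
    ultimately show ?thesis using q by (simp add: powr_mult)
  qed
  then show ?thesis unfolding word_sum_def sum_words_add sum_distrib_left sum_distrib_right
    by (subst sum.swap) (auto intro!: sum_mono simp: mult.assoc)
qed

lemma word_sum_pos: "M \<ge> 1 \<Longrightarrow> 0 < word_sum M s n"
proof -
  assume "M \<ge> 1"
  then have "replicate n 1 \<in> words M n" by (auto simp: words_def)
  then have "cfq (replicate n 1) 0 powr (- 2 * s) \<le> word_sum M s n"
    unfolding word_sum_def by (intro member_le_sum) auto
  moreover have "cfq (replicate n 1) 0 > 0" using cfq_ge_1[of "replicate n 1" 0] by fastforce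
  ultimately show ?thesis by (smt (verit) powr_gt_zero)
qed

lemma sum_powr_bounded:
  assumes "p > 1"
  obtains K where "K \<ge> 1" "\<And>M. (\<Sum>a=1..M. real a powr (- p)) \<le> K"
proof
  define K where "K = (\<Sum>a. real a powr (- p))"
  have sm: "summable (\<lambda>a. real a powr (- p))" using assms by (simp add: summable_real_powr_iff)
  show "(\<Sum>a=1..M. real a powr (- p)) \<le> max 1 K" for M
    using sum_le_suminf[OF sm, of "{1..M}"] unfolding K_def by auto
qed auto

lemma word_sum_le_power:
  assumes "s \<ge> 0"
  shows "word_sum M s n \<le> (word_sum M s 1) ^ n"
proof (induction n)
  case (Suc n)
  have "word_sum M s (Suc n) \<le> word_sum M s 1 * word_sum M s n" using word_sum_add_le[OF assms, of M 1 n] by simp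
  also have "\<dots> \<le> word_sum M s 1 * word_sum M s 1 ^ n" using Suc by (intro mult_left_mono word_sum_nonneg) auto
  finally show ?case by simp
qed auto

section \<open>The limit over the alphabets and the pressure function\<close>

definition cf_lim :: "real \<Rightarrow> nat \<Rightarrow> real" where
  "cf_lim s n = lim (\<lambda>M. word_sum M s n)"

text \<open>Submultiplicativity bounds the sums by powers of the one-digit sum, and for
  \<open>s > 1 / 2\<close> that sum is bounded uniformly in \<open>M\<close>.\<close>

lemma
  assumes "s > 1 / 2"
  shows word_sum_tendsto: "(\<lambda>M. word_sum M s n) \<longlonglongrightarrow> cf_lim s n"
    and word_sum_le_cf_lim: "word_sum M s n \<le> cf_lim s n"
proof -
  have inc: "incseq (\<lambda>M. word_sum M s n)" by (simp add: incseq_def word_sum_mono)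
  obtain K where K: "K \<ge> 1" "\<And>M. (\<Sum>a=1..M. real a powr (- (2 * s))) \<le> K"
    using sum_powr_bounded[of "2 * s"] assms by auto
  have "word_sum M s n \<le> K ^ n" for M
  proof -
    have "word_sum M s n \<le> (word_sum M s 1) ^ n" using assms by (intro word_sum_le_power) auto
    also have "\<dots> \<le> K ^ n" using K by (intro power_mono word_sum_nonneg) (simp add: word_sum_1)
    finally show ?thesis .
  qed
  then obtain l where l: "(\<lambda>M. word_sum M s n) \<longlonglongrightarrow> l" using incseq_convergent[OF inc, of "K ^ n"] by blast
  then show lim: "(\<lambda>M. word_sum M s n) \<longlonglongrightarrow> cf_lim s n" by (simp add: cf_lim_def limI)
  show "word_sum M s n \<le> cf_lim s n" by (rule incseq_le[OF inc lim])
qed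

lemma cf_lim_pos: "s > 1 / 2 \<Longrightarrow> 0 < cf_lim s n"
  using word_sum_le_cf_lim[of s 1 n] word_sum_pos[of 1 s n] by linarith

lemma cf_lim_add_le: "s > 1 / 2 \<Longrightarrow> cf_lim s (m + n) \<le> cf_lim s m * cf_lim s n"
  by (rule LIMSEQ_le[OF word_sum_tendsto tendsto_mult[OF word_sum_tendsto word_sum_tendsto]]) (auto intro!: word_sum_add_le)

lemma cf_lim_add_ge: "s > 1 / 2 \<Longrightarrow> 4 powr (- s) * cf_lim s m * cf_lim s n \<le> cf_lim s (m + n)"
  by (rule LIMSEQ_le[OF tendsto_mult[OF tendsto_mult[OF tendsto_const word_sum_tendsto] word_sum_tendsto] word_sum_tendsto])
    (auto intro!: word_sum_add_ge)

text \<open>A two-sided form of Fekete's lemma. Evaluating \<open>x\<close> at \<open>m * n\<close>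
  in two ways shows that \<open>x m / m\<close> and \<open>x n / n\<close> differ by at most
  \<open>C / m + C / n\<close>, which gives convergence; letting \<open>m\<close> tend to infinity
  then yields an error bounded uniformly in \<open>n\<close>, not merely of order o(n).\<close>

lemma quasi_additive_limit:
  fixes x :: "nat \<Rightarrow> real"
  assumes "\<And>m n. \<bar>x (m + n) - x m - x n\<bar> \<le> C"
  obtains L where "(\<lambda>n. x n / real n) \<longlonglongrightarrow> L" "\<And>n. \<bar>x n - real n * L\<bar> \<le> C"
proof -
  have C: "C \<ge> 0" using assms[of 0 0] by linarith
  have mult: "\<bar>x (Suc k * n) - real (Suc k) * x n\<bar> \<le> real (Suc k) * C" for k n
  proof (induction k)
    case (Suc k)
    then show ?case using assms[of n "Suc k * n"] by (simp add: algebra_simps abs_le_iff)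
  qed (use C in simp)
  have dist: "\<bar>x m / real m - x n / real n\<bar> \<le> C / real m + C / real n" if mn: "m \<ge> 1" "n \<ge> 1" for m n
  proof -
    have "\<bar>real n * x m - real m * x n\<bar> \<le> real n * C + real m * C"
      using mult[of "n - 1" m] mult[of "m - 1" n] mn by (simp add: mult.commute abs_le_iff)
    then have "\<bar>real n * x m - real m * x n\<bar> / (real m * real n) \<le> (real n * C + real m * C) / (real m * real n)"
      by (intro divide_right_mono) auto
    moreover have "x m / real m - x n / real n = (real n * x m - real m * x n) / (real m * real n)"
      using mn by (simp add: field_simps)
    moreover have "(real n * C + real m * C) / (real m * real n) = C / real m + C / real n"
      using mn by (simp add: field_simps)
    ultimately show ?thesis using mn by (simp add: abs_divide)
  qed
  have "Cauchy (\<lambda>n. x n / real n)"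
  proof (rule metric_CauchyI)
    fix e :: real assume e: "e > 0"
    obtain N :: nat where N: "2 * (C + 1) / e < real N" using reals_Archimedean2 by blast
    then have N0: "N \<ge> 1" using C e by (cases N) (auto simp: field_simps)
    have small: "C / real m < e / 2" if "m \<ge> N" for m
    proof -
      have "2 * (C + 1) < real N * e" using N e by (simp add: field_simps)
      also have "\<dots> \<le> real m * e" using that e by simp
      finally show ?thesis using that N0 by (simp add: field_simps)
    qed
    show "\<exists>M. \<forall>m\<ge>M. \<forall>n\<ge>M. dist (x m / real m) (x n / real n) < e"
    proof (intro exI[of _ N] allI impI)
      fix m n assume "m \<ge> N" "n \<ge> N"
      then show "dist (x m / real m) (x n / real n) < e"
        using small[of m] small[of n] dist[of m n] N0 unfolding dist_real_def by linarith
    qed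
  qed
  then obtain L where L: "(\<lambda>n. x n / real n) \<longlonglongrightarrow> L" using Cauchy_convergent convergent_def by blast
  have "\<bar>x n - real n * L\<bar> \<le> C" for n
  proof (cases "n = 0")
    case True then show ?thesis using assms[of 0 0] by simp
  next
    case False
    have "(\<lambda>m. \<bar>x m / real m - x n / real n\<bar>) \<longlonglongrightarrow> \<bar>L - x n / real n\<bar>"
      by (intro tendsto_intros L)
    moreover have "(\<lambda>m. C / real m + C / real n) \<longlonglongrightarrow> 0 + C / real n"
      by (intro tendsto_intros lim_const_over_n)
    ultimately have "\<bar>L - x n / real n\<bar> \<le> 0 + C / real n"
      by (rule LIMSEQ_le) (use dist False in \<open>auto intro!: exI[of _ 1]\<close>)
    then have "\<bar>L - x n / real n\<bar> * real n \<le> C" using False by (simp add: field_simps)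
    moreover have "\<bar>L - x n / real n\<bar> * real n = \<bar>(L - x n / real n) * real n\<bar>" by (simp add: abs_mult)
    moreover have "(L - x n / real n) * real n = L * real n - x n" using False by (simp add: field_simps)
    ultimately show ?thesis by (simp add: abs_minus_commute mult.commute)
  qed
  then show ?thesis using L that by blast
qed

text \<open>The pressure of \<open>- s log |T'|\<close> for \<open>s > 1 / 2\<close>, as
  \<open>pressure_geometric_potential\<close> confirms with \<open>c = 0\<close>.\<close>

definition cf_pressure :: "real \<Rightarrow> real" where
  "cf_pressure s = lim (\<lambda>n. ln (cf_lim s n) / real n)"

lemma ln_cf_lim:
  assumes s: "s > 1 / 2"
  shows "\<bar>ln (cf_lim s n) - real n * cf_pressure s\<bar> \<le> s * ln 4"
proof -
  have "\<bar>ln (cf_lim s (m + n)) - ln (cf_lim s m) - ln (cf_lim s n)\<bar> \<le> s * ln 4" for m n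
  proof -
    have p: "cf_lim s m > 0" "cf_lim s n > 0" "cf_lim s (m + n) > 0" using cf_lim_pos[OF s] by auto
    have "ln (cf_lim s (m + n)) \<le> ln (cf_lim s m * cf_lim s n)" using p cf_lim_add_le[OF s] by simp
    moreover have "ln (4 powr (- s) * cf_lim s m * cf_lim s n) \<le> ln (cf_lim s (m + n))"
      using p cf_lim_add_ge[OF s] by simp
    moreover have "ln (4 powr (- s) * cf_lim s m * cf_lim s n) = - s * ln 4 + ln (cf_lim s m) + ln (cf_lim s n)"
      using p by (simp add: ln_mult ln_powr)
    ultimately show ?thesis using p s by (simp add: ln_mult abs_le_iff)
  qed
  then obtain L where L: "(\<lambda>n. ln (cf_lim s n) / real n) \<longlonglongrightarrow> L"
      "\<And>n. \<bar>ln (cf_lim s n) - real n * L\<bar> \<le> s * ln 4"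
    using quasi_additive_limit[of "\<lambda>n. ln (cf_lim s n)" "s * ln 4"] by metis
  then have "cf_pressure s = L" by (simp add: cf_pressure_def limI)
  then show ?thesis using L by simp
qed

lemma word_sum_le_exp_pressure:
  assumes "s > 1 / 2"
  shows "word_sum M s n \<le> 4 powr s * exp (real n * cf_pressure s)"
proof -
  have "ln (cf_lim s n) \<le> s * ln 4 + real n * cf_pressure s" using ln_cf_lim[OF assms, of n] by linarith
  then have "cf_lim s n \<le> exp (s * ln 4 + real n * cf_pressure s)"
    using cf_lim_pos[OF assms, of n] by (metis exp_le_cancel_iff exp_ln)
  then show ?thesis using word_sum_le_cf_lim[OF assms, of M n] by (simp add: powr_def exp_add)
qed

lemma linear_bound_nonpos:
  fixes a C :: real
  assumes "\<And>n. real n * a \<le> C"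
  shows "a \<le> 0"
proof (rule ccontr)
  assume "\<not> a \<le> 0"
  then obtain n where "C < real n * a" using reals_Archimedean3[of a] by auto
  then show False using assms[of n] by simp
qed

text \<open>By \<open>cfq_growth\<close> every term loses at least the factor
  \<open>(2 ^ n / 2) powr (- (s' - s))\<close>. The definite slope \<open>ln 2\<close> gives the
  room for perturbing \<open>s\<close> in the upper bound on the dimension.\<close>

lemma cf_pressure_decreasing:
  assumes "1 / 2 < s" "s \<le> s'"
  shows "cf_pressure s' \<le> cf_pressure s - (s' - s) * ln 2"
proof -
  have Zle: "word_sum M s' n \<le> word_sum M s n * (2 ^ n / 2) powr (- (s' - s))" for M n
  proof -
    have "cfq w 0 powr (- 2 * s') \<le> cfq w 0 powr (- 2 * s) * (2 ^ n / 2) powr (- (s' - s))" if "w \<in> words M n" for w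
    proof -
      have w: "positive_word w" "length w = n" using that words_positive by (auto simp: words_def)
      have q: "cfq w 0 \<ge> 1" using w cfq_ge_1 by auto
      have "2 ^ n / 2 \<le> (cfq w 0)\<^sup>2" using cfq_growth[OF w(1)] w by simp
      then have "((cfq w 0)\<^sup>2) powr (- (s' - s)) \<le> (2 ^ n / 2) powr (- (s' - s))"
        using assms by (intro powr_mono2') auto
      moreover have "((cfq w 0)\<^sup>2) powr (- (s' - s)) = cfq w 0 powr (- 2 * (s' - s))"
        using q powr_powr[of "cfq w 0" 2 "- (s' - s)"] by (simp add: powr_numeral)
      moreover have "cfq w 0 powr (- 2 * s') = cfq w 0 powr (- 2 * s) * cfq w 0 powr (- 2 * (s' - s))"
        by (simp add: powr_add[symmetric] algebra_simps)
      ultimately show ?thesis by (simp add: mult_left_mono)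
    qed
    then show ?thesis unfolding word_sum_def sum_distrib_right by (intro sum_mono) auto
  qed
  have s': "s' > 1 / 2" using assms by simp
  have "real n * (cf_pressure s' - cf_pressure s + (s' - s) * ln 2) \<le> s * ln 4 + s' * ln 4 + (s' - s) * ln 2" for n
  proof -
    have "cf_lim s' n \<le> cf_lim s n * (2 ^ n / 2) powr (- (s' - s))"
      by (rule LIMSEQ_le[OF word_sum_tendsto tendsto_mult[OF word_sum_tendsto tendsto_const]]) (use Zle s' assms in auto)
    then have "ln (cf_lim s' n) \<le> ln (cf_lim s n * (2 ^ n / 2) powr (- (s' - s)))"
      using cf_lim_pos[OF s', of n] by simp
    also have "\<dots> = ln (cf_lim s n) - (s' - s) * (real n * ln 2 - ln 2)"
      using cf_lim_pos[OF assms(1), of n] by (simp add: ln_mult ln_powr ln_div ln_realpow algebra_simps)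
    finally show ?thesis using ln_cf_lim[OF assms(1), of n] ln_cf_lim[OF s', of n]
      by (simp add: algebra_simps abs_le_iff)
  qed
  then have "cf_pressure s' - cf_pressure s + (s' - s) * ln 2 \<le> 0" by (rule linear_bound_nonpos)
  then show ?thesis by simp
qed

text \<open>The slope \<open>cfq w 1 - cfq w 0\<close> is q_{n-1}.\<close>

lemma cfq_affine: "cfq w x = cfq w 0 + x * (cfq w 1 - cfq w 0)"
proof (induction w x rule: cfq.induct)
  case (3 a b as x)
  show ?case unfolding cfq.simps
    by (subst 3(1), subst 3(2)) (simp add: algebra_simps)
qed auto

text \<open>By \<open>cf_eval_diff\<close> at 0 and 1 the summand is the length of the cylinder of
  \<open>w\<close>, and the children of a cylinder are adjacent subintervals of it.\<close>

lemma sum_cylinder_lengths_le: "(\<Sum>w\<in>words M n. 1 / (cfq w 0 * cfq w 1)) \<le> 1"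
proof (induction n)
  case (Suc n)
  have "(\<Sum>a=1..M. 1 / (cfq (u @ [a]) 0 * cfq (u @ [a]) 1)) \<le> 1 / (cfq u 0 * cfq u 1)" if "u \<in> words M n" for u
  proof -
    \<comment> \<open>\<open>F x\<close> is the distance from \<open>cf_eval u 0\<close> to
      \<open>cf_eval u x\<close>. The child \<open>u @ [a]\<close> lies between the parameters
      \<open>1 / (a + 1)\<close> and \<open>1 / a\<close>, so the sum telescopes.\<close>
    define F where "F = (\<lambda>x. x / cfq u x / cfq u 0)"
    have u: "positive_word u" using that words_positive by auto
    have q: "cfq u x > 0" if "x \<ge> 0" for x using cfq_ge_1[OF u that] by simp
    have "1 / (cfq (u @ [a]) 0 * cfq (u @ [a]) 1) = F (1 / real a) - F (1 / real (Suc a))" if a: "a \<ge> 1" for a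
    proof -
      define x y where "x = 1 / real a" and "y = 1 / real (Suc a)"
      have xy: "x > 0" "y > 0" "x - y = 1 / (real a * real (Suc a))" using a by (auto simp: x_def y_def field_simps)
      have "F x - F y = (x * cfq u y - y * cfq u x) / (cfq u x * cfq u y * cfq u 0)"
        using q[of x] q[of y] q[of 0] xy unfolding F_def by (simp add: field_simps)
      also have "x * cfq u y - y * cfq u x = (x - y) * cfq u 0"
        by (subst cfq_affine[of u y], subst cfq_affine[of u x]) (simp add: algebra_simps)
      also have "(x - y) * cfq u 0 / (cfq u x * cfq u y * cfq u 0) = (x - y) / (cfq u x * cfq u y)"
        using q[of 0] by simp
      also have "\<dots> = 1 / ((cfq u x * real a) * (cfq u y * real (Suc a)))" unfolding xy(3) by simp
      also have "cfq u x * real a = cfq (u @ [a]) 0" using u a by (subst cfq_append) (auto simp: x_def)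
      also have "cfq u y * real (Suc a) = cfq (u @ [a]) 1" using u a by (subst cfq_append) (auto simp: y_def add.commute)
      finally show ?thesis unfolding x_def y_def by simp
    qed
    then have "(\<Sum>a=1..M. 1 / (cfq (u @ [a]) 0 * cfq (u @ [a]) 1)) = (\<Sum>a=1..M. F (1 / real a) - F (1 / real (Suc a)))"
      by (intro sum.cong) auto
    also have "\<dots> = F 1 - F (1 / real (Suc M))" by (induction M) auto
    also have "\<dots> \<le> F 1" unfolding F_def using q[of 0] q[of "1 / real (Suc M)"] by simp
    finally show ?thesis by (simp add: F_def mult.commute)
  qed
  then have "(\<Sum>w\<in>words M (Suc n). 1 / (cfq w 0 * cfq w 1)) \<le> (\<Sum>u\<in>words M n. 1 / (cfq u 0 * cfq u 1))"
    unfolding sum_words_Suc by (intro sum_mono) auto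
  then show ?case using Suc by simp
qed auto

text \<open>Cylinder lengths are at least \<open>1 / (2 * q^2)\<close> and add up to at most 1.
  Consequently \<open>s = 1\<close> belongs to the set whose infimum is the dimension.\<close>

lemma cf_pressure_1_le_0: "cf_pressure 1 \<le> 0"
proof -
  have "word_sum M 1 n \<le> 2" for M n
  proof -
    have "cfq w 0 powr (- 2 * 1) \<le> 2 * (1 / (cfq w 0 * cfq w 1))" if "w \<in> words M n" for w
    proof -
      have w: "positive_word w" using that words_positive by auto
      have q: "cfq w 0 \<ge> 1" "cfq w 1 \<ge> 1" "cfq w 1 \<le> 2 * cfq w 0" using w cfq_ge_1 cfq_le_twice by auto
      then have "cfq w 0 * cfq w 1 \<le> 2 * (cfq w 0)\<^sup>2" by (simp add: power2_eq_square)
      then have "1 / (cfq w 0)\<^sup>2 \<le> 2 * (1 / (cfq w 0 * cfq w 1))" using q by (simp add: field_simps)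
      then show ?thesis using q by (simp add: powr_minus powr_numeral inverse_eq_divide)
    qed
    then have "word_sum M 1 n \<le> 2 * (\<Sum>w\<in>words M n. 1 / (cfq w 0 * cfq w 1))"
      unfolding word_sum_def sum_distrib_left by (intro sum_mono) auto
    then show ?thesis using sum_cylinder_lengths_le[of M n] by linarith
  qed
  then have "cf_lim 1 n \<le> 2" for n by (intro LIMSEQ_le_const2[OF word_sum_tendsto]) auto
  then have "ln (cf_lim 1 n) \<le> ln 2" for n using cf_lim_pos[of 1 n] by simp
  then have "real n * cf_pressure 1 \<le> ln 2 + ln 4" for n
    using ln_cf_lim[of 1 n] by (simp add: abs_le_iff) (smt (verit))
  then show ?thesis by (rule linear_bound_nonpos)
qed

text \<open>Finite alphabets approximate the pressure from below. A length \<open>k\<close> is fixed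
  at which the growth beats the loss in concatenation, multiples of \<open>k\<close> follow by
  induction, and a remainder shorter than \<open>k\<close> costs a constant.\<close>

lemma word_sum_exp_lower_bound:
  assumes s: "s > 1 / 2" and l: "0 \<le> l" "l < cf_pressure s"
  obtains M c where "M \<ge> 2" "c > 0" "\<And>n. c * exp (l * real n) \<le> word_sum M s n"
proof -
  define h where "h = (4::real) powr (- s)"
  have h: "0 < h" "h \<le> 1" using s powr_mono[of "- s" 0 4] by (auto simp: h_def)
  \<comment> \<open>One \<open>s * ln 4\<close> covers the deviation of
    \<open>ln (cf_lim s k)\<close> from \<open>k * cf_pressure s\<close>, the other the factor
    \<open>h\<close> lost in one concatenation.\<close>
  obtain k where k: "2 * (s * ln 4) < real k * (cf_pressure s - l)"
    using reals_Archimedean3[of "cf_pressure s - l"] l by auto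
  have "exp (l * real k) < h * cf_lim s k"
  proof -
    have "ln (cf_lim s k) \<ge> real k * cf_pressure s - s * ln 4" using ln_cf_lim[OF s, of k] by linarith
    then have "l * real k < - s * ln 4 + ln (cf_lim s k)" using k by (simp add: algebra_simps)
    then have "exp (l * real k) < exp (- s * ln 4 + ln (cf_lim s k))" by simp
    also have "\<dots> = h * cf_lim s k" using cf_lim_pos[OF s, of k] by (subst exp_add) (simp add: h_def powr_def)
    finally show ?thesis .
  qed
  moreover have "(\<lambda>M. h * word_sum M s k) \<longlonglongrightarrow> h * cf_lim s k" by (intro tendsto_intros word_sum_tendsto s)
  ultimately have "\<forall>\<^sub>F M in sequentially. exp (l * real k) < h * word_sum M s k" using order_tendstoD(1) by blast
  then obtain M0 where M0: "\<And>M. M \<ge> M0 \<Longrightarrow> exp (l * real k) < h * word_sum M s k"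
    unfolding eventually_sequentially by auto
  define M where "M = max M0 2"
  have M: "exp (l * real k) \<le> h * word_sum M s k" "M \<ge> 2" using M0[of M] by (auto simp: M_def)
  have ge: "h * word_sum M s m * word_sum M s n \<le> word_sum M s (m + n)" for m n unfolding h_def using s by (intro word_sum_add_ge) auto
  \<comment> \<open>Of the two factors \<open>h\<close> in the product of two such bounds one is
    consumed by the concatenation and the other survives, so the induction closes. At
    \<open>j = 0\<close> the bound would require \<open>h = 1\<close>.\<close>
  have pw: "exp (l * real (j * k)) \<le> h * word_sum M s (j * k) \<or> j = 0" for j
  proof (induction j)
    case (Suc j)
    show ?case
    proof (cases "j = 0")
      case False
      then have "exp (l * real k) * exp (l * real (j * k)) \<le> (h * word_sum M s k) * (h * word_sum M s (j * k))"
        using Suc M h word_sum_nonneg by (intro mult_mono) auto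
      also have "\<dots> = h * (h * word_sum M s k * word_sum M s (j * k))" by simp
      also have "\<dots> \<le> h * word_sum M s (k + j * k)" using h ge by (intro mult_left_mono) auto
      finally show ?thesis by (simp add: exp_add[symmetric] algebra_simps)
    qed (use M in simp)
  qed auto
  have pw': "exp (l * real (j * k)) \<le> word_sum M s (j * k)" for j
  proof (cases "j = 0")
    case False
    then have "exp (l * real (j * k)) \<le> h * word_sum M s (j * k)" using pw by blast
    also have "\<dots> \<le> 1 * word_sum M s (j * k)" using h word_sum_nonneg by (intro mult_right_mono) auto
    finally show ?thesis by simp
  qed simp
  have Z1: "1 \<le> word_sum M s (Suc 0)"
  proof -
    have "real 1 powr (- 2 * s) \<le> word_sum M s (Suc 0)" unfolding word_sum_1 using M by (intro member_le_sum) auto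
    then show ?thesis by simp
  qed
  \<comment> \<open>Extending by one digit costs at most the factor \<open>h\<close>, because the
    one-digit sum is at least 1.\<close>
  have rem: "h ^ r * word_sum M s m \<le> word_sum M s (m + r)" for m r
  proof (induction r)
    case (Suc r)
    have "h ^ Suc r * word_sum M s m \<le> h * word_sum M s (m + r)" using Suc h by simp
    also have "\<dots> \<le> h * word_sum M s (m + r) * word_sum M s (Suc 0)"
      using Z1 h word_sum_nonneg[of M s "m + r"] mult_left_mono[of 1 "word_sum M s (Suc 0)" "h * word_sum M s (m + r)"] by simp
    also have "\<dots> \<le> word_sum M s (m + r + Suc 0)" by (rule ge)
    finally show ?case by simp
  qed auto
  define c where "c = h ^ k * exp (- l * real k)"
  have k0: "k > 0" using k s by (cases k) (auto simp: mult_less_0_iff)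
  have "c * exp (l * real n) \<le> word_sum M s n" for n
  proof -
    define j r where "j = n div k" and "r = n mod k"
    have n: "n = j * k + r" and r: "r < k" using k0 by (auto simp: j_def r_def)
    have e: "exp (- l * real k) * exp (l * real n) \<le> exp (l * real (j * k))"
    proof -
      have "l * real r \<le> l * real k" using l r by (intro mult_left_mono) auto
      then show ?thesis by (simp add: exp_add[symmetric] n algebra_simps)
    qed
    have "c * exp (l * real n) = h ^ k * (exp (- l * real k) * exp (l * real n))" by (simp add: c_def)
    also have "\<dots> \<le> h ^ r * exp (l * real (j * k))"
      using h r e by (intro mult_mono power_decreasing) auto
    also have "\<dots> \<le> h ^ r * word_sum M s (j * k)" using h pw'[of j] by (intro mult_left_mono) auto
    also have "\<dots> \<le> word_sum M s n" using rem[of r "j * k"] by (simp add: n)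
    finally show ?thesis .
  qed
  moreover have "c > 0" using h by (simp add: c_def)
  ultimately show ?thesis using M that by blast
qed

section \<open>The pressure of the geometric potential\<close>

text \<open>The floor is locally constant off the discontinuities, and for positive \<open>z\<close>
  the condition \<open>0 < gauss_map z\<close> says that \<open>z\<close> is not a point
  \<open>1 / m\<close>.\<close>

lemma deriv_gauss_map:
  assumes "0 < z" "0 < gauss_map z"
  shows "deriv gauss_map z = - 1 / z\<^sup>2"
proof -
  define m where "m = \<lfloor>1 / z\<rfloor>"
  have m: "of_int m < 1 / z" "1 / z < of_int m + 1"
    using assms unfolding gauss_map_def m_def by (auto split: if_splits)
  \<comment> \<open>The branch \<open>1 / (m + 1) < y < 1 / m\<close>, written without division so
    that it also makes sense for \<open>m = 0\<close>, that is, for \<open>z > 1\<close>.\<close>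
  define U where "U = {y :: real. 0 < y \<and> of_int m * y < 1 \<and> 1 < (of_int m + 1) * y}"
  have "open U" unfolding U_def
    by (intro open_Collect_conj open_Collect_less continuous_intros)
  moreover have "z \<in> U" using m assms by (auto simp: U_def field_simps)
  moreover have "1 / y - of_int m = gauss_map y" if "y \<in> U" for y
  proof -
    have "\<lfloor>1 / y\<rfloor> = m" using that by (auto simp: U_def floor_eq_iff field_simps)
    then show ?thesis using that by (auto simp: gauss_map_def U_def)
  qed
  moreover have "((\<lambda>y. 1 / y - of_int m) has_field_derivative (- 1 / z\<^sup>2)) (at z)"
    using assms by (auto intro!: derivative_eq_intros simp: power2_eq_square)
  ultimately have "(gauss_map has_field_derivative (- 1 / z\<^sup>2)) (at z)"
    by (rule_tac has_field_derivative_transform_within_open)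
  then show ?thesis by (rule DERIV_imp_deriv)
qed

text \<open>The tails multiply to \<open>1 / cfq w x\<close> because \<open>cfq_Cons\<close>
  telescopes. Since \<open>|T'(z)|\<close> is \<open>1 / z^2\<close>, this is the chain rule for the
  iterates of the Gauss map.\<close>

lemma sum_ln_cf_eval:
  assumes "positive_word w" "0 < x"
  shows "(\<Sum>k<length w. ln (cf_eval (drop k w) x)) = - ln (cfq w x)"
  using assms(1)
proof (induction w)
  case (Cons a w)
  have e: "cf_eval (a # w) x > 0" using Cons assms cf_eval_gt_0 by blast
  have q: "cfq w x > 0" using Cons assms cfq_ge_1[of w x] by auto
  have q': "cfq (a # w) x = cfq w x / cf_eval (a # w) x"
    using Cons assms by (subst cfq_Cons) auto
  have "(\<Sum>k<length (a # w). ln (cf_eval (drop k (a # w)) x)) = ln (cf_eval (a # w) x) - ln (cfq w x)"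
    using Cons by (simp add: sum.lessThan_Suc_shift del: sum.lessThan_Suc cf_eval.simps)
  then show ?case using e q unfolding q' by (simp add: ln_div del: cf_eval.simps)
qed auto

text \<open>The constant \<open>c\<close> will be \<open>(2 * s - 1) * ln B\<close>; it shifts the
  pressure by \<open>- c\<close>.\<close>

definition geometric_potential :: "real \<Rightarrow> real \<Rightarrow> real \<Rightarrow> real" where
  "geometric_potential s c x = - s * ln \<bar>deriv gauss_map x\<bar> - c"

lemma exp_birkhoff_sum:
  assumes w: "positive_word w" and x: "x \<in> cf_domain"
  shows "exp (birkhoff_sum (geometric_potential s c) (length w) (cf_eval w x)) =
    cfq w x powr (- 2 * s) * exp (- c * real (length w))"
proof -
  have x': "0 < x" "x < 1" using x cf_domain_pos by auto
  have "geometric_potential s c ((gauss_map ^^ k) (cf_eval w x)) = 2 * s * ln (cf_eval (drop k w) x) - c"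
    if k: "k < length w" for k
  proof -
    define z where "z = cf_eval (drop k w) x"
    have p: "positive_word (drop k w)" "positive_word (drop (Suc k) w)"
      using w set_drop_subset[of k w] set_drop_subset[of "Suc k" w] by auto
    have z: "(gauss_map ^^ k) (cf_eval w x) = z" "z > 0"
      using gauss_map_cf_eval[OF w x', of k] cf_eval_gt_0[OF p(1) x'(1)] k unfolding z_def by auto
    have "gauss_map z = cf_eval (drop (Suc k) w) x"
      using gauss_map_cf_eval[OF w x', of "Suc k"] k z by simp
    then have "gauss_map z > 0" using cf_eval_gt_0[OF p(2) x'(1)] by simp
    then have "deriv gauss_map z = - 1 / z\<^sup>2" using deriv_gauss_map z by blast
    then have "ln \<bar>deriv gauss_map z\<bar> = - 2 * ln z" using z by (simp add: ln_div ln_realpow)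
    then show ?thesis unfolding z geometric_potential_def by (simp add: z_def)
  qed
  then have "birkhoff_sum (geometric_potential s c) (length w) (cf_eval w x) =
      (\<Sum>k<length w. 2 * s * ln (cf_eval (drop k w) x) - c)"
    unfolding birkhoff_sum_def by (intro sum.cong) auto
  also have "\<dots> = - 2 * s * ln (cfq w x) - c * real (length w)"
    using sum_ln_cf_eval[OF w x'(1)] by (simp add: sum_subtractf sum_distrib_left[symmetric])
  finally have B: "birkhoff_sum (geometric_potential s c) (length w) (cf_eval w x) =
      - 2 * s * ln (cfq w x) - c * real (length w)" .
  show ?thesis using cfq_ge_1[OF w, of x] x' unfolding B powr_def by (simp add: mult_exp_exp)
qed

text \<open>Extended real values match \<open>partition_sum\<close> and admit
  \<open>s <= 1 / 2\<close>, where the sum is infinite for \<open>n >= 1\<close>.\<close>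

definition cf_sum :: "real \<Rightarrow> nat \<Rightarrow> ennreal" where
  "cf_sum s n = (\<Sum>\<^sub>\<infinity>w\<in>{w. length w = n \<and> positive_word w}. ennreal (cfq w 0 powr (- 2 * s)))"

text \<open>A finite set of words uses finitely many digits and so lies in some
  \<open>words M n\<close>.\<close>

lemma cf_sum_eq_SUP: "cf_sum s n = (SUP M. ennreal (word_sum M s n))"
proof -
  have Zs: "ennreal (word_sum M s n) = (\<Sum>w\<in>words M n. ennreal (cfq w 0 powr (- 2 * s)))" for M
    unfolding word_sum_def by (simp add: sum_ennreal)
  have cs: "cf_sum s n = (SUP F\<in>{F. finite F \<and> F \<subseteq> {w. length w = n \<and> positive_word w}}.
      \<Sum>w\<in>F. ennreal (cfq w 0 powr (- 2 * s)))"
    unfolding cf_sum_def by (rule nonneg_infsum_complete) auto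
  show ?thesis
  proof (rule antisym)
    show "cf_sum s n \<le> (SUP M. ennreal (word_sum M s n))"
      unfolding cs
    proof (rule SUP_least)
      fix F assume F: "F \<in> {F. finite F \<and> F \<subseteq> {w. length w = n \<and> positive_word w}}"
      then have fin: "finite (\<Union>w\<in>F. set w)" by auto
      define M where "M = Max (insert 0 (\<Union>w\<in>F. set w))"
      have "F \<subseteq> words M n"
      proof
        fix w assume "w \<in> F"
        then have "a \<le> M" if "a \<in> set w" for a using that fin unfolding M_def by (intro Max_ge) auto
        then show "w \<in> words M n" using F \<open>w \<in> F\<close> by (fastforce simp: words_def)
      qed
      then have "(\<Sum>w\<in>F. ennreal (cfq w 0 powr (- 2 * s))) \<le> ennreal (word_sum M s n)"
        unfolding Zs by (intro sum_mono2) auto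
      also have "\<dots> \<le> (SUP M. ennreal (word_sum M s n))" by (rule SUP_upper) auto
      finally show "(\<Sum>w\<in>F. ennreal (cfq w 0 powr (- 2 * s))) \<le> (SUP M. ennreal (word_sum M s n))" .
    qed
    show "(SUP M. ennreal (word_sum M s n)) \<le> cf_sum s n"
      unfolding cs Zs using finite_words[of _ n] words_positive
      by (intro SUP_least SUP_upper) (fastforce simp: words_def)
  qed
qed

lemma cf_sum_eq_cf_lim:
  assumes "s > 1 / 2"
  shows "cf_sum s n = ennreal (cf_lim s n)"
proof -
  have "incseq (\<lambda>M. ennreal (word_sum M s n))" by (auto simp: incseq_def word_sum_mono intro!: ennreal_leI)
  then have "(\<lambda>M. ennreal (word_sum M s n)) \<longlonglongrightarrow> cf_sum s n" unfolding cf_sum_eq_SUP by (rule LIMSEQ_SUP)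
  moreover have "(\<lambda>M. ennreal (word_sum M s n)) \<longlonglongrightarrow> ennreal (cf_lim s n)" by (intro tendsto_ennrealI word_sum_tendsto assms)
  ultimately show ?thesis by (rule LIMSEQ_unique)
qed

text \<open>Fixing all digits but the last to be 1 already leaves the divergent series of
  \<open>a powr (- 2 * s)\<close>.\<close>

lemma cf_sum_eq_top:
  assumes "0 \<le> s" "s \<le> 1 / 2" "n \<ge> 1"
  shows "cf_sum s n = \<infinity>"
proof -
  define k where "k = 4 powr (- s) * word_sum 1 s (n - 1)"
  have k: "k > 0" unfolding k_def using word_sum_pos[of 1 s "n - 1"] by simp
  have "\<not> summable (\<lambda>a. real a powr (- 2 * s))" using assms by (simp add: summable_real_powr_iff)
  have unb: "\<exists>M. K < (\<Sum>a=1..M. real a powr (- 2 * s))" for K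
  proof (rule ccontr)
    assume "\<nexists>M. K < (\<Sum>a=1..M. real a powr (- 2 * s))"
    then have le: "(\<Sum>a=1..M. real a powr (- 2 * s)) \<le> K" for M by (auto simp: not_less)
    have "(\<Sum>a<M. norm (real a powr (- 2 * s))) \<le> K" for M
    proof -
      have "(\<Sum>a<M. real a powr (- 2 * s)) \<le> (\<Sum>a\<in>insert 0 {1..M}. real a powr (- 2 * s))"
        by (intro sum_mono2) auto
      then show ?thesis using le[of M] by simp
    qed
    then have "summable (\<lambda>a. real a powr (- 2 * s))" by (intro summableI_nonneg_bounded[where x = K]) auto
    then show False using \<open>\<not> summable _\<close> by blast
  qed
  have "ennreal r \<le> cf_sum s n" for r
  proof -
    obtain M where M: "max 1 (r / k) < (\<Sum>a=1..M. real a powr (- 2 * s))" using unb by blast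
    then have M1: "M \<ge> 1" by (cases M) auto
    have "r \<le> k * word_sum M s (Suc 0)" using M k unfolding word_sum_1 by (simp add: field_simps)
    also have "\<dots> \<le> 4 powr (- s) * word_sum M s (n - 1) * word_sum M s (Suc 0)"
      unfolding k_def by (intro mult_right_mono mult_left_mono word_sum_mono M1 word_sum_nonneg) auto
    also have "\<dots> \<le> word_sum M s (n - 1 + Suc 0)" using assms by (intro word_sum_add_ge) auto
    finally have "r \<le> word_sum M s n" using assms by simp
    then have "ennreal r \<le> ennreal (word_sum M s n)" by (rule ennreal_leI)
    also have "\<dots> \<le> cf_sum s n" unfolding cf_sum_eq_SUP by (rule SUP_upper) auto
    finally show ?thesis .
  qed
  then show ?thesis by (metis ennreal_cases ennreal_less_iff infinity_ennreal_def not_le less_add_one ennreal_neg lt_ex zero_le le_less_trans enn2real_nonneg)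
qed

lemma cf_domain_nonempty: "cf_val (\<lambda>_. 1) \<in> cf_domain"
  by (rule cf_val_in_cf_domain) auto

text \<open>Bounded distortion: by \<open>exp_birkhoff_sum\<close> the weight of \<open>w\<close> at
  \<open>x\<close> involves \<open>cfq w x\<close>, which lies between \<open>cfq w 0\<close> and
  twice that value. For the lower bound the supremum is tested at one point, the fraction with all
  digits 1.\<close>

lemma partition_sum_bounds:
  assumes s: "s \<ge> 0"
  shows "partition_sum (geometric_potential s c) n \<le> ennreal (exp (- c * real n)) * cf_sum s n"
    and "ennreal (4 powr (- s) * exp (- c * real n)) * cf_sum s n \<le> partition_sum (geometric_potential s c) n"
proof -
  define W where "W = {w :: nat list. length w = n \<and> positive_word w}"
  have ps: "partition_sum (geometric_potential s c) n = (\<Sum>\<^sub>\<infinity>w\<in>W.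
      SUP x\<in>cf_domain. ennreal (cfq w x powr (- 2 * s) * exp (- c * real n)))"
    unfolding partition_sum_def W_def by (intro infsum_cong SUP_cong) (auto simp: exp_birkhoff_sum)
  have cmult: "ennreal k * cf_sum s n = (\<Sum>\<^sub>\<infinity>w\<in>W. ennreal k * ennreal (cfq w 0 powr (- 2 * s)))" for k
    unfolding cf_sum_def W_def[symmetric]
    by (simp add: nonneg_infsum_complete SUP_mult_left_ennreal sum_distrib_left del: sum_ennreal)
  show "partition_sum (geometric_potential s c) n \<le> ennreal (exp (- c * real n)) * cf_sum s n"
    unfolding ps cmult
  proof (intro infsum_mono SUP_least)
    fix w x assume w: "w \<in> W" and x: "x \<in> cf_domain"
    have q: "1 \<le> cfq w 0" "cfq w 0 \<le> cfq w x" using w x cfq_ge_1 cfq_mono cf_domain_pos[of x] by (auto simp: W_def)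
    then have "cfq w x powr (- 2 * s) \<le> cfq w 0 powr (- 2 * s)" using s by (intro powr_mono2') auto
    then show "ennreal (cfq w x powr (- 2 * s) * exp (- c * real n)) \<le>
        ennreal (exp (- c * real n)) * ennreal (cfq w 0 powr (- 2 * s))"
      by (simp add: ennreal_mult''[symmetric] mult.commute ennreal_leI)
  qed (simp_all add: nonneg_summable_on_complete)
  show "ennreal (4 powr (- s) * exp (- c * real n)) * cf_sum s n \<le> partition_sum (geometric_potential s c) n"
    unfolding ps cmult
  proof (intro infsum_mono)
    fix w assume w: "w \<in> W"
    define x where "x = cf_val (\<lambda>_. 1)"
    have x: "x \<in> cf_domain" unfolding x_def by (rule cf_domain_nonempty)
    have q: "1 \<le> cfq w 0" "cfq w x \<le> 2 * cfq w 0" "1 \<le> cfq w x"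
      using w x cfq_ge_1 cfq_le_twice cf_domain_pos[of x] by (auto simp: W_def)
    have "(2 * cfq w 0) powr (- 2 * s) \<le> cfq w x powr (- 2 * s)" using s q by (intro powr_mono2') auto
    moreover have "(2::real) powr (- 2 * s) = 4 powr (- s)" using powr_powr[of 2 2 "- s"] by simp
    ultimately have "4 powr (- s) * cfq w 0 powr (- 2 * s) \<le> cfq w x powr (- 2 * s)" using q by (simp add: powr_mult)
    then have "ennreal (4 powr (- s) * exp (- c * real n)) * ennreal (cfq w 0 powr (- 2 * s))
        \<le> ennreal (cfq w x powr (- 2 * s) * exp (- c * real n))"
      by (simp add: ennreal_mult''[symmetric] ennreal_leI)
    also have "\<dots> \<le> (SUP x\<in>cf_domain. ennreal (cfq w x powr (- 2 * s) * exp (- c * real n)))"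
      using x by (rule SUP_upper)
    finally show "ennreal (4 powr (- s) * exp (- c * real n)) * ennreal (cfq w 0 powr (- 2 * s)) \<le> \<dots>" .
  qed (simp_all add: nonneg_summable_on_complete)
qed

lemma pressure_geometric_potential:
  assumes s: "s > 1 / 2"
  shows "pressure (geometric_potential s c) = ereal (cf_pressure s - c)"
proof -
  define p where "p = (\<lambda>n. partition_sum (geometric_potential s c) n)"
  define r where "r = (\<lambda>n. enn2real (p n))"
  have up: "p n \<le> ennreal (exp (- c * real n) * cf_lim s n)"
    and lo: "ennreal (4 powr (- s) * exp (- c * real n) * cf_lim s n) \<le> p n" for n
    using partition_sum_bounds[of s c n] s cf_lim_pos[OF s, of n]
    unfolding p_def cf_sum_eq_cf_lim[OF s] by (auto simp: ennreal_mult[symmetric] less_imp_le)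
  have pr: "p n = ennreal (r n)" for n unfolding r_def using up[of n]
    by (metis ennreal_enn2real_if ennreal_neq_top neq_top_trans)
  have lo': "4 powr (- s) * exp (- c * real n) * cf_lim s n \<le> r n" for n
    using lo[of n] unfolding pr by (simp add: r_def ennreal_le_iff)
  have pos: "0 < 4 powr (- s) * exp (- c * real n) * cf_lim s n" for n using cf_lim_pos[OF s, of n] by simp
  have rpos: "r n > 0" for n using pos lo' less_le_trans by blast
  have up': "r n \<le> exp (- c * real n) * cf_lim s n" for n
    using up[of n] cf_lim_pos[OF s, of n] unfolding pr by (simp add: ennreal_le_iff)
  \<comment> \<open>One \<open>s * ln 4\<close> comes from the distortion factor, the other from
    \<open>ln_cf_lim\<close>.\<close>
  have bd: "\<bar>ln (r n) - real n * (cf_pressure s - c)\<bar> \<le> 2 * (s * ln 4)" for n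
  proof -
    have "ln (r n) \<le> ln (exp (- c * real n) * cf_lim s n)" using up'[of n] rpos[of n] by simp
    moreover have "ln (4 powr (- s) * exp (- c * real n) * cf_lim s n) \<le> ln (r n)" using lo'[of n] pos[of n] by simp
    ultimately show ?thesis using ln_cf_lim[OF s, of n] cf_lim_pos[OF s, of n] s
      by (simp add: ln_mult ln_powr abs_le_iff algebra_simps)
  qed
  have "(\<lambda>n. ln (r n) / real n) \<longlonglongrightarrow> cf_pressure s - c"
  proof (rule LIM_zero_cancel, rule Lim_null_comparison)
    show "(\<lambda>n. 2 * (s * ln 4) / real n) \<longlonglongrightarrow> 0" by (rule lim_const_over_n)
    show "\<forall>\<^sub>F n in sequentially. norm (ln (r n) / real n - (cf_pressure s - c)) \<le> 2 * (s * ln 4) / real n"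
    proof (rule eventually_sequentiallyI[of 1])
      fix n :: nat assume n: "n \<ge> 1"
      have "ln (r n) / real n - (cf_pressure s - c) = (ln (r n) - real n * (cf_pressure s - c)) / real n"
        using n by (simp add: field_simps)
      then show "norm (ln (r n) / real n - (cf_pressure s - c)) \<le> 2 * (s * ln 4) / real n"
        using bd[of n] n by (simp add: abs_divide divide_right_mono)
    qed
  qed
  then have "(\<lambda>n. ereal (ln (r n) / real n)) \<longlonglongrightarrow> ereal (cf_pressure s - c)" by simp
  moreover have "ln_ennreal (p n) / ereal (real n) = ereal (ln (r n) / real n)" if "n \<ge> 1" for n
  proof -
    have "p n \<noteq> 0" "p n \<noteq> \<infinity>" unfolding pr using rpos[of n] by auto
    then show ?thesis using that by (simp add: ln_ennreal_def r_def)
  qed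
  ultimately have "(\<lambda>n. ln_ennreal (p n) / ereal (real n)) \<longlonglongrightarrow> ereal (cf_pressure s - c)"
    using Lim_transform_eventually[of "\<lambda>n. ereal (ln (r n) / real n)" _ sequentially
        "\<lambda>n. ln_ennreal (p n) / ereal (real n)"] eventually_sequentiallyI[of 1]
    by (simp add: eventually_at_top_linorder)
  then show ?thesis unfolding pressure_def p_def by (rule limI)
qed

lemma pressure_geometric_potential_top:
  assumes "0 \<le> s" "s \<le> 1 / 2"
  shows "pressure (geometric_potential s c) = \<infinity>"
proof -
  have "ln_ennreal (partition_sum (geometric_potential s c) n) / ereal (real n) = \<infinity>" if n: "n \<ge> 1" for n
  proof -
    have "ennreal (4 powr (- s) * exp (- c * real n)) * cf_sum s n = \<infinity>"
      using cf_sum_eq_top[OF assms n] by (simp add: ennreal_mult_top)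
    then have "partition_sum (geometric_potential s c) n = \<infinity>"
      using partition_sum_bounds(2)[of s c n] assms by (simp add: top.extremum_unique)
    then show ?thesis using n by (simp add: ln_ennreal_def)
  qed
  then have "(\<lambda>n. ln_ennreal (partition_sum (geometric_potential s c) n) / ereal (real n)) \<longlonglongrightarrow> \<infinity>"
    by (rule_tac tendsto_eventually) (auto intro!: eventually_sequentiallyI[of 1])
  then show ?thesis unfolding pressure_def by (rule limI)
qed

section \<open>Upper bounds\<close>

text \<open>
  The hypothesis bounds sums over the finite alphabets \<open>{1..M}\<close> uniformly in \<open>M\<close>, which avoids
  infinite sums over words.
\<close>
lemma hausdorff_measure_limsup_eq_0:
  fixes V :: "nat \<Rightarrow> nat list \<Rightarrow> real set"
  assumes s: "s > 0" and g: "\<And>n w. 0 \<le> g n w" and summ: "summable \<beta>"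
    and sum: "\<And>M n. n \<ge> start \<Longrightarrow> (\<Sum>w\<in>words M (len n). g n w) \<le> \<beta> n"
    and V: "\<And>n w. n \<ge> start \<Longrightarrow> positive_word w \<Longrightarrow> length w = len n \<Longrightarrow>
      bounded (V n w) \<and> diameter (V n w) powr s \<le> g n w"
    and E: "\<And>x. x \<in> E \<Longrightarrow> \<exists>\<^sub>\<infinity>n. \<exists>w. positive_word w \<and> length w = len n \<and> x \<in> V n w"
  shows "hausdorff_measure s E = 0"
proof -
  have \<beta>0: "\<beta> n \<ge> 0" if "n \<ge> start" for n using sum[OF that, of 0] sum_nonneg[of "words 0 (len n)" "g n"] g by (meson order_trans)
  have le: "hausdorff_premeasure s \<delta> E \<le> ennreal e" if \<delta>: "\<delta> > 0" and e: "e > 0" for \<delta> e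
  proof -
    \<comment> \<open>A total of at most \<open>\<delta> powr s\<close> forces every single diameter
      to be at most \<open>\<delta>\<close>, so one bound controls both the mesh and the size of the
      cover.\<close>
    define \<eta> where "\<eta> = min e (\<delta> powr s)"
    have \<eta>: "\<eta> > 0" using \<delta> e by (simp add: \<eta>_def)
    obtain N' where N': "\<And>n. n \<ge> N' \<Longrightarrow> norm (\<Sum>i. \<beta> (i + n)) < \<eta>" using suminf_exist_split[OF \<eta> summ] by blast
    define N where "N = max N' start"
    have tail: "(\<Sum>n\<in>{N..<K}. \<beta> n) \<le> \<eta>" for K
    proof -
      have "(\<Sum>n\<in>{N..<K}. \<beta> n) = (\<Sum>i<K - N. \<beta> (i + N))"
      proof (cases "N \<le> K")
        case True
        have "(\<Sum>n\<in>{0 + N..<(K - N) + N}. \<beta> n) = (\<Sum>i\<in>{0..<K - N}. \<beta> (i + N))" by (rule sum.shift_bounds_nat_ivl)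
        then show ?thesis using True by (simp add: atLeast0LessThan)
      qed auto
      also have "\<dots> \<le> (\<Sum>i. \<beta> (i + N))"
        using \<beta>0 summ by (intro sum_le_suminf) (auto simp: summable_iff_shift N_def)
      also have "\<dots> \<le> \<eta>" using N'[of N] by (simp add: N_def)
      finally show ?thesis .
    qed
    \<comment> \<open>Covers are sequences of sets, so the pairs \<open>(n, w)\<close> are coded by
      numbers. A pair may have several preimages under \<open>from_nat\<close>; the condition
      \<open>to_nat (from_nat k) = k\<close> keeps one of them, and all other indices get the empty
      set.\<close>
    define good where "good = (\<lambda>k. to_nat (from_nat k :: nat \<times> nat list) = k \<and> N \<le> fst (from_nat k :: nat \<times> nat list)
      \<and> positive_word (snd (from_nat k :: nat \<times> nat list)) \<and> length (snd (from_nat k :: nat \<times> nat list)) = len (fst (from_nat k :: nat \<times> nat list)))"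
    define U where "U = (\<lambda>k. if good k then case from_nat k of (n, w) \<Rightarrow> V n w else {})"
    define G where "G = (\<lambda>k. if good k then case from_nat k of (n, w) \<Rightarrow> g n w else 0)"
    have UG: "bounded (U k) \<and> diameter (U k) powr s \<le> G k" for k
    proof (cases "good k")
      case True
      obtain n w where nw: "(from_nat k :: nat \<times> nat list) = (n, w)" by force
      then show ?thesis using True V[of n w] by (auto simp: U_def G_def good_def N_def)
    qed (auto simp: U_def G_def)
    have Gsum: "(\<Sum>k\<in>A. G k) \<le> \<eta>" if A: "finite A" for A
    proof -
      define J where "J = (from_nat :: nat \<Rightarrow> nat \<times> nat list) ` {k\<in>A. good k}"
      have finJ: "finite J" using A by (simp add: J_def)
      have "(\<Sum>k\<in>A. G k) = (\<Sum>k\<in>{k\<in>A. good k}. G k)"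
        using A by (intro sum.mono_neutral_right) (auto simp: G_def)
      also have "\<dots> = (\<Sum>(n, w)\<in>J. g n w)"
      proof -
        have inj: "inj_on (from_nat :: nat \<Rightarrow> nat \<times> nat list) {k\<in>A. good k}"
          by (rule inj_on_inverseI[of _ to_nat]) (auto simp: good_def)
        show ?thesis unfolding J_def sum.reindex[OF inj] by (intro sum.cong) (auto simp: G_def)
      qed
      \<comment> \<open>Finitely many pairs lie in finitely many levels and over one finite
        alphabet, where the hypothesis \<open>sum\<close> applies.\<close>
      also have "\<dots> \<le> (\<Sum>(n, w)\<in>Sigma {N..<Suc (Max (insert 0 (fst ` J)))} (\<lambda>n. words (Max (insert 0 (\<Union>(n, w)\<in>J. set w))) (len n)). g n w)"
      proof (rule sum_mono2)
        show "J \<subseteq> Sigma {N..<Suc (Max (insert 0 (fst ` J)))} (\<lambda>n. words (Max (insert 0 (\<Union>(n, w)\<in>J. set w))) (len n))"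
        proof (clarify, intro conjI)
          fix n w assume nw: "(n, w) \<in> J"
          then obtain k where k: "good k" "(from_nat k :: nat \<times> nat list) = (n, w)" unfolding J_def by force
          have fin: "finite (\<Union>(n, w)\<in>J. set w)" using finJ by (auto simp: case_prod_beta)
          have "n \<le> Max (insert 0 (fst ` J))" using nw finJ by (intro Max_ge) (auto simp: image_iff intro!: bexI[of _ "(n, w)"])
          then show "n \<in> {N..<Suc (Max (insert 0 (fst ` J)))}" using k by (simp add: good_def)
          have "a \<le> Max (insert 0 (\<Union>(n, w)\<in>J. set w))" if "a \<in> set w" for a
            using nw fin that by (intro Max_ge) auto
          then show "w \<in> words (Max (insert 0 (\<Union>(n, w)\<in>J. set w))) (len n)"
            using k by (auto simp: good_def words_def subset_iff)
        qed
      qed (use g in auto)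
      also have "\<dots> \<le> (\<Sum>n\<in>{N..<Suc (Max (insert 0 (fst ` J)))}. \<beta> n)"
        by (subst sum.Sigma[symmetric]) (auto intro!: sum_mono sum simp: N_def simp del: sum.op_ivl_Suc)
      also have "\<dots> \<le> \<eta>" by (rule tail)
      finally show ?thesis .
    qed
    have cover: "E \<subseteq> (\<Union>k. U k)"
    proof
      fix x assume "x \<in> E"
      then have "\<exists>n\<ge>N. \<exists>w. positive_word w \<and> length w = len n \<and> x \<in> V n w"
        using E[of x] unfolding INFM_nat_le by blast
      then obtain n w where nw: "n \<ge> N" "positive_word w" "length w = len n" "x \<in> V n w" by auto
      then have "x \<in> U (to_nat (n, w))" by (simp add: U_def good_def)
      then show "x \<in> (\<Union>k. U k)" by blast
    qed
    have diam: "diameter (U k) \<le> \<delta>" for k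
    proof -
      have "diameter (U k) powr s \<le> \<delta> powr s" using UG[of k] Gsum[of "{k}"] by (simp add: \<eta>_def)
      then show ?thesis using powr_less_mono2[of s \<delta> "diameter (U k)"] \<delta> s by (smt (verit))
    qed
    have "(\<Sum>k. diam_power s (U k)) \<le> ennreal e"
      unfolding suminf_eq_SUP
    proof (rule SUP_least)
      fix K
      have "(\<Sum>k<K. diam_power s (U k)) \<le> (\<Sum>k<K. ennreal (G k))"
        using UG s by (intro sum_mono) (auto simp: diam_power_def intro!: ennreal_leI)
      also have "\<dots> = ennreal (\<Sum>k<K. G k)" using g by (intro sum_ennreal) (auto simp: G_def split: prod.splits)
      also have "\<dots> \<le> ennreal e" using Gsum[of "{..<K}"] by (intro ennreal_leI) (simp add: \<eta>_def)
      finally show "(\<Sum>k<K. diam_power s (U k)) \<le> ennreal e" .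
    qed
    then show ?thesis unfolding hausdorff_premeasure_def
      using cover diam UG by (intro INF_lower2[of U]) auto
  qed
  have "hausdorff_premeasure s \<delta> E = 0" if "\<delta> > 0" for \<delta>
  proof -
    have "hausdorff_premeasure s \<delta> E \<le> 0" by (rule ennreal_le_epsilon) (use le[OF that] in simp)
    then show ?thesis by simp
  qed
  then show ?thesis unfolding hausdorff_measure_def by simp
qed

lemma hausdorff_dim_le: "s \<ge> 0 \<Longrightarrow> hausdorff_measure s E = 0 \<Longrightarrow> hausdorff_dim E \<le> ennreal s"
  unfolding hausdorff_dim_def by (rule INF_lower) auto

definition cf_digits :: "real \<Rightarrow> nat \<Rightarrow> nat list" where
  "cf_digits x n = map (\<lambda>k. partial_quotient (Suc k) x) [0..<n]"

lemma cf_digits_simps [simp]: "length (cf_digits x n) = n"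
  "k < n \<Longrightarrow> cf_digits x n ! k = partial_quotient (Suc k) x"
  "cf_digits x (Suc n) = cf_digits x n @ [partial_quotient (Suc n) x]"
  by (simp_all add: cf_digits_def)

lemma partial_quotient_ge_1: "x \<in> cf_domain \<Longrightarrow> partial_quotient (Suc n) x \<ge> 1"
  by (simp add: cf_domain_def)

lemma cf_digits_positive: "x \<in> cf_domain \<Longrightarrow> positive_word (cf_digits x n)"
  using partial_quotient_ge_1 by (auto simp: cf_digits_def)

lemma cf_digits_split: "x \<in> cf_domain \<Longrightarrow> x = cf_eval (cf_digits x n) ((gauss_map ^^ n) x)"
  unfolding cf_digits_def by (rule cf_domain_split)

lemma diameter_cylinder_le:
  assumes "positive_word w" "A \<subseteq> {x \<in> cf_domain. cf_digits x (length w) = w}"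
  shows "diameter A \<le> 1 / (cfq w 0)\<^sup>2"
proof (rule diameter_le)
  fix x y assume "x \<in> A" "y \<in> A"
  then have xy: "x \<in> cf_domain" "y \<in> cf_domain" "cf_digits x (length w) = w" "cf_digits y (length w) = w"
    using assms by auto
  define x' y' where "x' = (gauss_map ^^ length w) x" and "y' = (gauss_map ^^ length w) y"
  have u: "0 < x' \<and> x' < 1" "0 < y' \<and> y' < 1"
    using xy cf_domain_pos funpow_gauss_map_cf_domain unfolding x'_def y'_def by auto
  have "x = cf_eval w x'" "y = cf_eval w y'"
    using cf_digits_split[of x "length w"] cf_digits_split[of y "length w"] xy unfolding x'_def y'_def by auto
  then have "\<bar>x - y\<bar> \<le> \<bar>x' - y'\<bar> / (cfq w 0)\<^sup>2" using cf_eval_diff_le assms u by auto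
  also have "\<dots> \<le> 1 / (cfq w 0)\<^sup>2" using u by (intro divide_right_mono) auto
  finally show "norm (x - y) \<le> 1 / (cfq w 0)\<^sup>2" by simp
qed auto

lemma bounded_cf_domain: "A \<subseteq> cf_domain \<Longrightarrow> bounded A"
  by (rule bounded_subset[of "{0..1::real}"]) (auto simp: cf_domain_def)

lemma gauss_map_0 [simp]: "gauss_map 0 = 0" by (simp add: gauss_map_def)

section \<open>Membership in the exceptional set\<close>

abbreviation digit_product :: "(nat \<Rightarrow> nat) \<Rightarrow> nat \<Rightarrow> real \<Rightarrow> real" where
  "digit_product f n x \<equiv> (\<Prod>i=1..n. real (partial_quotient (i * f n) x))"

text \<open>For a rational point all quotients from some index on are 0, so the product vanishes for
  large \<open>n\<close>, whereas \<open>\<psi> n ^ n\<close> is at least 1.\<close>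

lemma E_setD:
  assumes f: "\<And>n. n \<ge> 1 \<Longrightarrow> f n \<ge> 1" and \<psi>: "\<And>n. n \<ge> 1 \<Longrightarrow> \<psi> n \<ge> 1" and x: "x \<in> E_set f \<psi>"
  shows "x \<in> cf_domain"
    and "\<exists>\<^sub>\<infinity>n. n \<ge> 1 \<and> \<psi> n ^ n \<le> digit_product f n x"
proof -
  have io: "\<exists>\<^sub>\<infinity>n. n \<ge> 1 \<and> root n (digit_product f n x) \<ge> \<psi> n" and x01: "x \<in> {0..<1}"
    using x by (auto simp: E_set_def)
  have ge: "\<psi> n ^ n \<le> digit_product f n x"
    if "n \<ge> 1" "root n (digit_product f n x) \<ge> \<psi> n" for n
  proof -
    have "\<psi> n ^ n \<le> root n (digit_product f n x) ^ n"
      using that \<psi>[of n] by (intro power_mono) auto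
    also have "\<dots> = digit_product f n x"
      using that by (intro real_root_pow_pos2) (auto intro!: prod_nonneg)
    finally show ?thesis .
  qed
  then show io': "\<exists>\<^sub>\<infinity>n. n \<ge> 1 \<and> \<psi> n ^ n \<le> digit_product f n x"
    using io by (auto elim!: INFM_mono)
  show "x \<in> cf_domain"
  proof (rule ccontr)
    assume "x \<notin> cf_domain"
    then obtain m where m: "partial_quotient m x = 0" "m \<ge> 1" using x01 by (force simp: cf_domain_def)
    define y where "y = (gauss_map ^^ (m - 1)) x"
    have y: "0 \<le> y" "y < 1" using gauss_map_range x01 unfolding y_def by (cases "m - 1"; auto)+
    have "y = 0"
    proof (rule ccontr)
      assume "y \<noteq> 0"
      then have "1 / y > 1" using y by simp
      then have "\<lfloor>1 / y\<rfloor> \<ge> 1" by linarith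
      then show False using m by (simp add: partial_quotient_def y_def)
    qed
    then have z: "(gauss_map ^^ (j + (m - 1))) x = 0" for j
      unfolding funpow_add y_def by (induction j) auto
    obtain n where n: "n \<ge> m" "n \<ge> 1" "\<psi> n ^ n \<le> digit_product f n x"
      using io' m unfolding INFM_nat_le by blast
    have "m * 1 \<le> n * f n" using n f by (intro mult_mono) auto
    then have "n * f n - 1 = (n * f n - m) + (m - 1)" using m by simp
    then have "partial_quotient (n * f n) x = 0" using z[of "n * f n - m"] by (simp add: partial_quotient_def)
    then have "digit_product f n x = 0"
      using n by (intro prod_zero) (auto intro!: bexI[of _ n])
    moreover have "\<psi> n ^ n \<ge> 1" using \<psi>[OF n(2)] by simp
    ultimately show False using n(3) by linarith
  qed
qed

lemma E_setI:
  assumes "x \<in> cf_domain" "\<exists>\<^sub>\<infinity>n. n \<ge> 1 \<and> 0 \<le> \<psi> n \<and> \<psi> n ^ n \<le> digit_product f n x"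
  shows "x \<in> E_set f \<psi>"
proof -
  have "root n (digit_product f n x) \<ge> \<psi> n"
    if "n \<ge> 1" "0 \<le> \<psi> n" "\<psi> n ^ n \<le> digit_product f n x" for n
    using that real_root_le_mono[of n "\<psi> n ^ n"] by (simp add: real_root_pos2)
  then show ?thesis using assms unfolding E_set_def cf_domain_def by (auto elim!: INFM_mono)
qed

section \<open>Finite \<open>B\<close>: covers by cylinders with a large product\<close>

definition spaced_prod :: "nat \<Rightarrow> nat \<Rightarrow> nat list \<Rightarrow> real" where
  "spaced_prod m k w = (\<Prod>i=1..k. real (w ! (i * m - 1)))"

text \<open>
  Chebyshev's inequality will be applied with the power \<open>\<sigma> < 2 * s - 1\<close> of the product of the
  distinguished digits, for which the sum over these digits still converges.
\<close>
lemma sum_spaced_prod_le: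
  assumes m: "m \<ge> 1" and s: "s \<ge> 0"
  shows "(\<Sum>w\<in>words M (k * m). spaced_prod m k w powr \<sigma> * cfq w 0 powr (- 2 * s))
    \<le> (word_sum M s (m - 1) * (\<Sum>a=1..M. real a powr (\<sigma> - 2 * s))) ^ k"
proof (induction k)
  case 0
  then show ?case by (simp add: spaced_prod_def)
next
  case (Suc k)
  define F where "F = (\<lambda>w. spaced_prod m k w powr \<sigma> * cfq w 0 powr (- 2 * s))"
  have "spaced_prod m (Suc k) (u @ v @ [a]) powr \<sigma> * cfq (u @ v @ [a]) 0 powr (- 2 * s)
      \<le> F u * (cfq v 0 powr (- 2 * s) * real a powr (\<sigma> - 2 * s))"
    if "u \<in> words M (k * m)" "v \<in> words M (m - 1)" "a \<in> {1..M}" for u v a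
  proof -
    have l: "length u = k * m" "length v = m - 1" using that by (auto simp: words_def)
    have p: "positive_word u" "positive_word v" "positive_word [a]" using that words_positive by auto
    have q: "cfq u 0 \<ge> 1" "cfq v 0 \<ge> 1" using cfq_ge_1 p by auto
    have "spaced_prod m (Suc k) (u @ v @ [a]) = spaced_prod m k u * real a"
    proof -
      have "(\<Prod>i=1..k. real ((u @ v @ [a]) ! (i * m - 1))) = (\<Prod>i=1..k. real (u ! (i * m - 1)))"
      proof (intro prod.cong refl)
        fix i assume i: "i \<in> {1..k}"
        then have "1 * 1 \<le> i * m" "i * m \<le> k * m" using m by (intro mult_mono; simp)+
        then have "i * m - 1 < length u" unfolding l by linarith
        then show "real ((u @ v @ [a]) ! (i * m - 1)) = real (u ! (i * m - 1))" by (simp add: nth_append)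
      qed
      moreover have "(u @ v @ [a]) ! (Suc k * m - 1) = a"
      proof -
        have "Suc k * m - 1 = length (u @ v)" using m by (simp add: l)
        then show ?thesis by (metis append_assoc nth_append_length)
      qed
      ultimately show ?thesis by (simp add: spaced_prod_def)
    qed
    moreover have "cfq (u @ v @ [a]) 0 powr (- 2 * s) \<le> (cfq u 0 * (cfq v 0 * real a)) powr (- 2 * s)"
    proof (intro powr_mono2')
      have "cfq u 0 * (cfq v 0 * cfq [a] 0) \<le> cfq u 0 * cfq (v @ [a]) 0"
        using cfq_append_ge[of v "[a]"] p q by (intro mult_left_mono) auto
      also have "\<dots> \<le> cfq (u @ v @ [a]) 0" using p by (intro cfq_append_ge) auto
      finally show "cfq u 0 * (cfq v 0 * real a) \<le> cfq (u @ v @ [a]) 0" by simp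
      show "cfq u 0 * (cfq v 0 * real a) > 0" using q that by (intro mult_pos_pos) auto
    qed (use s in auto)
    moreover have "(cfq u 0 * (cfq v 0 * real a)) powr (- 2 * s)
        = cfq u 0 powr (- 2 * s) * (cfq v 0 powr (- 2 * s) * real a powr (- 2 * s))"
      using q by (simp add: powr_mult)
    moreover have "spaced_prod m k u \<ge> 0" unfolding spaced_prod_def by (intro prod_nonneg) auto
    ultimately have "spaced_prod m (Suc k) (u @ v @ [a]) powr \<sigma> * cfq (u @ v @ [a]) 0 powr (- 2 * s)
      \<le> (spaced_prod m k u powr \<sigma> * real a powr \<sigma>) * (cfq u 0 powr (- 2 * s) * (cfq v 0 powr (- 2 * s) * real a powr (- 2 * s)))"
      by (simp add: powr_mult mult_left_mono)
    also have "\<dots> = F u * (cfq v 0 powr (- 2 * s) * (real a powr \<sigma> * real a powr (- 2 * s)))" by (simp add: F_def)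
    also have "real a powr \<sigma> * real a powr (- 2 * s) = real a powr (\<sigma> - 2 * s)" by (simp add: powr_add[symmetric])
    finally show ?thesis .
  qed
  note step = this
  \<comment> \<open>A block of length \<open>m\<close> consists of \<open>m - 1\<close> free digits
    followed by the distinguished one.\<close>
  have len: "Suc k * m = k * m + Suc (m - 1)" using m by simp
  have "(\<Sum>w\<in>words M (Suc k * m). spaced_prod m (Suc k) w powr \<sigma> * cfq w 0 powr (- 2 * s))
     = (\<Sum>u\<in>words M (k * m). \<Sum>v\<in>words M (m - 1). \<Sum>a=1..M.
         spaced_prod m (Suc k) (u @ v @ [a]) powr \<sigma> * cfq (u @ v @ [a]) 0 powr (- 2 * s))"
    unfolding len sum_words_add sum_words_Suc by simp
  also have "\<dots> \<le> (\<Sum>u\<in>words M (k * m). \<Sum>v\<in>words M (m - 1). \<Sum>a=1..M.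
      F u * (cfq v 0 powr (- 2 * s) * real a powr (\<sigma> - 2 * s)))"
    by (intro sum_mono step)
  also have "\<dots> = (\<Sum>u\<in>words M (k * m). F u) * (word_sum M s (m - 1) * (\<Sum>a=1..M. real a powr (\<sigma> - 2 * s)))"
  proof -
    have eq: "word_sum M s (m - 1) * (\<Sum>a=1..M. real a powr (\<sigma> - 2 * s)) =
        (\<Sum>v\<in>words M (m - 1). \<Sum>a=1..M. cfq v 0 powr (- 2 * s) * real a powr (\<sigma> - 2 * s))"
      unfolding word_sum_def by (rule sum_product)
    show ?thesis unfolding eq by (subst sum_distrib_right, simp only: sum_distrib_left)
  qed
  also have "\<dots> \<le> (word_sum M s (m - 1) * (\<Sum>a=1..M. real a powr (\<sigma> - 2 * s))) ^ k * (word_sum M s (m - 1) * (\<Sum>a=1..M. real a powr (\<sigma> - 2 * s)))"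
    using Suc unfolding F_def by (intro mult_right_mono mult_nonneg_nonneg word_sum_nonneg sum_nonneg) auto
  finally show ?case by (simp add: mult.commute)
qed

text \<open>Completing the square; this turns bounds \<open>exp (- k * n^2 + C * n)\<close> into
  geometric ones.\<close>

lemma quadratic_exponent_le:
  fixes k C x :: real
  assumes "k > 0"
  shows "- k * x\<^sup>2 + C * x \<le> - x + (C + 1)\<^sup>2 / (4 * k)"
proof -
  have "0 \<le> k * (x - (C + 1) / (2 * k))\<^sup>2" using assms by simp
  also have "k * (x - (C + 1) / (2 * k))\<^sup>2 = k * x\<^sup>2 - (C + 1) * x + (C + 1)\<^sup>2 / (4 * k)"
    using assms by (simp add: power2_eq_square field_simps)
  finally show ?thesis by (simp add: algebra_simps)
qed

text \<open>Two margins are built in: \<open>\<sigma> < 2 * s - 1\<close> for convergence over the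
  distinguished digits, and \<open>cf_pressure s < \<sigma> * \<theta>\<close> for a negative
  coefficient of \<open>n^2\<close>. Terms linear in \<open>n\<close> are then harmless.\<close>

lemma hausdorff_measure_E_set_eq_0:
  fixes f :: "nat \<Rightarrow> nat"
  assumes d: "d \<ge> 1" and f: "\<And>n. f n = d * n + t" and \<psi>: "\<And>n. n \<ge> 1 \<Longrightarrow> \<psi> n \<ge> 1"
    and s: "s > 1 / 2" and \<sigma>: "0 \<le> \<sigma>" "\<sigma> < 2 * s - 1"
    and \<theta>: "\<forall>\<^sub>F n in sequentially. \<theta> * (real d * real n) \<le> ln (\<psi> n)"
    and L: "cf_pressure s < \<sigma> * \<theta>"
  shows "hausdorff_measure s (E_set f \<psi>) = 0"
proof -
  have f1: "f n \<ge> 1" if "n \<ge> 1" for n using that d f[of n] by (metis le_add1 le_trans mult_le_mono nat_mult_1)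
  obtain n1 where n1: "\<And>n. n \<ge> n1 \<Longrightarrow> \<theta> * (real d * real n) \<le> ln (\<psi> n)" using \<theta> unfolding eventually_sequentially by auto
  define n0 where "n0 = max n1 1"
  obtain K where K: "K \<ge> 1" "\<And>M. (\<Sum>a=1..M. real a powr (- (2 * s - \<sigma>))) \<le> K"
    using sum_powr_bounded[of "2 * s - \<sigma>"] \<sigma> by auto
  define P where "P = (\<lambda>n w. spaced_prod (f n) n w)"
  define V where "V = (\<lambda>n w. {x \<in> cf_domain. cf_digits x (n * f n) = w \<and> \<psi> n ^ n \<le> P n w})"
  define g where "g = (\<lambda>n w. (P n w powr \<sigma> * cfq w 0 powr (- 2 * s)) / (\<psi> n ^ n) powr \<sigma>)"
  \<comment> \<open>The terms linear in \<open>n\<close>: each of the \<open>n\<close> blocks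
    contributes the constant of \<open>word_sum_le_exp_pressure\<close>, the pressure of its
    \<open>t - 1\<close> surplus digits and the bound \<open>K\<close> for its distinguished
    digit.\<close>
  define C where "C = s * ln 4 + (real t - 1) * cf_pressure s + ln K"
  define k where "k = real d * (\<sigma> * \<theta> - cf_pressure s)"
  have k: "k > 0" using d L by (simp add: k_def)
  define D where "D = exp ((C + 1)\<^sup>2 / (4 * k))"
  show ?thesis
  proof (rule hausdorff_measure_limsup_eq_0[where V = V and g = g and len = "\<lambda>n. n * f n" and start = n0 and \<beta> = "\<lambda>n. D * exp (- 1) ^ n"])
    show "summable (\<lambda>n. D * exp (- 1) ^ n)" by (intro summable_mult summable_geometric) auto
    show "0 \<le> g n w" for n w by (simp add: g_def)
  next
    fix x assume x: "x \<in> E_set f \<psi>"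
    have xd: "x \<in> cf_domain" using E_setD(1)[OF f1 \<psi> x] by blast
    have "\<exists>\<^sub>\<infinity>n. n \<ge> 1 \<and> \<psi> n ^ n \<le> digit_product f n x" using E_setD(2)[OF f1 \<psi> x] by blast
    then show "\<exists>\<^sub>\<infinity>n. \<exists>w. positive_word w \<and> length w = n * f n \<and> x \<in> V n w"
    proof (rule INFM_mono)
      fix n assume n: "1 \<le> n \<and> \<psi> n ^ n \<le> digit_product f n x"
      have "P n (cf_digits x (n * f n)) = digit_product f n x"
        unfolding P_def spaced_prod_def
      proof (intro prod.cong refl)
        fix i assume i: "i \<in> {1..n}"
        \<comment> \<open>Partial quotients are numbered from 1 and list entries from 0.\<close>
        have "1 * 1 \<le> i * f n" "i * f n \<le> n * f n" using i n f1[of n] by (intro mult_mono; simp)+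
        then have "i * f n - 1 < n * f n" "Suc (i * f n - 1) = i * f n" by linarith+
        then show "real (cf_digits x (n * f n) ! (i * f n - 1)) = real (partial_quotient (i * f n) x)" by simp
      qed
      then have "x \<in> V n (cf_digits x (n * f n))" using xd n by (simp add: V_def)
      then show "\<exists>w. positive_word w \<and> length w = n * f n \<and> x \<in> V n w" using cf_digits_positive[OF xd] by force
    qed
  next
    fix n w assume n: "n \<ge> n0" and w: "positive_word w" "length w = n * f n"
    have V: "V n w \<subseteq> {x \<in> cf_domain. cf_digits x (length w) = w}" using w by (auto simp: V_def)
    have q: "cfq w 0 \<ge> 1" using cfq_ge_1 w by auto
    have psi: "\<psi> n ^ n \<ge> 1" using \<psi>[of n] n by (simp add: n0_def)
    have "diameter (V n w) powr s \<le> g n w"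
    proof (cases "\<psi> n ^ n \<le> P n w")
      case True
      have "diameter (V n w) powr s \<le> (1 / (cfq w 0)\<^sup>2) powr s"
        using diameter_cylinder_le[OF w(1) V] s diameter_ge_0[OF bounded_cf_domain[of "V n w"]] V by (intro powr_mono2) auto
      also have "\<dots> = cfq w 0 powr (- 2 * s)"
        using q powr_powr[of "cfq w 0" "- 2" s] by (simp add: powr_minus powr_numeral divide_inverse)
      \<comment> \<open>Chebyshev's inequality: the inserted factor is at least 1 because
        \<open>\<psi> n ^ n\<close> is at most \<open>P n w\<close>.\<close>
      also have "\<dots> \<le> cfq w 0 powr (- 2 * s) * (P n w powr \<sigma> / (\<psi> n ^ n) powr \<sigma>)"
      proof -
        have "(\<psi> n ^ n) powr \<sigma> > 0" using psi powr_gt_zero[of "\<psi> n ^ n" \<sigma>] by linarith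
        then have "1 \<le> P n w powr \<sigma> / (\<psi> n ^ n) powr \<sigma>"
          using True psi \<sigma> powr_mono2[of \<sigma> "\<psi> n ^ n" "P n w"] by (subst le_divide_eq_1_pos) auto
        then show ?thesis using mult_left_mono[of 1 _ "cfq w 0 powr (- 2 * s)"] by (metis mult.right_neutral powr_ge_zero)
      qed
      finally show ?thesis by (simp add: g_def mult.commute)
    next
      case False
      then have "V n w = {}" by (auto simp: V_def)
      then show ?thesis by (simp add: g_def)
    qed
    then show "bounded (V n w) \<and> diameter (V n w) powr s \<le> g n w" using V bounded_cf_domain[of "V n w"] by auto
  next
    fix M n assume n: "n \<ge> n0"
    have n1': "n \<ge> 1" "\<psi> n \<ge> 1" "\<theta> * (real d * real n) \<le> ln (\<psi> n)" using n \<psi> n1 by (auto simp: n0_def)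
    have fn: "real (f n - 1) = real d * real n + real t - 1" using f1[OF n1'(1)] f[of n] by (simp add: of_nat_diff)
    have "(\<Sum>w\<in>words M (n * f n). g n w) = (\<Sum>w\<in>words M (n * f n). spaced_prod (f n) n w powr \<sigma> * cfq w 0 powr (- 2 * s)) / (\<psi> n ^ n) powr \<sigma>"
      by (simp add: g_def P_def sum_divide_distrib)
    also have "\<dots> \<le> (word_sum M s (f n - 1) * (\<Sum>a=1..M. real a powr (\<sigma> - 2 * s))) ^ n / (\<psi> n ^ n) powr \<sigma>"
      using s f1[OF n1'(1)] by (intro divide_right_mono sum_spaced_prod_le) auto
    also have "\<dots> \<le> (4 powr s * exp (real (f n - 1) * cf_pressure s) * K) ^ n / (\<psi> n ^ n) powr \<sigma>"
      using word_sum_le_exp_pressure[OF s, of M "f n - 1"] K(2)[of M] word_sum_nonneg[of M s "f n - 1"]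
      by (intro divide_right_mono power_mono mult_mono mult_nonneg_nonneg sum_nonneg) auto
    also have "\<dots> = exp (real n * (s * ln 4 + real (f n - 1) * cf_pressure s + ln K) - \<sigma> * (real n * ln (\<psi> n)))"
    proof -
      have "4 powr s * exp (real (f n - 1) * cf_pressure s) * K = exp (s * ln 4 + real (f n - 1) * cf_pressure s + ln K)"
        using K by (simp add: powr_def exp_add)
      moreover have "(\<psi> n ^ n) powr \<sigma> = exp (\<sigma> * (real n * ln (\<psi> n)))" using n1' by (simp add: powr_def ln_realpow)
      ultimately show ?thesis by (simp add: exp_of_nat_mult exp_diff)
    qed
    also have "\<dots> \<le> exp (- k * (real n)\<^sup>2 + C * real n)"
    proof -
      have "\<sigma> * (real n * (\<theta> * (real d * real n))) \<le> \<sigma> * (real n * ln (\<psi> n))"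
        using \<sigma> n1' by (intro mult_left_mono) auto
      moreover have "real n * (s * ln 4 + real (f n - 1) * cf_pressure s + ln K) - \<sigma> * (real n * (\<theta> * (real d * real n)))
          = - k * (real n)\<^sup>2 + C * real n"
        unfolding fn k_def C_def by (simp add: algebra_simps power2_eq_square)
      ultimately show ?thesis by simp
    qed
    also have "\<dots> \<le> exp (- real n + (C + 1)\<^sup>2 / (4 * k))" using quadratic_exponent_le[OF k] by (simp only: exp_le_cancel_iff)
    also have "\<dots> = D * exp (- 1) ^ n" by (subst exp_add) (simp add: D_def exp_of_nat_mult[symmetric])
    finally show "(\<Sum>w\<in>words M (n * f n). g n w) \<le> D * exp (- 1) ^ n" .
  qed (use s in auto)
qed

section \<open>Infinite \<open>B\<close>: covers by large quotients\<close>

text \<open>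
  A sequence that is infinitely often at least \<open>c\<^sup>p\<close> cannot grow by a factor less than
  \<open>c' < c\<close> at every step at which it is large.
\<close>
lemma frequently_large_and_growing:
  fixes l :: "nat \<Rightarrow> real"
  assumes c: "1 < c'" "c' < c" and inf: "\<exists>\<^sub>\<infinity>p. c ^ p \<le> l p"
  shows "\<exists>\<^sub>\<infinity>m. c ^ Suc m \<le> l (Suc m) \<and> c' * l m \<le> l (Suc m)"
proof (rule ccontr)
  assume "\<not> ?thesis"
  then obtain m0 where m0: "\<And>m. m \<ge> m0 \<Longrightarrow> \<not> (c ^ Suc m \<le> l (Suc m) \<and> c' * l m \<le> l (Suc m))"
    unfolding INFM_nat_le by blast
  obtain k where k: "l m0 < (c / c') ^ k" using real_arch_pow[of "c / c'" "l m0"] c by auto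
  obtain p where p: "p \<ge> m0 + k" "c ^ p \<le> l p" using inf unfolding INFM_nat_le by blast
  \<comment> \<open>Going down from \<open>p\<close>, each step divides the lower bound by
    \<open>c'\<close> only. The bound therefore stays above \<open>c ^ (p - j)\<close>, so every
    step on the way counts as large and must fail the growth condition.\<close>
  have "c ^ p / c' ^ j \<le> l (p - j)" if "j \<le> p - m0" for j
    using that
  proof (induction j)
    case 0
    then show ?case using p by simp
  next
    case (Suc j)
    define m where "m = p - Suc j"
    have m: "m \<ge> m0" "Suc m = p - j" "p = Suc m + j" using Suc p unfolding m_def by auto
    have "c ^ Suc m * c' ^ j \<le> c ^ Suc m * c ^ j" using c by (intro mult_left_mono power_mono) auto
    then have "c ^ Suc m * c' ^ j \<le> c ^ p" unfolding m(3) power_add .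
    moreover have c'j: "0 < c' ^ j" using c by simp
    ultimately have "c ^ Suc m \<le> c ^ p / c' ^ j" by (simp only: pos_le_divide_eq)
    also have "\<dots> \<le> l (Suc m)" using Suc by (simp add: m(2))
    finally have "l (Suc m) < c' * l m" using m0[OF m(1)] by auto
    moreover have "c ^ p / c' ^ j \<le> l (Suc m)" using Suc by (simp add: m(2))
    ultimately have "c ^ p / c' ^ j < c' * l m" by linarith
    then show ?case using c by (simp add: m_def[symmetric] field_simps)
  qed
  \<comment> \<open>At \<open>m0\<close> the bound has become
    \<open>c ^ m0 * (c / c') ^ (p - m0)\<close>, which is unbounded in \<open>p\<close>.\<close>
  from this[of "p - m0"] have "c ^ p / c' ^ (p - m0) \<le> l m0" using p by simp
  moreover have "c ^ p / c' ^ (p - m0) = c ^ m0 * (c / c') ^ (p - m0)"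
    using p by (simp add: power_divide power_add[symmetric])
  moreover have "1 * (c / c') ^ k \<le> c ^ m0 * (c / c') ^ (p - m0)"
    using c p by (intro mult_mono power_increasing) auto
  ultimately show False using k by linarith
qed

text \<open>The exponent \<open>a * c ^ m\<close> eventually exceeds
  \<open>m * (ln K + 1)\<close>.\<close>

lemma summable_power_double_exponential:
  fixes K c a :: real
  assumes "K \<ge> 1" "c > 1" "a > 0"
  shows "summable (\<lambda>m. K ^ m * exp (- a * c ^ m))"
proof -
  have "(\<lambda>m. real m * (1 / c) ^ m) \<longlonglongrightarrow> 0" using assms by (intro powser_times_n_limit_0) auto
  then have "(\<lambda>m. (ln K + 1) * (real m * (1 / c) ^ m)) \<longlonglongrightarrow> (ln K + 1) * 0" by (intro tendsto_intros)
  then have ev: "\<forall>\<^sub>F m in sequentially. (ln K + 1) * (real m * (1 / c) ^ m) < a"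
    using order_tendstoD(2)[of _ 0 sequentially a] assms by simp
  have "\<forall>\<^sub>F m in sequentially. norm (K ^ m * exp (- a * c ^ m)) \<le> exp (- 1) ^ m"
    using ev
  proof eventually_elim
    case (elim m)
    then have "(ln K + 1) * (real m * (1 / c) ^ m) * c ^ m \<le> a * c ^ m" using assms by (intro mult_right_mono) auto
    then have "(ln K + 1) * real m \<le> a * c ^ m" using assms by (simp add: power_divide)
    then have "real m * ln K - a * c ^ m \<le> real m * (- 1)" by (simp add: algebra_simps)
    then have "exp (real m * ln K - a * c ^ m) \<le> exp (real m * (- 1))" by (simp only: exp_le_cancel_iff)
    then show ?case using assms exp_of_nat_mult[of m "1 :: real"]
      by (simp add: exp_diff exp_of_nat_mult exp_minus field_simps)
  qed
  moreover have "summable (\<lambda>m. exp (- 1 :: real) ^ m)" by (intro summable_geometric) auto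
  ultimately show ?thesis by (rule summable_comparison_test_ev)
qed

text \<open>
  Besides the cylinder lengths, only \<open>q\<^sub>m\<^sub>+\<^sub>1 \<ge> max (exp (c\<^sup>m\<^sup>+\<^sup>1)) (q\<^sub>m powr c')\<close> is used: the second
  bound gives the exponent \<open>1 / (1 + c')\<close>, and a small power of the first one beats the exponentially
  growing number of words.
\<close>
lemma hausdorff_measure_large_quotients_eq_0:
  assumes c: "1 < c'" "c' < c" and s: "s > 1 / (1 + c')" and E: "E \<subseteq> cf_domain"
    and large: "\<And>x. x \<in> E \<Longrightarrow> \<exists>\<^sub>\<infinity>p. c ^ p \<le> ln (partial_quotient p x)"
  shows "hausdorff_measure s E = 0"
proof -
  have s0: "s > 0" using s c by (smt (verit) divide_pos_pos)
  have s1: "s * (1 + c') > 1" using s c by (simp add: field_simps)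
  \<comment> \<open>The portion of the exponent \<open>s\<close> spent on the bound
    \<open>exp (c ^ Suc m)\<close>. Half of the surplus \<open>s * (1 + c') - 1\<close> is given up
    for it, divided by \<open>c'\<close> because \<open>\<theta>\<close> is missing
    \<open>c'\<close> times in \<open>s + c' * (s - \<theta>)\<close>.\<close>
  define \<theta> where "\<theta> = min s ((s * (1 + c') - 1) / (2 * c'))"
  have \<theta>: "0 < \<theta>" "\<theta> \<le> s" using s0 s1 c by (auto simp: \<theta>_def)
  have "c' * \<theta> \<le> c' * ((s * (1 + c') - 1) / (2 * c'))" using c unfolding \<theta>_def by (intro mult_left_mono) auto
  also have "\<dots> = (s * (1 + c') - 1) / 2" using c by (simp add: field_simps)
  finally have \<theta>': "s + c' * (s - \<theta>) > 1" using s1 by (simp add: algebra_simps)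
  \<comment> \<open>The remaining power of \<open>q\<close> is \<open>- 2 * s'\<close>, and
    \<open>2 * s' > 1\<close> makes the one-digit sum converge.\<close>
  define s' where "s' = (s + c' * (s - \<theta>)) / 2"
  have s': "s' > 1 / 2" using \<theta>' by (simp add: s'_def)
  obtain K where K: "K \<ge> 1" "\<And>M. (\<Sum>a=1..M. real a powr (- (2 * s'))) \<le> K"
    using sum_powr_bounded[of "2 * s'"] s' by auto
  define V where "V = (\<lambda>m w. {x \<in> cf_domain. cf_digits x m = w \<and>
    exp (c ^ Suc m) \<le> cfq (cf_digits x (Suc m)) 0 \<and> cfq w 0 powr c' \<le> cfq (cf_digits x (Suc m)) 0})"
  define g where "g = (\<lambda>m w. 4 powr s * exp (- \<theta> * c ^ Suc m) * cfq w 0 powr (- 2 * s'))"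
  show ?thesis
  proof (rule hausdorff_measure_limsup_eq_0[where V = V and g = g and len = "\<lambda>m. m" and start = 0
        and \<beta> = "\<lambda>m. 4 powr s * (K ^ m * exp (- (\<theta> * c) * c ^ m))"])
    show "summable (\<lambda>m. 4 powr s * (K ^ m * exp (- (\<theta> * c) * c ^ m)))"
      using K c \<theta> by (intro summable_mult summable_power_double_exponential) auto
    show "0 \<le> g m w" for m w by (simp add: g_def)
  next
    fix M m
    have "word_sum M s' m \<le> word_sum M s' 1 ^ m" using s' by (intro word_sum_le_power) auto
    also have "\<dots> \<le> K ^ m" using K(2)[of M] by (intro power_mono word_sum_nonneg) (simp add: word_sum_1)
    finally have "word_sum M s' m \<le> K ^ m" .
    then have "4 powr s * exp (- \<theta> * c ^ Suc m) * word_sum M s' m \<le> 4 powr s * exp (- \<theta> * c ^ Suc m) * K ^ m"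
      by (intro mult_left_mono) auto
    then show "(\<Sum>w\<in>words M m. g m w) \<le> 4 powr s * (K ^ m * exp (- (\<theta> * c) * c ^ m))"
      unfolding g_def word_sum_def by (simp add: sum_distrib_left mult_ac)
  next
    fix m w assume w: "positive_word w" "length w = m"
    have Vs: "V m w \<subseteq> cf_domain" by (auto simp: V_def)
    define q Y where "q = cfq w 0" and "Y = max (exp (c ^ Suc m)) (q powr c')"
    have q: "q \<ge> 1" using cfq_ge_1 w unfolding q_def by auto
    have Y: "Y > 0" "Y \<ge> exp (c ^ Suc m)" "Y \<ge> q powr c'" by (auto simp: Y_def less_max_iff_disj)
    \<comment> \<open>The next digit is at least \<open>Y / (2 * q)\<close>, so the points of
      \<open>V m w\<close> crowd at the endpoint \<open>cf_eval w 0\<close>, in a set of size about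
      \<open>q / Y\<close> times that of the cylinder.\<close>
    have near: "\<bar>x - cf_eval w 0\<bar> \<le> 2 / (q * Y)" if x: "x \<in> V m w" for x
    proof -
      define y a where "y = (gauss_map ^^ m) x" and "a = partial_quotient (Suc m) x"
      have xd: "x \<in> cf_domain" "cf_digits x m = w" using x by (auto simp: V_def)
      have a: "a \<ge> 1" using partial_quotient_ge_1[OF xd(1)] by (simp add: a_def)
      have y: "0 < y" "y < 1" "y \<in> cf_domain"
        using cf_domain_pos[OF funpow_gauss_map_cf_domain[OF xd(1)]] funpow_gauss_map_cf_domain[OF xd(1)]
        by (auto simp: y_def)
      have "y = 1 / (real a + gauss_map y)"
        using cf_domain_step[OF y(3)] by (simp add: a_def y_def partial_quotient_def)
      moreover have "1 / (real a + gauss_map y) \<le> 1 / real a"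
        using gauss_map_range(1)[of y] a by (intro divide_left_mono) auto
      ultimately have ya: "y \<le> 1 / real a" by linarith
      have "Y \<le> cfq (w @ [a]) 0" using x xd unfolding V_def Y_def q_def a_def by simp
      also have "\<dots> \<le> 2 * q * real a" using cfq_append_le[of w "[a]"] w a by (simp add: q_def)
      finally have Ya: "Y \<le> 2 * q * real a" .
      have "\<bar>x - cf_eval w 0\<bar> = \<bar>cf_eval w y - cf_eval w 0\<bar>"
        using cf_digits_split[OF xd(1), of m] xd by (simp add: y_def)
      also have "\<dots> \<le> \<bar>y - 0\<bar> / q\<^sup>2" unfolding q_def using w y by (intro cf_eval_diff_le) auto
      also have "\<dots> \<le> (1 / real a) / q\<^sup>2" using ya y by (intro divide_right_mono) auto
      also have "\<dots> \<le> 2 / (q * Y)"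
        using mult_left_mono[OF Ya, of q] q a Y by (simp add: field_simps power2_eq_square)
      finally show ?thesis .
    qed
    have "diameter (V m w) \<le> 4 / (q * Y)"
    proof (rule diameter_le)
      fix x x' assume "x \<in> V m w" "x' \<in> V m w"
      then show "norm (x - x') \<le> 4 / (q * Y)" using near[of x] near[of x'] unfolding real_norm_def by argo
    qed (use q Y in auto)
    then have "diameter (V m w) powr s \<le> (4 / (q * Y)) powr s"
      using s0 diameter_ge_0[OF bounded_cf_domain[OF Vs]] by (intro powr_mono2) auto
    also have "\<dots> = 4 powr s * (q powr (- s) * Y powr (- s))"
      using q Y by (simp add: powr_divide powr_mult powr_minus field_simps)
    also have "\<dots> \<le> 4 powr s * (q powr (- s) * (exp (- \<theta> * c ^ Suc m) * q powr (- (c' * (s - \<theta>)))))"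
    proof -
      have "Y powr (- \<theta>) \<le> exp (c ^ Suc m) powr (- \<theta>)" using Y \<theta> by (intro powr_mono2') auto
      moreover have "Y powr (- (s - \<theta>)) \<le> (q powr c') powr (- (s - \<theta>))" using Y \<theta> q by (intro powr_mono2') auto
      moreover have "exp (c ^ Suc m) powr (- \<theta>) = exp (- \<theta> * c ^ Suc m)" by (simp add: powr_def)
      moreover have "(q powr c') powr (- (s - \<theta>)) = q powr (- (c' * (s - \<theta>)))"
        by (simp add: powr_powr algebra_simps)
      moreover have "Y powr (- s) = Y powr (- \<theta>) * Y powr (- (s - \<theta>))" by (simp add: powr_add[symmetric])
      ultimately have "Y powr (- s) \<le> exp (- \<theta> * c ^ Suc m) * q powr (- (c' * (s - \<theta>)))"
        by (simp only:) (intro mult_mono; simp)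
      then show ?thesis by (intro mult_left_mono) auto
    qed
    also have "\<dots> = g m w"
    proof -
      have e: "- 2 * s' = - s + - (c' * (s - \<theta>))" by (simp add: s'_def)
      show ?thesis unfolding g_def q_def[symmetric] e powr_add by simp
    qed
    finally have "diameter (V m w) powr s \<le> g m w" .
    then show "bounded (V m w) \<and> diameter (V m w) powr s \<le> g m w" using bounded_cf_domain[OF Vs] by simp
  next
    fix x assume x: "x \<in> E"
    have xd: "x \<in> cf_domain" using x E by auto
    define l where "l = (\<lambda>m. ln (cfq (cf_digits x m) 0))"
    have q: "cfq (cf_digits x m) 0 \<ge> 1" for m using cfq_ge_1 cf_digits_positive[OF xd] by auto
    have "\<exists>\<^sub>\<infinity>p. c ^ p \<le> l p"
      unfolding INFM_nat_le
    proof
      fix N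
      obtain p where p: "p \<ge> Suc N" "c ^ p \<le> ln (real (partial_quotient p x))"
        using large[OF x] unfolding INFM_nat_le by blast
      then obtain m where m: "p = Suc m" by (cases p) auto
      have a: "partial_quotient p x \<ge> 1" using partial_quotient_ge_1[OF xd] m by simp
      have "1 * real (partial_quotient p x) \<le> cfq (cf_digits x m) 0 * cfq [partial_quotient p x] 0"
        using q[of m] by (intro mult_mono) auto
      also have "\<dots> \<le> cfq (cf_digits x p) 0"
        using cfq_append_ge[of "cf_digits x m" "[partial_quotient p x]"] cf_digits_positive[OF xd] a m by simp
      finally have "ln (real (partial_quotient p x)) \<le> l p" unfolding l_def using a by simp
      then show "\<exists>p\<ge>N. c ^ p \<le> l p" using p by (intro exI[of _ p]) auto
    qed
    then have "\<exists>\<^sub>\<infinity>m. c ^ Suc m \<le> l (Suc m) \<and> c' * l m \<le> l (Suc m)"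
      by (rule frequently_large_and_growing[OF c])
    then show "\<exists>\<^sub>\<infinity>m. \<exists>w. positive_word w \<and> length w = m \<and> x \<in> V m w"
    proof (rule INFM_mono)
      fix m assume m: "c ^ Suc m \<le> l (Suc m) \<and> c' * l m \<le> l (Suc m)"
      have "exp (c ^ Suc m) \<le> cfq (cf_digits x (Suc m)) 0"
        using m q[of "Suc m"] unfolding l_def by (subst ln_ge_iff[symmetric]) auto
      moreover have "cfq (cf_digits x m) 0 powr c' \<le> cfq (cf_digits x (Suc m)) 0"
      proof -
        have "exp (c' * l m) \<le> exp (l (Suc m))" using m by simp
        also have "exp (l (Suc m)) = cfq (cf_digits x (Suc m)) 0"
          using q[of "Suc m"] unfolding l_def by (intro exp_ln) linarith
        finally show ?thesis using q[of m] by (simp add: l_def powr_def)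
      qed
      ultimately have "x \<in> V m (cf_digits x m)" using xd by (simp add: V_def del: cf_digits_simps(3))
      then show "\<exists>w. positive_word w \<and> length w = m \<and> x \<in> V m w" using cf_digits_positive[OF xd] by force
    qed
  qed (use s0 in auto)
qed

section \<open>A mass distribution principle for random continued fractions\<close>

text \<open>\<open>A k\<close> is the scale of the digit \<open>a k\<close>. By
  \<open>prob_digit\<close> the next digit is, up to a constant, spread at least as evenly as over
  \<open>A p\<close> values. \<open>prob_prefix\<close> is the Hoelder bound at the length
  \<open>1 / (A p * q^2)\<close> of the interval filled by the admissible next digits, not at the
  cylinder length \<open>1 / q^2\<close>.\<close>

locale random_cf = prob_space P for P :: "'w measure" +
  fixes a :: "nat \<Rightarrow> 'w \<Rightarrow> nat" and A :: "nat \<Rightarrow> nat" and M :: nat and C s :: real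
  assumes measurable_digit [measurable]: "\<And>k. a k \<in> P \<rightarrow>\<^sub>M count_space UNIV"
    and A_ge_1: "\<And>k. A k \<ge> 1" and M_ge_1: "M \<ge> 1" and C_pos: "C > 0" and s_pos: "0 < s" and s_le_1: "s \<le> 1"
    and AE_digit: "AE \<omega> in P. \<forall>k. A k \<le> a k \<omega> \<and> a k \<omega> \<le> M * A k"
    and prob_digit: "\<And>p u j. prob {\<omega> \<in> space P. (\<forall>k<p. a k \<omega> = u k) \<and> a p \<omega> = j}
      \<le> C * prob {\<omega> \<in> space P. \<forall>k<p. a k \<omega> = u k} / real (A p)"
    and prob_prefix: "\<And>p u. (\<And>k. k < p \<Longrightarrow> A k \<le> u k \<and> u k \<le> M * A k) \<Longrightarrow>
      prob {\<omega> \<in> space P. \<forall>k<p. a k \<omega> = u k} \<le> C * (real (A p) * (cfq (map u [0..<p]) 0)\<^sup>2) powr (- s)"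
begin

definition val :: "'w \<Rightarrow> real" where "val \<omega> = cf_val (\<lambda>k. a k \<omega>)"

definition good :: "'w set" where "good = {\<omega> \<in> space P. \<forall>k. A k \<le> a k \<omega> \<and> a k \<omega> \<le> M * A k}"

lemma measurable_cf_eval: "(\<lambda>\<omega>. cf_eval (map (\<lambda>k. a k \<omega>) ks) 0) \<in> borel_measurable P"
proof (induction ks)
  case (Cons k ks)
  note [measurable] = Cons
  show ?case by simp
qed simp

lemma measurable_val [measurable]: "val \<in> borel_measurable P"
  unfolding val_def cf_val_def by (intro borel_measurable_lim_metric measurable_cf_eval)

lemma measurable_good [measurable]: "good \<in> sets P"
  unfolding good_def by measurable

lemma goodD: "\<omega> \<in> good \<Longrightarrow> A k \<le> a k \<omega> \<and> a k \<omega> \<le> M * A k \<and> 1 \<le> a k \<omega>"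
  using A_ge_1[of k] unfolding good_def by (auto intro: order_trans)

lemma tail_bounds:
  fixes n :: nat
  assumes "\<omega> \<in> good"
  defines "z \<equiv> cf_val (\<lambda>i. a (i + n) \<omega>)"
  shows "0 < z" "z < 1" "A n = 1 \<Longrightarrow> 1 / (real M + 1) \<le> z" "A n \<noteq> 1 \<Longrightarrow> z \<le> 1 / 2"
    "z = 1 / (real (a n \<omega>) + cf_val (\<lambda>i. a (i + Suc n) \<omega>))"
proof -
  have pos: "\<forall>i. 1 \<le> a (i + m) \<omega>" for m using goodD[OF assms(1)] by auto
  show z: "0 < z" "z < 1" unfolding z_def using cf_val_unfold(2,3)[OF pos] by auto
  define z' where "z' = cf_val (\<lambda>i. a (i + Suc n) \<omega>)"
  have z': "0 < z'" "z' < 1" unfolding z'_def by (rule cf_val_unfold(2)[OF pos], rule cf_val_unfold(3)[OF pos])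
  have e: "z = 1 / (real (a n \<omega>) + z')" unfolding z_def z'_def using cf_val_unfold(1)[OF pos[of n]] by simp
  then show "z = 1 / (real (a n \<omega>) + cf_val (\<lambda>i. a (i + Suc n) \<omega>))" by (simp add: z'_def)
  have d: "A n \<le> a n \<omega>" "a n \<omega> \<le> M * A n" "1 \<le> a n \<omega>" using goodD[OF assms(1)] by auto
  show "1 / (real M + 1) \<le> z" if "A n = 1"
  proof -
    have "real (a n \<omega>) \<le> real M" using d that by simp
    then show ?thesis unfolding e using z' d by (intro divide_left_mono) auto
  qed
  show "z \<le> 1 / 2" if "A n \<noteq> 1"
  proof -
    have "2 \<le> a n \<omega>" using d that A_ge_1[of n] by linarith
    then have "2 \<le> real (a n \<omega>)" by simp
    then have "1 / (real (a n \<omega>) + z') \<le> 1 / 2" using z' by (intro divide_left_mono) auto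
    then show ?thesis unfolding e .
  qed
qed

text \<open>
  The tails of \<open>\<omega>\<close> and \<open>\<omega>'\<close> after position \<open>p\<close> cannot be close to 0 and close to 1, respectively:
  if \<open>A (p + 1) = 1\<close> both are bounded away from 0, otherwise both are at most \<open>1 / 2\<close>.
\<close>
lemma val_separation:
  assumes \<omega>: "\<omega> \<in> good" "\<omega>' \<in> good" and agree: "\<And>k. k < p \<Longrightarrow> a k \<omega> = u k \<and> a k \<omega>' = u k"
    and less: "a p \<omega> < a p \<omega>'"
  shows "real (a p \<omega>' - a p \<omega>) \<le>
    16 * (real M)\<^sup>2 * (real M + 1) * (real (A p))\<^sup>2 * (cfq (map u [0..<p]) 0)\<^sup>2 * \<bar>val \<omega> - val \<omega>'\<bar>"
proof -
  define y y' z z' where "y = cf_val (\<lambda>i. a (i + p) \<omega>)" and "y' = cf_val (\<lambda>i. a (i + p) \<omega>')"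
    and "z = cf_val (\<lambda>i. a (i + Suc p) \<omega>)" and "z' = cf_val (\<lambda>i. a (i + Suc p) \<omega>')"
  define j j' where "j = real (a p \<omega>)" and "j' = real (a p \<omega>')"
  define q where "q = cfq (map u [0..<p]) 0"
  have pw: "positive_word (map u [0..<p])"
  proof -
    have "u k \<ge> 1" if "k < p" for k using agree[OF that] goodD[OF \<omega>(1), of k] by auto
    then show ?thesis by auto
  qed
  then have q: "q \<ge> 1" unfolding q_def using cfq_ge_1 by auto
  have yb: "0 < y" "y < 1" "0 < y'" "y' < 1" unfolding y_def y'_def
    using tail_bounds(1,2)[OF \<omega>(1), of p] tail_bounds(1,2)[OF \<omega>(2), of p] by auto
  have zb: "0 < z" "z < 1" "0 < z'" "z' < 1" unfolding z_def z'_def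
    using tail_bounds(1,2)[OF \<omega>(1), of "Suc p"] tail_bounds(1,2)[OF \<omega>(2), of "Suc p"] by auto
  have ye: "y = 1 / (j + z)" "y' = 1 / (j' + z')"
    unfolding y_def y'_def z_def z'_def j_def j'_def using tail_bounds(5)[OF \<omega>(1), of p] tail_bounds(5)[OF \<omega>(2), of p] by auto
  have v: "val \<omega> = cf_eval (map u [0..<p]) y" "val \<omega>' = cf_eval (map u [0..<p]) y'"
  proof -
    have m: "map (\<lambda>k. a k \<omega>) [0..<p] = map u [0..<p]" "map (\<lambda>k. a k \<omega>') [0..<p] = map u [0..<p]"
      using agree by auto
    show "val \<omega> = cf_eval (map u [0..<p]) y"
      unfolding val_def y_def m(1)[symmetric] by (rule cf_val_split) (use goodD \<omega> in blast)
    show "val \<omega>' = cf_eval (map u [0..<p]) y'"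
      unfolding val_def y'_def m(2)[symmetric] by (rule cf_val_split) (use goodD \<omega> in blast)
  qed
  have M1: "real M \<ge> 1" using M_ge_1 by simp
  \<comment> \<open>A tail whose first digit is at most \<open>M\<close> is at least
    \<open>1 / (M + 1)\<close>.\<close>
  define \<kappa> where "\<kappa> = 1 / (real M + 1)"
  have \<kappa>: "0 < \<kappa>" "\<kappa> \<le> 1 / 2" using M1 by (auto simp: \<kappa>_def field_simps)
  have zz: "\<bar>z - z'\<bar> \<le> 1 - \<kappa>"
  proof (cases "A (Suc p) = 1")
    case True
    then have "\<kappa> \<le> z" "\<kappa> \<le> z'" unfolding z_def z'_def \<kappa>_def
      using tail_bounds(3)[OF \<omega>(1) True] tail_bounds(3)[OF \<omega>(2) True] by auto
    then show ?thesis using zb by linarith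
  next
    case False
    then have "z \<le> 1 / 2" "z' \<le> 1 / 2" unfolding z_def z'_def
      using tail_bounds(4)[OF \<omega>(1) False] tail_bounds(4)[OF \<omega>(2) False] by auto
    then show ?thesis using zb \<kappa> by linarith
  qed
  have jj: "j' - j \<ge> 1" "1 \<le> j" "j \<le> real M * real (A p)" "1 \<le> j'" "j' \<le> real M * real (A p)"
    using less goodD[OF \<omega>(1), of p] goodD[OF \<omega>(2), of p] unfolding j_def j'_def
    by (auto simp: of_nat_mult[symmetric] simp del: of_nat_mult)
  \<comment> \<open>The integers \<open>j < j'\<close> differ by at least 1, so a shift by at most
    \<open>1 - \<kappa>\<close> leaves a definite fraction of \<open>j' - j\<close>.\<close>
  have "\<kappa> * (j' - j) \<le> (j' - j) - (1 - \<kappa>) "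
  proof -
    have "0 \<le> (1 - \<kappa>) * (j' - j - 1)" using \<kappa> jj by (intro mult_nonneg_nonneg) auto
    then show ?thesis by (simp add: algebra_simps)
  qed
  then have num: "\<kappa> * (j' - j) \<le> (j' + z') - (j + z)" using zz by linarith
  have den: "(j + z) * (j' + z') \<le> (2 * real M * real (A p)) * (2 * real M * real (A p))"
    using jj zb by (intro mult_mono) auto
  have jz: "j + z > 0" "j' + z' > 0" using jj zb by linarith+
  have "y - y' = ((j' + z') - (j + z)) / ((j + z) * (j' + z'))" unfolding ye using jz by (simp add: field_simps)
  also have "\<dots> \<ge> \<kappa> * (j' - j) / ((2 * real M * real (A p)) * (2 * real M * real (A p)))"
  proof (rule frac_le)
    have "0 \<le> \<kappa> * (j' - j)" using \<kappa> jj by (intro mult_nonneg_nonneg) auto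
    then show "0 \<le> (j' + z') - (j + z)" using num by linarith
  qed (use num den jz in auto)
  finally have yy: "\<kappa> * (j' - j) / (4 * (real M)\<^sup>2 * (real (A p))\<^sup>2) \<le> \<bar>y - y'\<bar>"
    by (simp add: power2_eq_square mult_ac)
  have "\<bar>y - y'\<bar> / (4 * q\<^sup>2) \<le> \<bar>val \<omega> - val \<omega>'\<bar>"
    unfolding v q_def using pw yb by (intro cf_eval_diff_ge) auto
  then have "\<bar>y - y'\<bar> \<le> 4 * q\<^sup>2 * \<bar>val \<omega> - val \<omega>'\<bar>" using q by (simp add: field_simps)
  with yy have "\<kappa> * (j' - j) / (4 * (real M)\<^sup>2 * (real (A p))\<^sup>2) \<le> 4 * q\<^sup>2 * \<bar>val \<omega> - val \<omega>'\<bar>" by linarith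
  moreover have "real (A p) > 0" using A_ge_1[of p] by simp
  ultimately have "\<kappa> * (j' - j) \<le> 4 * q\<^sup>2 * \<bar>val \<omega> - val \<omega>'\<bar> * (4 * (real M)\<^sup>2 * (real (A p))\<^sup>2)"
    using M1 by (subst (asm) pos_divide_le_eq) auto
  then have "j' - j \<le> 4 * q\<^sup>2 * \<bar>val \<omega> - val \<omega>'\<bar> * (4 * (real M)\<^sup>2 * (real (A p))\<^sup>2) * (real M + 1)"
    using M1 by (simp add: \<kappa>_def pos_divide_le_eq)
  then show ?thesis using less unfolding q_def j_def j'_def by (simp add: of_nat_diff mult_ac)
qed

text \<open>Let \<open>p\<close> be the first position at which points of the interval disagree. The
  mass is at most that of the common prefix, and also at most the number of digits in the range
  occurring at \<open>p\<close> times \<open>C / A p\<close> of it; \<open>val_separation\<close>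
  bounds that number by a constant times \<open>A p ^ 2 * q ^ 2 * r\<close> for an interval of
  length \<open>r\<close>. Interpolating between both bounds gives the power
  \<open>s\<close>.\<close>

lemma prob_interval:
  obtains D where "D > 0" "\<And>\<alpha> \<beta>. \<alpha> < \<beta> \<Longrightarrow> prob {\<omega> \<in> good. val \<omega> \<in> {\<alpha>..\<beta>}} \<le> D * (\<beta> - \<alpha>) powr s"
proof -
  \<comment> \<open>The 16 of \<open>val_separation\<close> is doubled because
    \<open>Max J - Min J + 1\<close> digits are counted; the maximum with 1 gives
    \<open>C <= D\<close>.\<close>
  define k0 where "k0 = max 1 (32 * (real M)\<^sup>2 * (real M + 1) * C)"
  define D where "D = C * k0 powr s"
  have k0: "k0 \<ge> 1" by (simp add: k0_def)
  then have "k0 powr s \<ge> 1" using s_pos by (simp add: ge_one_powr_ge_zero)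
  then have D: "D > 0" "C \<le> D" using C_pos mult_left_mono[of 1 "k0 powr s" C] k0 by (auto simp: D_def)
  have "prob {\<omega> \<in> good. val \<omega> \<in> {\<alpha>..\<beta>}} \<le> D * (\<beta> - \<alpha>) powr s" if ab: "\<alpha> < \<beta>" for \<alpha> \<beta>
  proof -
    define r where "r = \<beta> - \<alpha>"
    have r: "r > 0" using ab by (simp add: r_def)
    define S where "S = {\<omega> \<in> good. val \<omega> \<in> {\<alpha>..\<beta>}}"
    define pre where "pre = (\<lambda>p u. {\<omega> \<in> space P. \<forall>k<p. a k \<omega> = (u k :: nat)})"
    have pre_meas [measurable]: "pre p u \<in> sets P" for p u unfolding pre_def by measurable
    have "prob S \<le> D * r powr s"
    proof (cases "S = {}")
      case True
      then show ?thesis using D by simp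
    next
      case False
      then obtain \<omega>0 where \<omega>0: "\<omega>0 \<in> S" by auto
      define u where "u = (\<lambda>k. a k \<omega>0)"
      have \<omega>0g: "\<omega>0 \<in> good" using \<omega>0 by (simp add: S_def)
      have u: "A k \<le> u k \<and> u k \<le> M * A k" "u k \<ge> 1" for k using goodD[OF \<omega>0g] by (auto simp: u_def)
      have Ssp: "S \<subseteq> space P" by (auto simp: S_def good_def)
      have pp: "prob (pre p u) \<le> C * (real (A p) * (cfq (map u [0..<p]) 0)\<^sup>2) powr (- s)" for p
        unfolding pre_def using u by (intro prob_prefix) auto
      have pw: "positive_word (map u [0..<p])" for p using u by auto
      have q: "cfq (map u [0..<p]) 0 \<ge> 1" for p using cfq_ge_1[OF pw] by simp
      show ?thesis
      proof (cases "\<forall>\<omega>\<in>S. \<forall>k. a k \<omega> = u k")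
        case True
        \<comment> \<open>Only one digit sequence is left, so a prefix long enough for
          \<open>1 / q^2\<close> to be below \<open>r\<close> suffices.\<close>
        obtain p where p: "(1 / 2) ^ p < r / 2" using real_arch_pow_inv[of "r / 2" "1 / 2"] r by auto
        have "S \<subseteq> pre p u" using True Ssp by (auto simp: pre_def)
        then have "prob S \<le> prob (pre p u)" by (intro finite_measure_mono) auto
        also have "\<dots> \<le> C * (real (A p) * (cfq (map u [0..<p]) 0)\<^sup>2) powr (- s)" by (rule pp)
        also have "\<dots> \<le> C * (1 / r) powr (- s)"
        proof -
          have "1 / r \<le> 2 ^ p / 2" using p r by (simp add: field_simps)
          also have "\<dots> \<le> (cfq (map u [0..<p]) 0)\<^sup>2" using cfq_growth[OF pw, of p] by simp
          also have "\<dots> \<le> real (A p) * (cfq (map u [0..<p]) 0)\<^sup>2"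
            using A_ge_1[of p] mult_right_mono[of 1 "real (A p)" "(cfq (map u [0..<p]) 0)\<^sup>2"] by simp
          finally show ?thesis using r s_pos C_pos by (intro mult_left_mono powr_mono2') auto
        qed
        also have "\<dots> = C * r powr s" using r by (simp add: powr_minus powr_divide)
        also have "\<dots> \<le> D * r powr s" using D by (intro mult_right_mono) auto
        finally show ?thesis .
      next
        case False
        then have ex: "\<exists>p. \<exists>\<omega>\<in>S. a p \<omega> \<noteq> u p" by auto
        define p where "p = (LEAST p. \<exists>\<omega>\<in>S. a p \<omega> \<noteq> u p)"
        have p: "\<exists>\<omega>\<in>S. a p \<omega> \<noteq> u p" unfolding p_def using ex by (rule LeastI_ex)
        have agree: "a k \<omega> = u k" if "k < p" "\<omega> \<in> S" for k \<omega>
          using not_less_Least[of k "\<lambda>p. \<exists>\<omega>\<in>S. a p \<omega> \<noteq> u p"] that unfolding p_def by blast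
        define J where "J = a p ` S"
        have finJ: "finite J"
        proof (rule finite_subset)
          show "J \<subseteq> {..M * A p}" unfolding J_def S_def using goodD by auto
        qed simp
        have J: "u p \<in> J" "J \<noteq> {}" using \<omega>0 by (auto simp: J_def u_def)
        obtain \<omega>1 where \<omega>1: "\<omega>1 \<in> S" "a p \<omega>1 = Min J" using Min_in[OF finJ J(2)] unfolding J_def by auto
        obtain \<omega>2 where \<omega>2: "\<omega>2 \<in> S" "a p \<omega>2 = Max J" using Max_in[OF finJ J(2)] unfolding J_def by auto
        have Jb: "Min J \<le> j \<and> j \<le> Max J" if "j \<in> J" for j using finJ that by auto
        have less: "Min J < Max J"
        proof -
          obtain \<omega> where "\<omega> \<in> S" "a p \<omega> \<noteq> u p" using p by blast
          then have "a p \<omega> \<in> J" by (simp add: J_def)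
          then show ?thesis using Jb[OF \<open>u p \<in> J\<close>] Jb[of "a p \<omega>"] \<open>a p \<omega> \<noteq> u p\<close> by linarith
        qed
        define Q where "Q = (cfq (map u [0..<p]) 0)\<^sup>2"
        have Q: "Q \<ge> 1" unfolding Q_def using q by simp
        have Ap: "real (A p) \<ge> 1" using A_ge_1[of p] by simp
        define \<pi> where "\<pi> = prob (pre p u)"
        have "\<bar>val \<omega>1 - val \<omega>2\<bar> \<le> r" using \<omega>1 \<omega>2 unfolding S_def r_def by auto
        then have "16 * (real M)\<^sup>2 * (real M + 1) * (real (A p))\<^sup>2 * Q * \<bar>val \<omega>1 - val \<omega>2\<bar>
            \<le> 16 * (real M)\<^sup>2 * (real M + 1) * (real (A p))\<^sup>2 * Q * r"
          using Q by (intro mult_left_mono) auto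
        moreover have "real (Max J - Min J) \<le> 16 * (real M)\<^sup>2 * (real M + 1) * (real (A p))\<^sup>2 * Q * \<bar>val \<omega>1 - val \<omega>2\<bar>"
          using val_separation[of \<omega>1 \<omega>2 p u] \<omega>1 \<omega>2 agree less by (simp add: S_def Q_def)
        ultimately have gap: "real (Max J - Min J) \<le> 16 * (real M)\<^sup>2 * (real M + 1) * (real (A p))\<^sup>2 * Q * r" by linarith
        have "S \<subseteq> (\<Union>j\<in>{Min J..Max J}. {\<omega> \<in> space P. (\<forall>k<p. a k \<omega> = u k) \<and> a p \<omega> = j})"
          using agree Ssp Jb by (auto simp: J_def)
        then have "prob S \<le> prob (\<Union>j\<in>{Min J..Max J}. {\<omega> \<in> space P. (\<forall>k<p. a k \<omega> = u k) \<and> a p \<omega> = j})"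
          by (intro finite_measure_mono) measurable
        also have "\<dots> \<le> (\<Sum>j\<in>{Min J..Max J}. prob {\<omega> \<in> space P. (\<forall>k<p. a k \<omega> = u k) \<and> a p \<omega> = j})"
          by (intro finite_measure_subadditive_finite) (auto intro!: sets.sets_Collect)
        also have "\<dots> \<le> (\<Sum>j\<in>{Min J..Max J}. C * \<pi> / real (A p))"
          unfolding \<pi>_def pre_def by (intro sum_mono prob_digit)
        also have "\<dots> = real (Max J - Min J + 1) * (C * \<pi> / real (A p))" using less by (simp add: Suc_diff_le)
        also have "\<dots> \<le> (2 * real (Max J - Min J)) * (C * \<pi> / real (A p))"
          using less C_pos by (intro mult_right_mono) (auto simp: \<pi>_def)
        also have "\<dots> \<le> (2 * (16 * (real M)\<^sup>2 * (real M + 1) * (real (A p))\<^sup>2 * Q * r)) * (C * \<pi> / real (A p))"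
          using gap C_pos by (intro mult_right_mono mult_left_mono) (auto simp: \<pi>_def)
        also have "\<dots> = (32 * (real M)\<^sup>2 * (real M + 1) * C) * (r * (real (A p) * Q)) * \<pi>"
          using Ap by (simp add: power2_eq_square)
        also have "\<dots> \<le> k0 * (r * (real (A p) * Q)) * \<pi>"
          using r Ap Q by (intro mult_right_mono) (auto simp: k0_def \<pi>_def)
        finally have le1: "prob S \<le> (k0 * (r * (real (A p) * Q))) * \<pi>" .
        have "S \<subseteq> pre p u" using agree Ssp by (auto simp: pre_def)
        then have le2: "prob S \<le> \<pi>" unfolding \<pi>_def by (intro finite_measure_mono) auto
        define T where "T = k0 * (r * (real (A p) * Q))"
        have T: "T > 0" unfolding T_def using k0 r Ap Q by (intro mult_pos_pos) auto
        \<comment> \<open>The smaller of \<open>T\<close> and 1 is at most \<open>T powr s\<close>,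
          since \<open>0 < s <= 1\<close>.\<close>
        have "prob S \<le> T powr s * \<pi>"
        proof (cases "T \<le> 1")
          case True
          then have "T powr 1 \<le> T powr s" using T s_le_1 by (intro powr_mono') auto
          then have "T * \<pi> \<le> T powr s * \<pi>" using T by (intro mult_right_mono) (auto simp: \<pi>_def)
          then show ?thesis using le1 unfolding T_def by linarith
        next
          case False
          then have "1 \<le> T powr s" using s_pos by (intro ge_one_powr_ge_zero) auto
          then have "1 * \<pi> \<le> T powr s * \<pi>" by (intro mult_right_mono) (auto simp: \<pi>_def)
          then show ?thesis using le2 by linarith
        qed
        also have "\<dots> \<le> T powr s * (C * (real (A p) * Q) powr (- s))"
          using pp[of p] unfolding \<pi>_def Q_def by (intro mult_left_mono) auto
        also have "\<dots> = D * r powr s"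
        proof -
          have "real (A p) * Q > 0" using Ap Q by (intro mult_pos_pos) auto
          then have "(real (A p) * Q) powr s * (real (A p) * Q) powr (- s) = 1"
            using Ap Q by (auto simp: powr_add[symmetric])
          moreover have "T powr s = k0 powr s * r powr s * (real (A p) * Q) powr s"
            unfolding T_def using k0 r Ap Q by (simp add: powr_mult mult.assoc)
          ultimately show ?thesis unfolding D_def by (simp add: mult_ac)
        qed
        finally show ?thesis .
      qed
    qed
    then show ?thesis by (simp add: S_def r_def)
  qed
  then show ?thesis using that D by blast
qed

text \<open>A covering set is replaced by the interval it spans, which has the same diameter and a
  measurable preimage. Length 0 is reached as a limit, since \<open>prob_interval\<close> asks for
  positive length.\<close>

lemma prob_bounded_set:
  obtains D where "D > 0"
    "\<And>U. bounded U \<Longrightarrow> U \<noteq> {} \<Longrightarrow> prob {\<omega> \<in> good. val \<omega> \<in> {Inf U..Sup U}} \<le> D * diameter U powr s"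
proof -
  obtain D where D: "D > 0" "\<And>\<alpha> \<beta>. \<alpha> < \<beta> \<Longrightarrow> prob {\<omega> \<in> good. val \<omega> \<in> {\<alpha>..\<beta>}} \<le> D * (\<beta> - \<alpha>) powr s"
    using prob_interval by blast
  have "prob {\<omega> \<in> good. val \<omega> \<in> {Inf U..Sup U}} \<le> D * diameter U powr s" if U: "bounded U" "U \<noteq> {}" for U
  proof -
    have ex: "prob {\<omega> \<in> good. val \<omega> \<in> {Inf U..Sup U}} \<le> D * (diameter U + e) powr s" if e: "e > 0" for e
    proof -
      have bd: "bdd_above U" "bdd_below U" using U(1) bounded_imp_bdd_above bounded_imp_bdd_below by auto
      have "x - y \<le> diameter U" if "x \<in> U" "y \<in> U" for x y
        using diameter_bounded_bound[OF U(1) that] by (simp add: dist_real_def)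
      then have "x \<le> diameter U + y" if "x \<in> U" "y \<in> U" for x y using that by (simp add: diff_le_eq)
      then have "Sup U \<le> diameter U + y" if "y \<in> U" for y using that U(2) by (intro cSup_least) auto
      then have "Sup U - diameter U \<le> Inf U" using U(2) by (intro cInf_greatest) (auto simp: algebra_simps)
      moreover have "Inf U \<le> Sup U" using bd U(2) by (meson cInf_le_cSup)
      moreover have "prob {\<omega> \<in> good. val \<omega> \<in> {Inf U..Sup U}} \<le> prob {\<omega> \<in> good. val \<omega> \<in> {Inf U..Sup U + e}}"
        using e by (intro finite_measure_mono) auto
      moreover have "prob {\<omega> \<in> good. val \<omega> \<in> {Inf U..Sup U + e}} \<le> D * (Sup U + e - Inf U) powr s"
        using \<open>Inf U \<le> Sup U\<close> e by (intro D(2)) auto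
      moreover have "D * (Sup U + e - Inf U) powr s \<le> D * (diameter U + e) powr s"
        using calculation e D(1) s_pos by (intro mult_left_mono powr_mono2) auto
      ultimately show ?thesis by linarith
    qed
    have "((\<lambda>e. D * (diameter U + e) powr s) \<longlongrightarrow> D * (diameter U + 0) powr s) (at_right 0)"
      using s_pos diameter_ge_0[OF U(1)]
      by (intro tendsto_intros tendsto_powr2) (auto simp: eventually_at_right_field intro!: exI[of _ 1])
    moreover have "\<forall>\<^sub>F e in at_right 0. prob {\<omega> \<in> good. val \<omega> \<in> {Inf U..Sup U}} \<le> D * (diameter U + e) powr s"
      using ex by (auto simp: eventually_at_right_field intro!: exI[of _ 1])
    ultimately have "prob {\<omega> \<in> good. val \<omega> \<in> {Inf U..Sup U}} \<le> D * (diameter U + 0) powr s"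
      by (rule tendsto_lowerbound) simp
    then show ?thesis by simp
  qed
  then show ?thesis using that D(1) by blast
qed

text \<open>The mass distribution principle: for \<open>\<sigma> < s\<close> and diameters at most 1
  the power \<open>s\<close> is bounded by the power \<open>\<sigma>\<close>, so the
  \<open>\<sigma>\<close>-sum of any such cover is at least \<open>1 / D\<close>.\<close>

theorem hausdorff_dim_ge:
  assumes E: "AE \<omega> in P. val \<omega> \<in> E"
  shows "ennreal s \<le> hausdorff_dim E"
  unfolding hausdorff_dim_def
proof (rule INF_greatest, rule ccontr)
  fix \<sigma> assume \<sigma>: "\<sigma> \<in> {\<sigma>. 0 \<le> \<sigma> \<and> hausdorff_measure \<sigma> E = 0}" and "\<not> ennreal s \<le> ennreal \<sigma>"
  then have \<sigma>s: "0 \<le> \<sigma>" "\<sigma> < s" using s_pos by (auto simp: not_le ennreal_less_iff)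
  obtain D where D: "D > 0"
    "\<And>U. bounded U \<Longrightarrow> U \<noteq> {} \<Longrightarrow> prob {\<omega> \<in> good. val \<omega> \<in> {Inf U..Sup U}} \<le> D * diameter U powr s"
    using prob_bounded_set by blast
  have "hausdorff_premeasure \<sigma> 1 E \<le> hausdorff_measure \<sigma> E"
    unfolding hausdorff_measure_def by (rule SUP_upper) auto
  \<comment> \<open>Any value below \<open>1 / D\<close> would contradict the total mass 1.\<close>
  then have "hausdorff_premeasure \<sigma> 1 E < ennreal (1 / (2 * D))" using \<sigma> D by simp
  then obtain U where U: "E \<subseteq> (\<Union>i. U i)" "\<And>i :: nat. bounded (U i) \<and> diameter (U i) \<le> 1"
      "(\<Sum>i. diam_power \<sigma> (U i)) < ennreal (1 / (2 * D))"
    unfolding hausdorff_premeasure_def INF_less_iff by auto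
  define B where "B = (\<lambda>i. if U i = {} then {} else {\<omega> \<in> good. val \<omega> \<in> {Inf (U i)..Sup (U i)}})"
  have [measurable]: "B i \<in> sets P" for i unfolding B_def by simp
  have Bi: "emeasure P (B i) \<le> ennreal D * diam_power \<sigma> (U i)" for i
  proof (cases "U i = {}")
    case False
    have d: "0 \<le> diameter (U i)" "diameter (U i) \<le> 1" using U(2)[of i] diameter_ge_0 by auto
    have "emeasure P (B i) \<le> ennreal (D * diameter (U i) powr s)"
      unfolding emeasure_eq_measure B_def using False U(2)[of i] D(2)[of "U i"] by (auto intro!: ennreal_leI)
    also have "\<dots> = ennreal D * ennreal (diameter (U i) powr s)" using D by (simp add: ennreal_mult)
    also have "\<dots> \<le> ennreal D * diam_power \<sigma> (U i)"
    proof (intro mult_left_mono)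
      show "ennreal (diameter (U i) powr s) \<le> diam_power \<sigma> (U i)"
      proof (cases "\<sigma> = 0")
        case True
        have "diameter (U i) powr s \<le> 1" using d s_pos by (intro powr_le1) auto
        then show ?thesis using True False by (simp add: diam_power_def)
      next
        case False': False
        have "diameter (U i) powr s \<le> diameter (U i) powr \<sigma>" using d \<sigma>s by (intro powr_mono') auto
        then show ?thesis using False False' by (simp add: diam_power_def ennreal_leI)
      qed
    qed simp
    finally show ?thesis .
  qed (simp add: B_def)
  have "AE \<omega> in P. \<omega> \<in> (\<Union>i. B i)"
    using E AE_digit AE_space
  proof eventually_elim
    case (elim \<omega>)
    then obtain i where i: "val \<omega> \<in> U i" using U(1) by blast
    have "bdd_above (U i)" "bdd_below (U i)" using U(2)[of i] bounded_imp_bdd_above bounded_imp_bdd_below by auto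
    then have "val \<omega> \<in> {Inf (U i)..Sup (U i)}" using i by (auto intro: cInf_lower cSup_upper)
    then have "\<omega> \<in> B i" using elim i by (auto simp: B_def good_def)
    then show ?case by blast
  qed
  then have "emeasure P (\<Union>i. B i) = 1" by (intro emeasure_eq_1_AE) auto
  then have "1 \<le> emeasure P (\<Union>i. B i)" by simp
  also have "\<dots> \<le> (\<Sum>i. emeasure P (B i))" by (intro emeasure_subadditive_countably) auto
  also have "\<dots> \<le> (\<Sum>i. ennreal D * diam_power \<sigma> (U i))" by (intro suminf_le Bi) auto
  also have "\<dots> = ennreal D * (\<Sum>i. diam_power \<sigma> (U i))" by simp
  also have "\<dots> \<le> ennreal D * ennreal (1 / (2 * D))" using U(3) by (intro mult_left_mono) auto
  also have "\<dots> = ennreal (1 / 2)" using D by (simp add: ennreal_mult[symmetric])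
  finally have "ennreal 1 \<le> ennreal (1 / 2)" by (simp only: ennreal_1)
  then show False by (subst (asm) ennreal_le_iff) auto
qed

end

section \<open>Independent blocks of digits\<close>

text \<open>A finite-volume Gibbs distribution for \<open>- s log |T'|\<close>, with
  \<open>word_sum\<close> as partition function.\<close>

definition word_pmf :: "nat \<Rightarrow> real \<Rightarrow> nat \<Rightarrow> nat list pmf" where
  "word_pmf M s n = embed_pmf (\<lambda>w. if w \<in> words M n then cfq w 0 powr (- 2 * s) / word_sum M s n else 0)"

lemma pmf_word_pmf:
  assumes "M \<ge> 1"
  shows "pmf (word_pmf M s n) w = (if w \<in> words M n then cfq w 0 powr (- 2 * s) / word_sum M s n else 0)"
  unfolding word_pmf_def
proof (rule pmf_embed_pmf)
  let ?f = "\<lambda>w. if w \<in> words M n then cfq w 0 powr (- 2 * s) / word_sum M s n else 0"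
  show nn: "\<And>w. 0 \<le> ?f w" using word_sum_nonneg by (auto intro!: divide_nonneg_nonneg)
  have "(\<integral>\<^sup>+w. ennreal (?f w) \<partial>count_space UNIV) = (\<Sum>w\<in>words M n. ennreal (?f w))"
    by (intro nn_integral_count_space') auto
  also have "\<dots> = ennreal (\<Sum>w\<in>words M n. ?f w)" using nn by (intro sum_ennreal) blast
  also have "(\<Sum>w\<in>words M n. ?f w) = (\<Sum>w\<in>words M n. cfq w 0 powr (- 2 * s)) / word_sum M s n"
    by (simp add: sum_divide_distrib)
  also have "\<dots> = 1" using word_sum_pos[OF assms, of s n] by (simp add: word_sum_def)
  finally show "(\<integral>\<^sup>+w. ennreal (?f w) \<partial>count_space UNIV) = 1" by simp
qed

lemma set_word_pmf: "M \<ge> 1 \<Longrightarrow> set_pmf (word_pmf M s n) \<subseteq> words M n"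
  by (auto simp: set_pmf_eq pmf_word_pmf split: if_splits)

text \<open>Supermultiplicativity of \<open>word_sum\<close> makes the marginals comparable to the same kind of distribution.\<close>
lemma word_pmf_marginal:
  assumes M: "M \<ge> 1" and s: "s \<ge> 0" and n: "n \<le> m" and v: "length v = n"
  shows "measure_pmf.prob (word_pmf M s m) {w. take n w = v} \<le> 4 powr s * cfq v 0 powr (- 2 * s) / word_sum M s n"
proof -
  have "measure_pmf.prob (word_pmf M s m) {w. take n w = v}
      = measure_pmf.prob (word_pmf M s m) ({w. take n w = v} \<inter> set_pmf (word_pmf M s m))"
    by (rule measure_Int_set_pmf[symmetric])
  also have "\<dots> \<le> measure_pmf.prob (word_pmf M s m) {w \<in> words M m. take n w = v}"
    using set_word_pmf[OF M] by (intro measure_pmf.finite_measure_mono) auto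
  also have "\<dots> = (\<Sum>w\<in>{w \<in> words M m. take n w = v}. cfq w 0 powr (- 2 * s) / word_sum M s m)"
    using M by (subst measure_measure_pmf_finite) (auto intro!: sum.cong simp: pmf_word_pmf)
  also have "\<dots> = (\<Sum>w\<in>words M m. if take n w = v then cfq w 0 powr (- 2 * s) / word_sum M s m else 0)"
    by (subst sum.inter_filter) auto
  also have "\<dots> = (\<Sum>u\<in>words M n. \<Sum>x\<in>words M (m - n). if take n (u @ x) = v then cfq (u @ x) 0 powr (- 2 * s) / word_sum M s m else 0)"
    using sum_words_add[of "\<lambda>w. if take n w = v then cfq w 0 powr (- 2 * s) / word_sum M s m else 0" M n "m - n"] n
    by (simp only: le_add_diff_inverse)
  also have "\<dots> = (\<Sum>u\<in>words M n. if u = v then (\<Sum>x\<in>words M (m - n). cfq (v @ x) 0 powr (- 2 * s) / word_sum M s m) else 0)"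
    by (intro sum.cong refl) (auto simp: words_def)
  also have "\<dots> \<le> 4 powr s * cfq v 0 powr (- 2 * s) / word_sum M s n"
  proof (cases "v \<in> words M n")
    case True
    have pv: "positive_word v" using True words_positive by auto
    have q: "cfq v 0 \<ge> 1" using pv cfq_ge_1 by auto
    have Zp: "word_sum M s n > 0" "word_sum M s m > 0" using word_sum_pos[OF M] by auto
    have "(\<Sum>x\<in>words M (m - n). cfq (v @ x) 0 powr (- 2 * s)) \<le> (\<Sum>x\<in>words M (m - n). cfq v 0 powr (- 2 * s) * cfq x 0 powr (- 2 * s))"
    proof (rule sum_mono)
      fix x assume "x \<in> words M (m - n)"
      then have px: "positive_word x" using words_positive by auto
      then have "cfq x 0 \<ge> 1" using cfq_ge_1 by auto
      then have "(cfq v 0 * cfq x 0) powr (- 2 * s) = cfq v 0 powr (- 2 * s) * cfq x 0 powr (- 2 * s)"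
        and "cfq v 0 * cfq x 0 > 0" using q by (simp_all add: powr_mult)
      then show "cfq (v @ x) 0 powr (- 2 * s) \<le> cfq v 0 powr (- 2 * s) * cfq x 0 powr (- 2 * s)"
        using powr_mono2'[of "- 2 * s" "cfq v 0 * cfq x 0" "cfq (v @ x) 0"] s cfq_append_ge[OF pv px] by simp
    qed
    also have "\<dots> = cfq v 0 powr (- 2 * s) * word_sum M s (m - n)" by (simp add: word_sum_def sum_distrib_left)
    finally have "(\<Sum>x\<in>words M (m - n). cfq (v @ x) 0 powr (- 2 * s)) / word_sum M s m
        \<le> cfq v 0 powr (- 2 * s) * word_sum M s (m - n) / word_sum M s m" using Zp by (intro divide_right_mono) auto
    also have "\<dots> \<le> 4 powr s * cfq v 0 powr (- 2 * s) / word_sum M s n"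
    proof -
      have "4 powr (- s) * word_sum M s n * word_sum M s (m - n) \<le> word_sum M s m" using word_sum_add_ge[OF s, of M n "m - n"] n by simp
      then have "4 powr s * (4 powr (- s) * word_sum M s n * word_sum M s (m - n)) \<le> 4 powr s * word_sum M s m" by (intro mult_left_mono) auto
      moreover have "4 powr s * (4 powr (- s) * word_sum M s n * word_sum M s (m - n)) = word_sum M s n * word_sum M s (m - n)"
        by (simp add: powr_minus)
      ultimately have "word_sum M s n * word_sum M s (m - n) \<le> 4 powr s * word_sum M s m" by linarith
      then have "cfq v 0 powr (- 2 * s) * (word_sum M s n * word_sum M s (m - n)) \<le> cfq v 0 powr (- 2 * s) * (4 powr s * word_sum M s m)"
        by (intro mult_left_mono) auto
      then show ?thesis using Zp by (simp add: field_simps)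
    qed
    finally show ?thesis using True by (simp add: sum_divide_distrib)
  next
    case False
    then show ?thesis using word_sum_nonneg[of M s n] by (auto intro!: divide_nonneg_nonneg sum.neutral[THEN eq_refl, THEN order_trans])
  qed
  finally show ?thesis .
qed

text \<open>The event constrains only the first \<open>n\<close> entries; lists in the support have
  length \<open>n\<close>, so at most one word remains.\<close>

lemma prob_word_pmf_le:
  assumes "M \<ge> 1"
  shows "measure_pmf.prob (word_pmf M s n) {v. \<forall>k<n. v ! k = u k}
    \<le> cfq (map u [0..<n]) 0 powr (- 2 * s) / word_sum M s n"
proof -
  have "measure_pmf.prob (word_pmf M s n) {v. \<forall>k<n. v ! k = u k} =
      measure_pmf.prob (word_pmf M s n) ({v. \<forall>k<n. v ! k = u k} \<inter> set_pmf (word_pmf M s n))"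
    by (rule measure_Int_set_pmf[symmetric])
  also have "\<dots> \<le> measure_pmf.prob (word_pmf M s n) {map u [0..<n]}"
  proof (rule measure_pmf.finite_measure_mono)
    show "{v. \<forall>k<n. v ! k = u k} \<inter> set_pmf (word_pmf M s n) \<subseteq> {map u [0..<n]}"
    proof
      fix v assume v: "v \<in> {v. \<forall>k<n. v ! k = u k} \<inter> set_pmf (word_pmf M s n)"
      then have "length v = n" using set_word_pmf[OF assms, of s n] by (auto simp: words_def)
      then show "v \<in> {map u [0..<n]}" using v by (auto intro!: nth_equalityI)
    qed
  qed simp
  also have "\<dots> \<le> cfq (map u [0..<n]) 0 powr (- 2 * s) / word_sum M s n"
    using word_sum_nonneg[of M s n] by (simp add: measure_pmf_single pmf_word_pmf[OF assms])
  finally show ?thesis .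
qed

text \<open>
  The positions (counted from 0) are cut into the blocks \<open>[c j, c (j + 1))\<close>. The last digit of a block
  is uniform in \<open>[V j, 2 * V j)\<close>, the digits before it form a word over \<open>{1..M}\<close> distributed according
  to \<open>word_pmf\<close>, and different blocks are independent.
\<close>
locale cf_blocks =
  fixes c :: "nat \<Rightarrow> nat" and V :: "nat \<Rightarrow> nat" and M :: nat and s :: real
  assumes c_0: "c 0 = 0" and c_mono: "strict_mono c" and V_ge_1: "\<And>j. V j \<ge> 1"
    and M_ge_2: "M \<ge> 2" and s_nonneg: "s \<ge> 0"
begin

definition free :: "nat \<Rightarrow> nat" where "free j = c (Suc j) - c j - 1"

lemma c_Suc: "c (Suc j) = c j + free j + 1"
  using strict_monoD[OF c_mono, of j "Suc j"] by (simp add: free_def)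

definition blk :: "nat \<Rightarrow> nat" where "blk k = (LEAST j. k < c (Suc j))"

lemma blk_bounds: "c (blk k) \<le> k" "k < c (Suc (blk k))"
proof -
  have "k < c (Suc k)" using seq_suble[OF c_mono, of "Suc k"] by simp
  then show 1: "k < c (Suc (blk k))" unfolding blk_def by (rule LeastI)
  show "c (blk k) \<le> k"
  proof (cases "blk k")
    case (Suc i)
    then have "\<not> k < c (Suc i)" using not_less_Least[of i "\<lambda>j. k < c (Suc j)"] by (simp add: blk_def)
    then show ?thesis using Suc by simp
  qed (simp add: c_0)
qed

lemma blk_eqI: "c j \<le> k \<Longrightarrow> k < c (Suc j) \<Longrightarrow> blk k = j"
  using blk_bounds[of k] strict_mono_less[OF c_mono] by (metis le_less_trans less_Suc_eq_le order_antisym)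

definition block_pmf :: "nat \<Rightarrow> (nat list \<times> nat) pmf" where
  "block_pmf j = pair_pmf (word_pmf M s (free j)) (pmf_of_set {V j..<2 * V j})"

definition block_space :: "(nat \<Rightarrow> nat list \<times> nat) measure" where
  "block_space = PiM UNIV (\<lambda>j. measure_pmf (block_pmf j))"

definition digit :: "nat \<Rightarrow> (nat \<Rightarrow> nat list \<times> nat) \<Rightarrow> nat" where
  "digit k \<omega> = (if Suc k = c (Suc (blk k)) then snd (\<omega> (blk k)) else fst (\<omega> (blk k)) ! (k - c (blk k)))"

text \<open>These are the scales \<open>A\<close> of \<open>random_cf\<close>; a free digit has
  scale 1 since its alphabet is bounded.\<close>

definition scale :: "nat \<Rightarrow> nat" where
  "scale k = (if Suc k = c (Suc (blk k)) then V (blk k) else 1)"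

sublocale product_prob_space "\<lambda>j. measure_pmf (block_pmf j)" UNIV
  by unfold_locales

lemma digit_last: "digit (c j + free j) \<omega> = snd (\<omega> j)"
  using blk_eqI[of j "c j + free j"] by (simp add: digit_def c_Suc)

lemma digit_free: "k < free j \<Longrightarrow> digit (c j + k) \<omega> = fst (\<omega> j) ! k"
  using blk_eqI[of j "c j + k"] by (simp add: digit_def c_Suc)

lemma position_cases:
  obtains (last) j where "k = c j + free j" | (free) j i where "k = c j + i" "i < free j"
proof -
  have "k = c (blk k) + (k - c (blk k))" "k - c (blk k) \<le> free (blk k)"
    using blk_bounds[of k] by (auto simp: c_Suc)
  then show ?thesis using that by (metis le_neq_implies_less)
qed

lemma scale_simps [simp]: "scale (c j + free j) = V j" "i < free j \<Longrightarrow> scale (c j + i) = 1"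
  using blk_eqI[of j "c j + free j"] blk_eqI[of j "c j + i"] by (auto simp: scale_def c_Suc)

lemma measurable_digit: "digit k \<in> block_space \<rightarrow>\<^sub>M count_space UNIV"
proof -
  have "(\<lambda>\<omega>. \<omega> (blk k)) \<in> block_space \<rightarrow>\<^sub>M measure_pmf (block_pmf (blk k))"
    unfolding block_space_def by (rule measurable_component_singleton) simp
  then have "(\<lambda>\<omega>. (\<lambda>b. if Suc k = c (Suc (blk k)) then snd b else fst b ! (k - c (blk k))) (\<omega> (blk k)))
      \<in> block_space \<rightarrow>\<^sub>M count_space UNIV"
    by (rule measurable_compose) simp
  then show ?thesis unfolding digit_def .
qed

lemma set_block_pmf: "(v, x) \<in> set_pmf (block_pmf j) \<Longrightarrow> v \<in> words M (free j) \<and> V j \<le> x \<and> x < 2 * V j"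
  using set_word_pmf[of M s "free j"] M_ge_2 V_ge_1[of j]
  by (auto simp: block_pmf_def set_pmf_of_set)

lemma AE_digit: "AE \<omega> in block_space. \<forall>k. scale k \<le> digit k \<omega> \<and> digit k \<omega> \<le> M * scale k"
proof -
  have "AE \<omega> in block_space. \<forall>j. \<omega> j \<in> set_pmf (block_pmf j)"
    unfolding AE_all_countable block_space_def
    by (intro allI AE_PiM_component) (auto simp: AE_measure_pmf measure_pmf.prob_space_axioms)
  then show ?thesis
  proof eventually_elim
    case (elim \<omega>)
    have b: "fst (\<omega> j) \<in> words M (free j) \<and> V j \<le> snd (\<omega> j) \<and> snd (\<omega> j) < 2 * V j" for j
      using elim set_block_pmf[of "fst (\<omega> j)" "snd (\<omega> j)" j] by simp
    show ?case
    proof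
      fix k
      show "scale k \<le> digit k \<omega> \<and> digit k \<omega> \<le> M * scale k"
      proof (cases k rule: position_cases)
        case (last j)
        have "snd (\<omega> j) \<le> 2 * V j" using b[of j] by simp
        also have "\<dots> \<le> M * V j" using M_ge_2 by (intro mult_right_mono) auto
        finally show ?thesis using b[of j] by (simp add: last digit_last)
      next
        case (free j i)
        then have "fst (\<omega> j) ! i \<in> {1..M}" using b[of j] nth_mem[of i "fst (\<omega> j)"] by (auto simp: words_def subset_iff)
        then show ?thesis using free by (simp add: digit_free)
      qed
    qed
  qed
qed

definition block_word :: "(nat \<Rightarrow> nat) \<Rightarrow> nat \<Rightarrow> nat list" where
  "block_word u j = map (\<lambda>k. u (k + c j)) [0..<free j]"

definition block_event :: "(nat \<Rightarrow> nat) \<Rightarrow> nat \<Rightarrow> (nat list \<times> nat) set" where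
  "block_event u j = {v. \<forall>k<free j. v ! k = u (c j + k)} \<times> {u (c j + free j)}"

definition partial_event :: "(nat \<Rightarrow> nat) \<Rightarrow> nat \<Rightarrow> nat \<Rightarrow> nat list set" where
  "partial_event u j n = {v. \<forall>k<n. v ! k = u (c j + k)}"

text \<open>A condition on consecutive digits becomes one condition per coordinate of the product
  space, so independence turns its probability into a product.\<close>

lemma prefix_iff:
  assumes "n \<le> free j"
  shows "(\<forall>k<c j + n. digit k \<omega> = u k) \<longleftrightarrow>
    (\<forall>i<j. \<omega> i \<in> block_event u i) \<and> fst (\<omega> j) \<in> partial_event u j n"
proof (intro iffI conjI allI impI)
  assume L: "\<forall>k<c j + n. digit k \<omega> = u k"
  fix i assume i: "i < j"
  have "c (Suc i) \<le> c j" using i strict_mono_less_eq[OF c_mono] by simp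
  then have le: "c i + free i < c j" by (simp add: c_Suc)
  have "fst (\<omega> i) ! k = u (c i + k)" if "k < free i" for k
    using L le that digit_free[of k i \<omega>] by (metis add_less_cancel_left less_trans trans_less_add1)
  moreover have "snd (\<omega> i) = u (c i + free i)" using L le digit_last[of i \<omega>] by (metis trans_less_add1)
  ultimately show "\<omega> i \<in> block_event u i" by (cases "\<omega> i") (simp add: block_event_def)
next
  assume L: "\<forall>k<c j + n. digit k \<omega> = u k"
  show "fst (\<omega> j) \<in> partial_event u j n"
    unfolding partial_event_def
  proof (intro CollectI allI impI)
    fix k assume "k < n"
    then have "digit (c j + k) \<omega> = u (c j + k)" "digit (c j + k) \<omega> = fst (\<omega> j) ! k"
      using L assms digit_free[of k j \<omega>] by auto
    then show "fst (\<omega> j) ! k = u (c j + k)" by simp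
  qed
next
  fix k assume R: "(\<forall>i<j. \<omega> i \<in> block_event u i) \<and> fst (\<omega> j) \<in> partial_event u j n" and k: "k < c j + n"
  have cj: "c i \<le> k \<Longrightarrow> i \<le> j" for i
  proof (rule ccontr)
    assume "c i \<le> k" "\<not> i \<le> j"
    then have "c (Suc j) \<le> c i" using strict_mono_less_eq[OF c_mono] by simp
    then show False using \<open>c i \<le> k\<close> k assms by (simp add: c_Suc)
  qed
  show "digit k \<omega> = u k"
  proof (cases k rule: position_cases)
    case (last i)
    then have "i < j" using cj[of i] k assms by (cases "i = j") auto
    then have "\<omega> i \<in> block_event u i" using R by blast
    then show ?thesis using last digit_last[of i \<omega>] by (auto simp: block_event_def)
  next
    case (free i l)
    show ?thesis
    proof (cases "i = j")
      case True
      then show ?thesis using free k R digit_free[of l j \<omega>] by (auto simp: partial_event_def)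
    next
      case False
      then have "i < j" using cj[of i] free by simp
      then have "\<omega> i \<in> block_event u i" using R by blast
      then show ?thesis using free digit_free[of l i \<omega>] by (auto simp: block_event_def)
    qed
  qed
qed

text \<open>\<open>H\<close> is a singleton when the last digit of block \<open>j\<close> is
  prescribed as well, and \<open>UNIV\<close> when only the prefix is.\<close>

lemma prob_prefix_eq:
  assumes "n \<le> free j"
  shows "measure block_space {\<omega> \<in> space block_space. (\<forall>k<c j + n. digit k \<omega> = u k) \<and> snd (\<omega> j) \<in> H} =
    (\<Prod>i<j. measure_pmf.prob (block_pmf i) (block_event u i)) *
      (measure_pmf.prob (word_pmf M s (free j)) (partial_event u j n) * measure_pmf.prob (pmf_of_set {V j..<2 * V j}) H)"
proof -
  define X where "X = (\<lambda>i. if i < j then block_event u i else partial_event u j n \<times> H)"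
  have ev: "{\<omega> \<in> space block_space. (\<forall>k<c j + n. digit k \<omega> = u k) \<and> snd (\<omega> j) \<in> H} =
      {\<omega> \<in> space (PiM UNIV (\<lambda>j. measure_pmf (block_pmf j))). \<forall>i\<in>{..j}. \<omega> i \<in> X i}"
    unfolding prefix_iff[OF assms] X_def block_space_def
    by (auto simp: mem_Times_iff split: if_splits)
  have "measure block_space {\<omega> \<in> space block_space. (\<forall>k<c j + n. digit k \<omega> = u k) \<and> snd (\<omega> j) \<in> H}
      = (\<Prod>i\<in>{..j}. measure_pmf.prob (block_pmf i) (X i))"
  proof -
    have "emeasure block_space {\<omega> \<in> space (PiM UNIV (\<lambda>j. measure_pmf (block_pmf j))). \<forall>i\<in>{..j}. \<omega> i \<in> X i}
        = (\<Prod>i\<in>{..j}. emeasure (measure_pmf (block_pmf i)) (X i))"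
      unfolding block_space_def by (rule emeasure_PiM_Collect) auto
    also have "\<dots> = ennreal (\<Prod>i\<in>{..j}. measure_pmf.prob (block_pmf i) (X i))"
      unfolding measure_pmf.emeasure_eq_measure by (rule prod_ennreal) simp
    finally have "measure block_space {\<omega> \<in> space (PiM UNIV (\<lambda>j. measure_pmf (block_pmf j))). \<forall>i\<in>{..j}. \<omega> i \<in> X i}
        = (\<Prod>i\<in>{..j}. measure_pmf.prob (block_pmf i) (X i))"
      by (rule measure_eq_emeasure_eq_ennreal[rotated]) (simp add: prod_nonneg)
    with ev show ?thesis by simp
  qed
  also have "\<dots> = (\<Prod>i<j. measure_pmf.prob (block_pmf i) (X i)) * measure_pmf.prob (block_pmf j) (X j)"
    by (simp add: lessThan_Suc_atMost[symmetric])
  also have "(\<Prod>i<j. measure_pmf.prob (block_pmf i) (X i)) = (\<Prod>i<j. measure_pmf.prob (block_pmf i) (block_event u i))"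
    by (intro prod.cong) (auto simp: X_def)
  also have "measure_pmf.prob (block_pmf j) (X j) =
      measure_pmf.prob (word_pmf M s (free j)) (partial_event u j n) * measure_pmf.prob (pmf_of_set {V j..<2 * V j}) H"
    unfolding X_def block_pmf_def by (simp add: measure_pmf_prob_product)
  finally show ?thesis .
qed

lemma prob_single_le: "measure_pmf.prob (pmf_of_set {V j..<2 * V j}) {x} \<le> 1 / real (V j)"
  using V_ge_1[of j] by (simp add: measure_pmf_single pmf_of_set indicator_def)

lemma prob_block_event_le:
  "measure_pmf.prob (block_pmf j) (block_event u j) \<le>
    cfq (block_word u j) 0 powr (- 2 * s) / word_sum M s (free j) * (1 / real (V j))"
proof -
  have "measure_pmf.prob (block_pmf j) (block_event u j) =
      measure_pmf.prob (word_pmf M s (free j)) {v. \<forall>k<free j. v ! k = u (c j + k)} *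
      measure_pmf.prob (pmf_of_set {V j..<2 * V j}) {u (c j + free j)}"
    unfolding block_pmf_def block_event_def by (simp add: measure_pmf_prob_product)
  also have "\<dots> \<le> cfq (block_word u j) 0 powr (- 2 * s) / word_sum M s (free j) * (1 / real (V j))"
    using prob_word_pmf_le[of M s "free j" "\<lambda>k. u (c j + k)"] prob_single_le M_ge_2 word_sum_nonneg[of M s "free j"]
    by (intro mult_mono) (auto simp: block_word_def add.commute)
  finally show ?thesis .
qed

lemma prob_partial_event_le:
  assumes "n \<le> free j"
  shows "measure_pmf.prob (word_pmf M s (free j)) (partial_event u j n) \<le>
    4 powr s * cfq (map (\<lambda>k. u (k + c j)) [0..<n]) 0 powr (- 2 * s) / word_sum M s n"
proof -
  have "measure_pmf.prob (word_pmf M s (free j)) (partial_event u j n) =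
      measure_pmf.prob (word_pmf M s (free j)) (partial_event u j n \<inter> set_pmf (word_pmf M s (free j)))"
    by (rule measure_Int_set_pmf[symmetric])
  also have "\<dots> \<le> measure_pmf.prob (word_pmf M s (free j)) {w. take n w = map (\<lambda>k. u (k + c j)) [0..<n]}"
  proof (rule measure_pmf.finite_measure_mono)
    show "partial_event u j n \<inter> set_pmf (word_pmf M s (free j)) \<subseteq> {w. take n w = map (\<lambda>k. u (k + c j)) [0..<n]}"
    proof
      fix v assume v: "v \<in> partial_event u j n \<inter> set_pmf (word_pmf M s (free j))"
      then have "length v = free j" using set_word_pmf[of M s "free j"] M_ge_2 by (auto simp: words_def)
      then show "v \<in> {w. take n w = map (\<lambda>k. u (k + c j)) [0..<n]}"
        using v assms by (auto intro!: nth_equalityI simp: partial_event_def add.commute)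
    qed
  qed simp
  also have "\<dots> \<le> 4 powr s * cfq (map (\<lambda>k. u (k + c j)) [0..<n]) 0 powr (- 2 * s) / word_sum M s n"
    using assms M_ge_2 s_nonneg by (intro word_pmf_marginal) auto
  finally show ?thesis .
qed

lemma block_decomposition:
  obtains j n where "p = c j + n" "n \<le> free j" "j = blk p"
proof -
  have "p = c (blk p) + (p - c (blk p))" "p - c (blk p) \<le> free (blk p)"
    using blk_bounds[of p] by (auto simp: c_Suc)
  then show ?thesis using that by blast
qed

text \<open>The last digit of a block is independent of everything before it and uniform on
  \<open>V j\<close> values. For a free digit the scale is 1 and inclusion of events
  suffices.\<close>

lemma prob_digit_le:
  "measure block_space {\<omega> \<in> space block_space. (\<forall>k<p. digit k \<omega> = u k) \<and> digit p \<omega> = x}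
    \<le> measure block_space {\<omega> \<in> space block_space. \<forall>k<p. digit k \<omega> = u k} / real (scale p)"
proof -
  interpret B: prob_space block_space unfolding block_space_def by (rule P.prob_space_axioms)
  obtain j n where p: "p = c j + n" "n \<le> free j" "j = blk p" by (rule block_decomposition)
  note measurable_digit [measurable]
  show ?thesis
  proof (cases "n = free j")
    case True
    have sc: "scale p = V j" using True p(1) by simp
    have "measure block_space {\<omega> \<in> space block_space. (\<forall>k<p. digit k \<omega> = u k) \<and> digit p \<omega> = x}
        = measure block_space {\<omega> \<in> space block_space. (\<forall>k<c j + n. digit k \<omega> = u k) \<and> snd (\<omega> j) \<in> {x}}"
      using True p(1) digit_last[of j] by simp
    also have "\<dots> \<le> (\<Prod>i<j. measure_pmf.prob (block_pmf i) (block_event u i)) *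
      (measure_pmf.prob (word_pmf M s (free j)) (partial_event u j n) * (1 / real (V j)))"
      unfolding prob_prefix_eq[OF p(2)] by (intro mult_left_mono prob_single_le prod_nonneg) auto
    also have "\<dots> = measure block_space {\<omega> \<in> space block_space. (\<forall>k<c j + n. digit k \<omega> = u k) \<and> snd (\<omega> j) \<in> UNIV} / real (V j)"
      unfolding prob_prefix_eq[OF p(2)] by (simp add: measure_pmf.prob_space[simplified])
    finally show ?thesis unfolding sc by (simp add: p(1))
  next
    case False
    then have "scale p = 1" using p(1,2) by simp
    moreover have "measure block_space {\<omega> \<in> space block_space. (\<forall>k<p. digit k \<omega> = u k) \<and> digit p \<omega> = x}
        \<le> measure block_space {\<omega> \<in> space block_space. \<forall>k<p. digit k \<omega> = u k}"
      by (intro B.finite_measure_mono) auto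
    ultimately show ?thesis by simp
  qed
qed

text \<open>The factor that a complete block adds to the ratio between the probability of a prefix
  and its \<open>q powr (- 2 * s)\<close>. With \<open>q\<close> and \<open>Z\<close> taken from the
  free word, the block has probability at most \<open>q powr (- 2 * s) / (Z * V)\<close> and
  multiplies the denominator by at most \<open>4 * M * V * q\<close>.\<close>

definition block_weight :: "nat \<Rightarrow> real" where
  "block_weight j = (4 * real M) powr (2 * s) * real (V j) powr (2 * s - 1) / word_sum M s (free j)"

lemma positive_prefix: "\<forall>k<p. 1 \<le> u k \<Longrightarrow> positive_word (map u [0..<p])"
  by auto

text \<open>Each block takes two concatenations, with a factor 2 each, and its last digit is at most
  \<open>M * V j\<close>.\<close>

lemma cfq_prefix_le:
  assumes "\<And>k. k < c j \<Longrightarrow> scale k \<le> u k \<and> u k \<le> M * scale k"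
  shows "cfq (map u [0..<c j]) 0 \<le> (\<Prod>i<j. 4 * real M * real (V i) * cfq (block_word u i) 0)"
  using assms
proof (induction j)
  case 0
  then show ?case by (simp add: c_0)
next
  case (Suc j)
  have u1: "1 \<le> u k" if "k < c (Suc j)" for k
  proof -
    have "scale k \<ge> 1" using V_ge_1 by (simp add: scale_def)
    then show ?thesis using Suc.prems[OF that] by linarith
  qed
  define w x y where "w = map u [0..<c j]" and "x = block_word u j" and "y = u (c j + free j)"
  have split: "map u [0..<c (Suc j)] = w @ x @ [y]"
    unfolding w_def x_def y_def block_word_def c_Suc
    using map_upt_shift[of u "c j" "free j + 1"] by (simp add: add.commute)
  have pw: "positive_word (w @ x @ [y])" unfolding split[symmetric] using u1 by (intro positive_prefix) auto
  have q: "cfq w 0 \<ge> 1" "cfq x 0 \<ge> 1" using pw cfq_ge_1 by auto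
  have y: "real y \<le> real M * real (V j)" using Suc.prems[of "c j + free j"] unfolding y_def
    by (simp add: c_Suc of_nat_mult[symmetric] del: of_nat_mult)
  have IH: "cfq w 0 \<le> (\<Prod>i<j. 4 * real M * real (V i) * cfq (block_word u i) 0)"
    unfolding w_def using Suc.prems by (intro Suc.IH) (auto simp: c_Suc)
  have "cfq (w @ x @ [y]) 0 \<le> 2 * cfq w 0 * cfq (x @ [y]) 0" using pw by (intro cfq_append_le) auto
  also have "\<dots> \<le> 2 * cfq w 0 * (2 * cfq x 0 * cfq [y] 0)"
    using pw q by (intro mult_left_mono cfq_append_le) auto
  also have "\<dots> \<le> 2 * cfq w 0 * (2 * cfq x 0 * (real M * real (V j)))"
    using q y by (intro mult_left_mono) auto
  also have "\<dots> = cfq w 0 * (4 * real M * real (V j) * cfq x 0)" by simp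
  also have "\<dots> \<le> (\<Prod>i<j. 4 * real M * real (V i) * cfq (block_word u i) 0) * (4 * real M * real (V j) * cfq x 0)"
    using IH q by (intro mult_right_mono mult_nonneg_nonneg) auto
  finally show ?case unfolding split x_def by simp
qed

text \<open>One factor \<open>4 powr s\<close> comes from the marginal of the unfinished block, the
  other from attaching it to the complete ones.\<close>

lemma prob_prefix_le:
  assumes u: "\<And>k. k < c j + n \<Longrightarrow> scale k \<le> u k \<and> u k \<le> M * scale k" and n: "n \<le> free j"
  shows "measure block_space {\<omega> \<in> space block_space. \<forall>k<c j + n. digit k \<omega> = u k} \<le>
    16 powr s * (\<Prod>i<j. block_weight i) / word_sum M s n * cfq (map u [0..<c j + n]) 0 powr (- 2 * s)"
proof -
  have u1: "1 \<le> u k" if "k < c j + n" for k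
  proof -
    have "scale k \<ge> 1" using V_ge_1 by (simp add: scale_def)
    then show ?thesis using u[OF that] by linarith
  qed
  define w x where "w = map u [0..<c j]" and "x = map (\<lambda>k. u (k + c j)) [0..<n]"
  have split: "map u [0..<c j + n] = w @ x" unfolding w_def x_def by (rule map_upt_shift)
  have pw: "positive_word (w @ x)" unfolding split[symmetric] using u1 by (intro positive_prefix) auto
  have q: "cfq w 0 \<ge> 1" "cfq x 0 \<ge> 1" "cfq (w @ x) 0 \<ge> 1" using pw cfq_ge_1[of _ 0] by auto
  have qb: "cfq (block_word u i) 0 \<ge> 1" if "i < j" for i
  proof -
    have "c (Suc i) \<le> c j" using that strict_mono_less_eq[OF c_mono] by simp
    then have "positive_word (block_word u i)" unfolding block_word_def using u1 by (auto simp: c_Suc)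
    then show ?thesis using cfq_ge_1 by auto
  qed
  have Zn: "word_sum M s n > 0" using word_sum_pos M_ge_2 by simp
  have Zi: "word_sum M s (free i) > 0" for i using word_sum_pos M_ge_2 by simp
  have Mp: "real M > 0" using M_ge_2 by simp
  define R where "R = (\<Prod>i<j. 4 * real M * real (V i) * cfq (block_word u i) 0)"
  have wR: "cfq w 0 \<le> R" unfolding w_def R_def using u by (intro cfq_prefix_le) auto
  have Rp: "R > 0" using wR q by linarith
  have "cfq (w @ x) 0 \<le> 2 * cfq w 0 * cfq x 0" using pw by (intro cfq_append_le) auto
  also have "\<dots> \<le> 2 * R * cfq x 0" using wR q by (intro mult_right_mono mult_left_mono) auto
  finally have "(2 * R * cfq x 0) powr (- 2 * s) \<le> cfq (w @ x) 0 powr (- 2 * s)"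
    using q s_nonneg by (intro powr_mono2') auto
  moreover have "(2 * R * cfq x 0) powr (- 2 * s) = 4 powr (- s) * R powr (- 2 * s) * cfq x 0 powr (- 2 * s)"
  proof -
    have "(2::real) powr (- 2 * s) = 4 powr (- s)" using powr_powr[of 2 2 "- s"] by simp
    then show ?thesis using Rp q by (simp add: powr_mult)
  qed
  ultimately have "4 powr (- s) * R powr (- 2 * s) * cfq x 0 powr (- 2 * s) \<le> cfq (w @ x) 0 powr (- 2 * s)" by simp
  then have "4 powr s * R powr (2 * s) * (4 powr (- s) * R powr (- 2 * s) * cfq x 0 powr (- 2 * s))
      \<le> 4 powr s * R powr (2 * s) * cfq (w @ x) 0 powr (- 2 * s)" by (intro mult_left_mono) auto
  moreover have "4 powr s * R powr (2 * s) * (4 powr (- s) * R powr (- 2 * s) * cfq x 0 powr (- 2 * s)) = cfq x 0 powr (- 2 * s)"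
  proof -
    have "4 powr s * 4 powr (- s) = (1 :: real)" "R powr (2 * s) * R powr (- 2 * s) = 1"
      using Rp by (simp_all add: powr_add[symmetric])
    moreover have "4 powr s * R powr (2 * s) * (4 powr (- s) * R powr (- 2 * s) * cfq x 0 powr (- 2 * s))
      = (4 powr s * 4 powr (- s)) * (R powr (2 * s) * R powr (- 2 * s)) * cfq x 0 powr (- 2 * s)"
      by (simp only: mult_ac)
    ultimately show ?thesis by simp
  qed
  ultimately have X: "cfq x 0 powr (- 2 * s) \<le> 4 powr s * R powr (2 * s) * cfq (w @ x) 0 powr (- 2 * s)" by linarith
  \<comment> \<open>The denominators of the single block words cancel, so the bound depends on the
    digits only through the denominator of the whole prefix.\<close>
  have Bw: "(\<Prod>i<j. cfq (block_word u i) 0 powr (- 2 * s) / word_sum M s (free i) * (1 / real (V i))) * R powr (2 * s)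
      = (\<Prod>i<j. block_weight i)"
  proof -
    have "R powr (2 * s) = (\<Prod>i<j. (4 * real M * real (V i) * cfq (block_word u i) 0) powr (2 * s))"
      unfolding R_def by (rule prod_powr_distrib)
    then have "(\<Prod>i<j. cfq (block_word u i) 0 powr (- 2 * s) / word_sum M s (free i) * (1 / real (V i))) * R powr (2 * s)
      = (\<Prod>i<j. cfq (block_word u i) 0 powr (- 2 * s) / word_sum M s (free i) * (1 / real (V i)) *
          (4 * real M * real (V i) * cfq (block_word u i) 0) powr (2 * s))"
      by (simp only: prod.distrib)
    also have "\<dots> = (\<Prod>i<j. block_weight i)"
    proof (intro prod.cong refl)
      fix i assume "i \<in> {..<j}"
      then have q: "cfq (block_word u i) 0 \<ge> 1" using qb by auto
      have v: "real (V i) > 0" using V_ge_1[of i] by simp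
      have "(4 * real M * real (V i) * cfq (block_word u i) 0) powr (2 * s)
          = (4 * real M) powr (2 * s) * real (V i) powr (2 * s) * cfq (block_word u i) 0 powr (2 * s)"
        using q v Mp by (simp add: powr_mult)
      moreover have "real (V i) powr (2 * s) * (1 / real (V i)) = real (V i) powr (2 * s - 1)"
        using v by (simp add: powr_diff)
      moreover have "cfq (block_word u i) 0 powr (- 2 * s) * cfq (block_word u i) 0 powr (2 * s) = 1"
        using q by (simp add: powr_add[symmetric])
      moreover have "a / z * v' * (m * v * b) = m * (v * v') / z" if "a * b = 1" for a b m v v' z :: real
      proof -
        have "a / z * v' * (m * v * b) = (a * b) * (m * (v * v') / z)" by simp
        then show ?thesis using that by simp
      qed
      ultimately show "cfq (block_word u i) 0 powr (- 2 * s) / word_sum M s (free i) * (1 / real (V i)) *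
          (4 * real M * real (V i) * cfq (block_word u i) 0) powr (2 * s) = block_weight i"
        unfolding block_weight_def by presburger
    qed
    finally show ?thesis .
  qed
  have "measure block_space {\<omega> \<in> space block_space. \<forall>k<c j + n. digit k \<omega> = u k} =
    (\<Prod>i<j. measure_pmf.prob (block_pmf i) (block_event u i)) *
      measure_pmf.prob (word_pmf M s (free j)) (partial_event u j n)"
    using prob_prefix_eq[OF n, of u UNIV] by (simp add: measure_pmf.prob_space[simplified])
  also have "\<dots> \<le> (\<Prod>i<j. cfq (block_word u i) 0 powr (- 2 * s) / word_sum M s (free i) * (1 / real (V i))) *
      (4 powr s * cfq x 0 powr (- 2 * s) / word_sum M s n)"
    using prob_block_event_le prob_partial_event_le[OF n, of u] Zi
    by (intro mult_mono prod_mono prod_nonneg) (auto simp: x_def less_imp_le)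
  also have "\<dots> \<le> (\<Prod>i<j. cfq (block_word u i) 0 powr (- 2 * s) / word_sum M s (free i) * (1 / real (V i))) *
      (4 powr s * (4 powr s * R powr (2 * s) * cfq (w @ x) 0 powr (- 2 * s)) / word_sum M s n)"
    using X Zn Zi by (intro mult_left_mono divide_right_mono prod_nonneg) (auto simp: less_imp_le)
  also have "\<dots> = (4 powr s * 4 powr s) *
     ((\<Prod>i<j. cfq (block_word u i) 0 powr (- 2 * s) / word_sum M s (free i) * (1 / real (V i))) * R powr (2 * s)) / word_sum M s n * cfq (w @ x) 0 powr (- 2 * s)"
    by (simp add: mult_ac)
  also have "\<dots> = 16 powr s * (\<Prod>i<j. block_weight i) / word_sum M s n * cfq (map u [0..<c j + n]) 0 powr (- 2 * s)"
  proof -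
    have "(4::real) powr s * 4 powr s = 16 powr s" using powr_mult[of 4 4 s] by simp
    then show ?thesis unfolding Bw split by simp
  qed
  finally show ?thesis .
qed

text \<open>This is the end of the probability: an application chooses \<open>c\<close> and
  \<open>V\<close> and verifies the deterministic inequality \<open>bound\<close> and the membership
  of digit sequences in \<open>E\<close>.\<close>

theorem hausdorff_dim_ge:
  assumes s': "0 < s'" "s' \<le> 1" and C: "C \<ge> 1"
    and bound: "\<And>j n w. n \<le> free j \<Longrightarrow> positive_word w \<Longrightarrow> length w = c j + n \<Longrightarrow>
      16 powr s * (\<Prod>i<j. block_weight i) / word_sum M s n * cfq w 0 powr (- 2 * s)
      \<le> C * (real (scale (c j + n)) * (cfq w 0)\<^sup>2) powr (- s')"
    and E: "\<And>a. \<forall>k. 1 \<le> a k \<Longrightarrow> \<forall>j. V j \<le> a (c j + free j) \<Longrightarrow> cf_val a \<in> E"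
  shows "ennreal s' \<le> hausdorff_dim E"
proof -
  interpret B: prob_space block_space unfolding block_space_def by (rule P.prob_space_axioms)
  have sc: "scale k \<ge> 1" for k using V_ge_1 by (simp add: scale_def)
  interpret R: random_cf block_space digit scale M C s'
  proof
    show "digit k \<in> block_space \<rightarrow>\<^sub>M count_space UNIV" for k by (rule measurable_digit)
    show "1 \<le> scale k" for k by (rule sc)
    show "AE \<omega> in block_space. \<forall>k. scale k \<le> digit k \<omega> \<and> digit k \<omega> \<le> M * scale k" by (rule AE_digit)
    show "B.prob {\<omega> \<in> space block_space. (\<forall>k<p. digit k \<omega> = u k) \<and> digit p \<omega> = x}
        \<le> C * B.prob {\<omega> \<in> space block_space. \<forall>k<p. digit k \<omega> = u k} / real (scale p)" for p u x
    proof -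
      have "1 * B.prob {\<omega> \<in> space block_space. \<forall>k<p. digit k \<omega> = u k} \<le> C * B.prob {\<omega> \<in> space block_space. \<forall>k<p. digit k \<omega> = u k}"
        using C by (intro mult_right_mono) auto
      then have "B.prob {\<omega> \<in> space block_space. \<forall>k<p. digit k \<omega> = u k} / real (scale p)
          \<le> C * B.prob {\<omega> \<in> space block_space. \<forall>k<p. digit k \<omega> = u k} / real (scale p)"
        by (intro divide_right_mono) auto
      then show ?thesis using prob_digit_le[of p u x] by linarith
    qed
    show "B.prob {\<omega> \<in> space block_space. \<forall>k<p. digit k \<omega> = u k}
        \<le> C * (real (scale p) * (cfq (map u [0..<p]) 0)\<^sup>2) powr (- s')"
      if u: "\<And>k. k < p \<Longrightarrow> scale k \<le> u k \<and> u k \<le> M * scale k" for p u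
    proof -
      obtain j n where p: "p = c j + n" "n \<le> free j" by (rule block_decomposition)
      have "1 \<le> u k" if "k < p" for k using u[OF that] sc[of k] by linarith
      then have pw: "positive_word (map u [0..<p])" by (intro positive_prefix) auto
      show ?thesis
        using prob_prefix_le[of j n u] bound[OF p(2) pw] u p by simp
    qed
  qed (use s' C M_ge_2 in auto)
  show ?thesis
  proof (rule R.hausdorff_dim_ge)
    show "AE \<omega> in block_space. R.val \<omega> \<in> E"
      using AE_digit
    proof eventually_elim
      case (elim \<omega>)
      have "\<forall>k. 1 \<le> digit k \<omega>" using elim sc by (meson order_trans)
      moreover have "\<forall>j. V j \<le> digit (c j + free j) \<omega>" using elim scale_simps(1) by metis
      ultimately show ?case unfolding R.val_def by (rule E)
    qed
  qed
qed

end

section \<open>Lower bounds\<close>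

text \<open>All digits are large: digit \<open>j\<close>, counted from 0, is about
  \<open>exp (b ^ j)\<close>. The partial quotient number \<open>n * f n\<close> alone then exceeds
  \<open>\<psi> n ^ n\<close>; counting from 0 explains the exponent
  \<open>n * f n - 1\<close>.\<close>

lemma hausdorff_dim_ge_double_exponential:
  fixes f :: "nat \<Rightarrow> nat"
  assumes b: "b > 1" and f: "\<And>n. n \<ge> 1 \<Longrightarrow> f n \<ge> 1" and \<psi>: "\<And>n. n \<ge> 1 \<Longrightarrow> \<psi> n \<ge> 1"
    and inf: "\<exists>\<^sub>\<infinity>n. n \<ge> 1 \<and> real n * ln (\<psi> n) \<le> b ^ (n * f n - 1)"
    and s: "0 < s" "s < 1 / (1 + b)"
  shows "ennreal s \<le> hausdorff_dim (E_set f \<psi>)"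
proof -
  define V where "V = (\<lambda>j. nat \<lceil>exp (b ^ j)\<rceil>)"
  have V: "exp (b ^ j) \<le> real (V j)" "real (V j) \<le> 2 * exp (b ^ j)" "V j \<ge> 1" for j
  proof -
    have e: "exp (b ^ j) \<ge> 1" using b by simp
    then show "exp (b ^ j) \<le> real (V j)" unfolding V_def by linarith
    then show "V j \<ge> 1" using e by linarith
    show "real (V j) \<le> 2 * exp (b ^ j)" unfolding V_def using e by linarith
  qed
  have s1: "s * (1 + b) < 1" using s b by (simp add: field_simps)
  have "s * 2 < s * (1 + b)" using s b by (intro mult_strict_left_mono) auto
  then have s2: "2 * s < 1" using s1 by linarith
  \<comment> \<open>Blocks of length 1: there are no free digits, and 2 is the ratio of the ends of
    \<open>[V, 2V)\<close>.\<close>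
  interpret cf_blocks "\<lambda>j. j" V 2 s
    by unfold_locales (use V s in \<open>auto simp: strict_mono_def\<close>)
  have free0: "free j = 0" for j by (simp add: free_def)
  \<comment> \<open>The decay rate against \<open>b ^ j\<close>: the weights of the earlier blocks
    give \<open>(1 - 2 * s) / (b - 1)\<close> by the geometric sum, and the scale of the next digit
    takes away \<open>s\<close>. It is positive exactly when \<open>s < 1 / (1 + b)\<close>.\<close>
  define k where "k = (1 - 2 * s) / (b - 1) - s"
  have k: "k > 0" unfolding k_def using b s1 by (simp add: field_simps)
  define K where "K = (64::real) powr s"
  have K: "K \<ge> 1" unfolding K_def using s by (simp add: ge_one_powr_ge_zero)
  have summ: "summable (\<lambda>m. K ^ m * exp (- k * b ^ m))" by (rule summable_power_double_exponential[OF K b k])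
  define T where "T = (\<Sum>m. K ^ m * exp (- k * b ^ m))"
  have T: "K ^ m * exp (- k * b ^ m) \<le> T" for m
    using sum_le_suminf[OF summ, of "{m}"] K by (simp add: T_def)
  define C where "C = max 1 (16 powr s * 2 powr s * exp ((1 - 2 * s) / (b - 1)) * T)"
  show ?thesis
  proof (rule hausdorff_dim_ge[where C = C])
    have "1 / (1 + b) \<le> 1" using b by simp
    then show "s \<le> 1" using s by linarith
    show "1 \<le> C" by (simp add: C_def)
  next
    fix j n w assume n: "n \<le> free j" and w: "positive_word w"
    have n0: "n = 0" using n free0 by simp
    have sc: "scale (j + n) = V j" using scale_simps(1)[of j] n0 free0 by simp
    have q: "cfq w 0 \<ge> 1" using cfq_ge_1 w by auto
    have bw: "block_weight i \<le> K * exp (- (1 - 2 * s) * b ^ i)" for i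
    proof -
      have "real (V i) powr (2 * s - 1) \<le> exp (b ^ i) powr (2 * s - 1)"
        using V(1)[of i] s2 by (intro powr_mono2') auto
      also have "\<dots> = exp (- (1 - 2 * s) * b ^ i)" by (simp add: powr_def)
      finally have "K * real (V i) powr (2 * s - 1) \<le> K * exp (- (1 - 2 * s) * b ^ i)"
        using K by (intro mult_left_mono) auto
      moreover have "(4 * real 2) powr (2 * s) = K" unfolding K_def using powr_powr[of 8 2 s] by simp
      ultimately show ?thesis unfolding block_weight_def free0 by simp
    qed
    have "(\<Prod>i<j. block_weight i) \<le> (\<Prod>i<j. K * exp (- (1 - 2 * s) * b ^ i))"
      using bw by (intro prod_mono) (auto simp: block_weight_def free0)
    also have "\<dots> = K ^ j * exp (- (1 - 2 * s) * (\<Sum>i<j. b ^ i))"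
      by (simp add: prod.distrib exp_sum[symmetric] sum_distrib_left)
    also have "(\<Sum>i<j. b ^ i) = (b ^ j - 1) / (b - 1)" using b by (simp add: geometric_sum)
    finally have prod: "(\<Prod>i<j. block_weight i) \<le> K ^ j * exp (- (1 - 2 * s) * ((b ^ j - 1) / (b - 1)))" .
    have Vs: "real (V j) powr s \<le> 2 powr s * exp (s * b ^ j)"
    proof -
      have "real (V j) powr s \<le> (2 * exp (b ^ j)) powr s" using V(2)[of j] s by (intro powr_mono2) auto
      also have "\<dots> = 2 powr s * exp (b ^ j) powr s" by (simp add: powr_mult)
      also have "exp (b ^ j) powr s = exp (s * b ^ j)" by (simp add: powr_def)
      finally show ?thesis .
    qed
    have "16 powr s * (\<Prod>i<j. block_weight i) * real (V j) powr s \<le>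
      16 powr s * (K ^ j * exp (- (1 - 2 * s) * ((b ^ j - 1) / (b - 1)))) * (2 powr s * exp (s * b ^ j))"
      using prod Vs K by (intro mult_mono mult_left_mono) auto
    also have "\<dots> = 16 powr s * 2 powr s * exp ((1 - 2 * s) / (b - 1)) * (K ^ j * exp (- k * b ^ j))"
    proof -
      have "- (1 - 2 * s) * ((b ^ j - 1) / (b - 1)) + s * b ^ j = (1 - 2 * s) / (b - 1) + - k * b ^ j"
      proof -
        define r where "r = (1 - 2 * s) / (b - 1)"
        have "(1 - 2 * s) * ((b ^ j - 1) / (b - 1)) = r * (b ^ j - 1)" by (simp add: r_def)
        then show ?thesis unfolding k_def r_def[symmetric] mult_minus_left by (simp add: algebra_simps)
      qed
      then have e: "exp (- (1 - 2 * s) * ((b ^ j - 1) / (b - 1))) * exp (s * b ^ j) = exp ((1 - 2 * s) / (b - 1)) * exp (- k * b ^ j)"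
        by (simp only: exp_add[symmetric])
      have "16 powr s * (K ^ j * x) * (2 powr s * y) = 16 powr s * 2 powr s * g * (K ^ j * h)" if "x * y = g * h" for x y g h :: real
      proof -
        have "16 powr s * (K ^ j * x) * (2 powr s * y) = 16 powr s * 2 powr s * K ^ j * (x * y)" by simp
        then show ?thesis unfolding that by simp
      qed
      then show ?thesis using e by blast
    qed
    also have "\<dots> \<le> 16 powr s * 2 powr s * exp ((1 - 2 * s) / (b - 1)) * T"
      using T by (intro mult_left_mono) auto
    also have "\<dots> \<le> C" by (simp add: C_def)
    finally have main: "16 powr s * (\<Prod>i<j. block_weight i) * real (V j) powr s \<le> C" .
    have Vj: "real (V j) > 0" using V(3)[of j] by simp
    have "16 powr s * (\<Prod>i<j. block_weight i) = 16 powr s * (\<Prod>i<j. block_weight i) * real (V j) powr s * real (V j) powr (- s)"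
      using Vj by (simp add: powr_minus)
    also have "\<dots> \<le> C * real (V j) powr (- s)" using main by (intro mult_right_mono) auto
    finally have "16 powr s * (\<Prod>i<j. block_weight i) * cfq w 0 powr (- 2 * s) \<le> C * real (V j) powr (- s) * cfq w 0 powr (- 2 * s)"
      by (intro mult_right_mono) auto
    moreover have "(real (V j) * (cfq w 0)\<^sup>2) powr (- s) = real (V j) powr (- s) * cfq w 0 powr (- 2 * s)"
      using Vj q powr_powr[of "cfq w 0" 2 "- s"] by (simp add: powr_mult powr_numeral)
    ultimately show "16 powr s * (\<Prod>i<j. block_weight i) / word_sum 2 s n * cfq w 0 powr (- 2 * s)
        \<le> C * (real (scale (j + n)) * (cfq w 0)\<^sup>2) powr (- s)"
      unfolding sc by (simp add: n0)
  next
    fix a :: "nat \<Rightarrow> nat" assume a: "\<forall>k. 1 \<le> a k" and "\<forall>j. V j \<le> a (j + free j)"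
    then have aV: "V j \<le> a j" for j by (simp add: free0)
    show "cf_val a \<in> E_set f \<psi>"
    proof (rule E_setI)
      show "cf_val a \<in> cf_domain" using a by (rule cf_val_in_cf_domain)
      show "\<exists>\<^sub>\<infinity>n. n \<ge> 1 \<and> 0 \<le> \<psi> n \<and> \<psi> n ^ n \<le> digit_product f n (cf_val a)"
        using inf
      proof (rule INFM_mono)
        fix n assume n: "n \<ge> 1 \<and> real n * ln (\<psi> n) \<le> b ^ (n * f n - 1)"
        have nf: "1 * 1 \<le> n * f n" using n f[of n] by (intro mult_mono) auto
        have psi: "\<psi> n \<ge> 1" using \<psi> n by blast
        have pq: "partial_quotient m (cf_val a) = a (m - 1)" if "m \<ge> 1" for m
          using partial_quotient_cf_val[OF a, of "m - 1"] that by simp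
        have "\<psi> n ^ n = exp (real n * ln (\<psi> n))" using psi by (simp add: exp_of_nat_mult)
        also have "\<dots> \<le> exp (b ^ (n * f n - 1))" using n by simp
        also have "\<dots> \<le> real (a (n * f n - 1))" using V(1)[of "n * f n - 1"] aV[of "n * f n - 1"] by linarith
        also have "\<dots> = real (partial_quotient (n * f n) (cf_val a))" using pq[of "n * f n"] nf by simp
        also have "\<dots> \<le> real (partial_quotient (n * f n) (cf_val a)) * (\<Prod>i\<in>{1..n} - {n}. real (partial_quotient (i * f n) (cf_val a)))"
        proof -
          have "(\<Prod>i\<in>{1..n} - {n}. real (partial_quotient (i * f n) (cf_val a))) \<ge> 1"
          proof (rule prod_ge_1)
            fix i assume "i \<in> {1..n} - {n}"
            then have "1 * 1 \<le> i * f n" using n f[of n] by (intro mult_mono) auto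
            then show "1 \<le> real (partial_quotient (i * f n) (cf_val a))" using pq[of "i * f n"] a by simp
          qed
          then show ?thesis using mult_left_mono[of 1 _ "real (partial_quotient (n * f n) (cf_val a))"] by simp
        qed
        also have "\<dots> = digit_product f n (cf_val a)"
          using n by (subst prod.remove[of "{1..n}" n]) auto
        finally show "n \<ge> 1 \<and> 0 \<le> \<psi> n \<and> \<psi> n ^ n \<le> digit_product f n (cf_val a)"
          using n psi by linarith
      qed
    qed
  qed (use s in auto)
qed

text \<open>
  The assumption \<open>gap\<close> makes the number of large digits before position \<open>p\<close> at most \<open>2 * sqrt p\<close>, so that
  constant factors per block are absorbed by decreasing \<open>s\<close> to \<open>s'\<close>.
\<close>
lemma (in cf_blocks) hausdorff_dim_ge_sparse:
  assumes s': "0 < s'" "s' \<le> 1" "s' < s" and K: "K \<ge> 0" and l: "l \<ge> 0" and z: "z > 0" and Zge: "\<And>n. z * exp (l * real n) \<le> word_sum M s n"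
    and gap: "\<And>j. c (Suc j) \<le> (c (Suc j) - c j)\<^sup>2"
    and lnV: "\<And>j. ln (real (V j)) \<le> K * (1 + sqrt (real (c (Suc j))))"
    and cost: "\<And>j. (2 * s - 1) * ln (real (V j)) \<le> K + l * real (free j)"
    and E: "\<And>a. \<forall>k. 1 \<le> a k \<Longrightarrow> \<forall>j. V j \<le> a (c j + free j) \<Longrightarrow> cf_val a \<in> E"
  shows "ennreal s' \<le> hausdorff_dim E"
proof -
  \<comment> \<open>By \<open>cost\<close> and \<open>Zge\<close> the free word pays for the large
    digit, so this constant bounds every block weight.\<close>
  define C0 where "C0 = max 1 ((4 * real M) powr (2 * s) * exp K / z)"
  have C0: "C0 \<ge> 1" by (simp add: C0_def)
  have bw: "0 \<le> block_weight j \<and> block_weight j \<le> C0" for j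
  proof -
    have Zp: "word_sum M s (free j) > 0" using word_sum_pos M_ge_2 by simp
    have "real (V j) powr (2 * s - 1) = exp ((2 * s - 1) * ln (real (V j)))" using V_ge_1[of j] by (simp add: powr_def)
    also have "\<dots> \<le> exp (K + l * real (free j))" using cost[of j] by simp
    finally have "block_weight j \<le> (4 * real M) powr (2 * s) * exp (K + l * real (free j)) / word_sum M s (free j)"
      unfolding block_weight_def using Zp by (intro divide_right_mono mult_left_mono) auto
    also have "\<dots> \<le> (4 * real M) powr (2 * s) * exp (K + l * real (free j)) / (z * exp (l * real (free j)))"
      using z by (intro divide_left_mono Zge) (auto intro!: mult_pos_pos Zp)
    also have "\<dots> = (4 * real M) powr (2 * s) * exp K / z" using z by (simp add: exp_add)
    also have "\<dots> \<le> C0" by (simp add: C0_def)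
    finally show ?thesis using Zp by (auto simp: block_weight_def intro!: divide_nonneg_nonneg)
  qed
  \<comment> \<open>By \<open>gap\<close> the difference \<open>c (Suc j) - c j\<close> is at least
    \<open>sqrt (c (Suc j))\<close>, so each step raises \<open>sqrt (c j)\<close> by at least
    1/2.\<close>
  have count: "real j / 2 \<le> sqrt (real (c j))" for j
  proof (induction j)
    case (Suc j)
    define x where "x = sqrt (real (c (Suc j)))"
    have lt: "c j < c (Suc j)" using strict_monoD[OF c_mono, of j "Suc j"] by simp
    then have x1: "x \<ge> 1" unfolding x_def by simp
    have xx: "x\<^sup>2 = real (c (Suc j))" by (simp add: x_def)
    have "real (c (Suc j)) \<le> (real (c (Suc j)) - real (c j))\<^sup>2"
    proof -
      have "real (c (Suc j)) \<le> real ((c (Suc j) - c j)\<^sup>2)" using gap[of j] by (simp only: of_nat_le_iff)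
      then show ?thesis using lt by (simp add: of_nat_diff)
    qed
    then have "x \<le> real (c (Suc j)) - real (c j)" unfolding x_def using lt by (intro real_le_lsqrt) auto
    then have "real (c j) \<le> (x - 1 / 2)\<^sup>2" using xx by (simp add: power2_eq_square algebra_simps)
    then have "sqrt (real (c j)) \<le> x - 1 / 2" using x1 by (intro real_le_lsqrt) auto
    then show ?case using Suc unfolding x_def by simp
  qed simp
  define \<delta> where "\<delta> = s - s'"
  \<comment> \<open>Giving up \<open>\<delta>\<close> in the exponent gains
    \<open>exp (- k * p)\<close> up to a constant, against errors of size exp(O(sqrt p)).\<close>
  define k where "k = \<delta> * ln 2"
  have k: "k > 0" using s' by (simp add: k_def \<delta>_def)
  \<comment> \<open>The coefficient of \<open>x = sqrt (p + 1)\<close> in the errors: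
    \<open>2 * ln C0\<close> from the block weights and \<open>K\<close> from the scale.\<close>
  define \<beta> where "\<beta> = 2 * ln C0 + K"
  define C where "C = max 1 (16 powr s / z * exp (K + \<beta>\<^sup>2 / (4 * k) + 2 * k))"
  show ?thesis
  proof (rule hausdorff_dim_ge[where C = C])
    show "1 \<le> C" by (simp add: C_def)
  next
    fix j n w assume n: "n \<le> free j" and w: "positive_word w" "length w = c j + n"
    define p where "p = c j + n"
    define x where "x = sqrt (real (p + 1))"
    have x: "x\<^sup>2 = real p + 1" "x \<ge> 0" by (auto simp: x_def)
    have q: "cfq w 0 \<ge> 1" using cfq_ge_1 w by auto
    have "(\<Prod>i<j. block_weight i) \<le> (\<Prod>i<j. C0)" using bw by (intro prod_mono) auto
    also have "\<dots> = exp (real j * ln C0)" using C0 by (simp add: exp_of_nat_mult)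
    also have "\<dots> \<le> exp (2 * x * ln C0)"
    proof -
      have "sqrt (real (c j)) \<le> x" unfolding x_def p_def by simp
      then have "real j \<le> 2 * x" using count[of j] by linarith
      then show ?thesis using C0 by (simp add: mult_right_mono)
    qed
    finally have prod: "(\<Prod>i<j. block_weight i) \<le> exp (2 * x * ln C0)" .
    have zZ: "z \<le> word_sum M s n"
    proof -
      have "z * 1 \<le> z * exp (l * real n)" using z l by (intro mult_left_mono) auto
      then show ?thesis using Zge[of n] by simp
    qed
    have sc: "exp (- K * (1 + x)) \<le> real (scale p) powr (- s')"
    proof (cases "n = free j")
      case True
      then have e: "scale p = V j" "c (Suc j) = p + 1" by (simp_all add: p_def c_Suc)
      have V1: "real (V j) \<ge> 1" using V_ge_1[of j] by simp
      have "s' * ln (real (V j)) \<le> 1 * ln (real (V j))" using s' V1 by (intro mult_right_mono) auto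
      also have "\<dots> \<le> K * (1 + x)" using lnV[of j] unfolding e x_def by simp
      finally have "- K * (1 + x) \<le> - s' * ln (real (V j))" by simp
      then have "exp (- K * (1 + x)) \<le> exp (- s' * ln (real (V j)))" by (simp only: exp_le_cancel_iff)
      then show ?thesis unfolding e using V1 by (simp add: powr_def)
    next
      case False
      then have "scale p = 1" using n by (simp add: p_def)
      then show ?thesis using K x by simp
    qed
    have q2: "cfq w 0 powr (- 2 * \<delta>) \<le> exp (2 * k - k * x\<^sup>2)"
    proof -
      have "2 ^ p / 2 \<le> (cfq w 0)\<^sup>2" using cfq_growth[OF w(1)] w(2) by (simp add: p_def)
      then have "((cfq w 0)\<^sup>2) powr (- \<delta>) \<le> (2 ^ p / 2) powr (- \<delta>)" using s' by (intro powr_mono2') (auto simp: \<delta>_def)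
      moreover have "((cfq w 0)\<^sup>2) powr (- \<delta>) = cfq w 0 powr (- 2 * \<delta>)"
        using q powr_powr[of "cfq w 0" 2 "- \<delta>"] by (simp add: powr_numeral)
      moreover have "(2 ^ p / 2 :: real) powr (- \<delta>) = exp (2 * k - k * x\<^sup>2)"
        unfolding k_def x(1) by (simp add: powr_def ln_div ln_realpow algebra_simps)
      ultimately show ?thesis by simp
    qed
    have quad: "\<beta> * x - k * x\<^sup>2 \<le> \<beta>\<^sup>2 / (4 * k)"
    proof -
      have "- k * x\<^sup>2 + (\<beta> - 1) * x \<le> - x + (\<beta> - 1 + 1)\<^sup>2 / (4 * k)" by (rule quadratic_exponent_le[OF k])
      then show ?thesis by (simp add: algebra_simps)
    qed
    have "16 powr s * (\<Prod>i<j. block_weight i) / word_sum M s n * cfq w 0 powr (- 2 * s)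
        \<le> 16 powr s * exp (2 * x * ln C0) / z * (cfq w 0 powr (- 2 * s') * exp (2 * k - k * x\<^sup>2))"
    proof (intro mult_mono frac_le)
      have "cfq w 0 powr (- 2 * s) = cfq w 0 powr (- 2 * s') * cfq w 0 powr (- 2 * \<delta>)"
        by (simp add: powr_add[symmetric] \<delta>_def algebra_simps)
      then show "cfq w 0 powr (- 2 * s) \<le> cfq w 0 powr (- 2 * s') * exp (2 * k - k * x\<^sup>2)"
        using q2 by (simp add: mult_left_mono)
    qed (use z zZ prod bw in \<open>auto intro!: prod_nonneg\<close>)
    also have "\<dots> = (16 powr s / z) * exp (2 * x * ln C0 + (2 * k - k * x\<^sup>2)) * cfq w 0 powr (- 2 * s')"
      by (simp only: exp_add) (simp add: field_simps)
    also have "\<dots> \<le> (16 powr s / z) * exp ((K + \<beta>\<^sup>2 / (4 * k) + 2 * k) + - K * (1 + x)) * cfq w 0 powr (- 2 * s')"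
    proof -
      have "2 * x * ln C0 + (2 * k - k * x\<^sup>2) \<le> (K + \<beta>\<^sup>2 / (4 * k) + 2 * k) + - K * (1 + x)"
        using quad unfolding \<beta>_def by (simp add: algebra_simps)
      then show ?thesis using z by (intro mult_right_mono mult_left_mono) auto
    qed
    also have "\<dots> = ((16 powr s / z) * exp (K + \<beta>\<^sup>2 / (4 * k) + 2 * k)) * (exp (- K * (1 + x)) * cfq w 0 powr (- 2 * s'))"
      by (simp only: exp_add mult_ac)
    also have "\<dots> \<le> C * (real (scale p) powr (- s') * cfq w 0 powr (- 2 * s'))"
      using sc by (intro mult_mono mult_right_mono) (auto simp: C_def)
    also have "real (scale p) powr (- s') * cfq w 0 powr (- 2 * s') = (real (scale p) * (cfq w 0)\<^sup>2) powr (- s')"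
      using q powr_powr[of "cfq w 0" 2 "- s'"] by (simp add: powr_mult powr_numeral)
    finally show "16 powr s * (\<Prod>i<j. block_weight i) / word_sum M s n * cfq w 0 powr (- 2 * s)
        \<le> C * (real (scale (c j + n)) * (cfq w 0)\<^sup>2) powr (- s')" by (simp add: p_def)
  qed (use s' E in auto)
qed

text \<open>
  Large digits are placed at the positions \<open>i * f n\<close> with \<open>n div r < i \<le> n\<close>, for a sparse sequence of
  values of \<open>n\<close>. Leaving out \<open>i \<le> n div r\<close> is essential: a large digit at position \<open>f n\<close> would lower the
  dimension.
\<close>
lemma hausdorff_dim_ge_exponential:
  fixes f :: "nat \<Rightarrow> nat"
  assumes d: "d \<ge> 1" and f: "\<And>n. f n = d * n + t" and \<psi>: "\<And>n. n \<ge> 1 \<Longrightarrow> \<psi> n \<ge> 1"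
    and inf: "\<exists>\<^sub>\<infinity>n. ln (\<psi> n) \<le> \<theta> * (real d * real n)"
    and \<theta>: "0 < \<theta>" "\<theta> < \<theta>'" and s: "s > 1 / 2" and P: "(2 * s - 1) * \<theta>' < cf_pressure s"
    and s': "0 < s'" "s' < s" "s' \<le> 1"
  shows "ennreal s' \<le> hausdorff_dim (E_set f \<psi>)"
proof -
  \<comment> \<open>What a free digit has to earn: a large digit of size
    \<open>exp (\<theta>' * d * n)\<close> is paid for by about \<open>d * n\<close> free
    digits.\<close>
  define l where "l = (2 * s - 1) * \<theta>'"
  have l: "0 \<le> l" "l < cf_pressure s" using s \<theta> P by (auto simp: l_def)
  obtain M z where M: "M \<ge> 2" and z: "z > 0" and Zge: "\<And>n. z * exp (l * real n) \<le> word_sum M s n"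
    using word_sum_exp_lower_bound[OF s l] by blast
  \<comment> \<open>\<open>1 / r\<close> is a proportion of large digits that may be left out once
    the others are raised from \<open>\<theta>\<close> to \<open>\<theta>'\<close>.\<close>
  obtain r :: nat where r: "r > 0" "\<theta>' / (\<theta>' - \<theta>) < real r"
    using reals_Archimedean2[of "max 1 (\<theta>' / (\<theta>' - \<theta>))"] by (metis max_less_iff_conj of_nat_0_less_iff zero_less_one less_trans)
  have r\<theta>: "\<theta> \<le> (1 - 1 / real r) * \<theta>'" using r \<theta> by (simp add: field_simps)
  define good where "good = (\<lambda>n. n \<ge> 1 \<and> ln (\<psi> n) \<le> \<theta> * (real d * real n))"
  have goodinf: "\<exists>m>N. good m" for N
  proof -
    obtain m where "m \<ge> Suc N" "ln (\<psi> m) \<le> \<theta> * (real d * real m)" using inf unfolding INFM_nat_le by blast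
    then show ?thesis by (intro exI[of _ m]) (auto simp: good_def)
  qed
  have progression_ge: "n \<le> f n" for n
  proof -
    have "1 * n \<le> d * n" using d by (intro mult_right_mono) auto
    then show ?thesis using f[of n] by linarith
  qed
  \<comment> \<open>Successive values are so far apart that all positions used for
    \<open>g k\<close> are at most \<open>g (Suc k) div r\<close>, below every position used for
    \<open>g (Suc k)\<close>.\<close>
  have "\<exists>g. \<forall>k. good (g k) \<and> g k * f (g k) \<le> g (Suc k) div r"
  proof (rule dependent_nat_choice[of "\<lambda>_. good" "\<lambda>_ x y. x * f x \<le> y div r"])
    show "\<exists>x. good x" using goodinf by blast
    show "\<exists>y. good y \<and> x * f x \<le> y div r" for x
    proof -
      obtain y where y: "y > x * f x * r" "good y" using goodinf by blast
      have "x * f x = (x * f x * r) div r" using r by simp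
      also have "\<dots> \<le> y div r" using y by (intro div_le_mono) auto
      finally show ?thesis using y by blast
    qed
  qed
  then obtain g where g: "\<And>k. good (g k)" "\<And>k. g k * f (g k) \<le> g (Suc k) div r" by blast
  have g1: "g k \<ge> 1" for k using g(1) by (simp add: good_def)
  have fg1: "f (g k) \<ge> 1" for k using g1[of k] progression_ge[of "g k"] by linarith
  have gle: "g k \<le> g k * f (g k)" for k using fg1[of k] by simp
  have gSuc: "g k \<le> g (Suc k)" for k using gle[of k] g(2)[of k] div_le_dividend[of "g (Suc k)" r] by linarith
  have gmono: "mono g" using gSuc by (simp add: mono_iff_le_Suc)
  have sep: "g k * f (g k) \<le> g k' div r" if "k < k'" for k k'
  proof -
    have "g (Suc k) \<le> g k'" using gmono that by (simp add: mono_def)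
    then have "g (Suc k) div r \<le> g k' div r" by (rule div_le_mono)
    then show ?thesis using g(2)[of k] by linarith
  qed
  have r2: "r \<ge> 2"
  proof -
    have "1 < \<theta>' / (\<theta>' - \<theta>)" using \<theta> by (simp add: field_simps)
    then show ?thesis using r by linarith
  qed
  have glt: "g k < g (Suc k)" for k
  proof -
    have "g k \<le> g (Suc k) div r" using gle[of k] g(2)[of k] by linarith
    also have "\<dots> < g (Suc k)" using r2 g1[of "Suc k"] by (intro div_less_dividend) auto
    finally show ?thesis .
  qed
  have gk: "k \<le> g k" for k
  proof (induction k)
    case (Suc k)
    then show ?case using glt[of k] by linarith
  qed simp
  \<comment> \<open>Partial quotient number \<open>i * f (g k)\<close> is digit
    \<open>i * f (g k) - 1\<close> counted from 0, hence the last digit of a block that ends at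
    \<open>i * f (g k)\<close>. So these numbers are the block boundaries, and 0 starts the first
    block.\<close>
  define S where "S = {0} \<union> {i * f (g k) | i k. g k div r < i \<and> i \<le> g k}"
  have Smem: "i * f (g k) \<in> S" if "g k div r < i" "i \<le> g k" for i k unfolding S_def using that by blast
  have gdiv: "g k div r < g k" for k using r2 g1[of k] by (intro div_less_dividend) auto
  have infS: "infinite S"
    unfolding infinite_nat_iff_unbounded_le
  proof
    fix m show "\<exists>n\<ge>m. n \<in> S"
      using Smem[OF gdiv order_refl, of m] order_trans[OF gk gle, of m] by blast
  qed
  define c where "c = enumerate S"
  have c_mono: "strict_mono c" unfolding c_def using infS by (rule strict_mono_enumerate)
  have c_range: "range c = S" unfolding c_def using infS by (rule range_enumerate)
  have c0: "c 0 = 0"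
  proof -
    have "c 0 \<le> 0" unfolding c_def enumerate_0 by (rule Least_le) (simp add: S_def)
    then show ?thesis by simp
  qed
  have "\<exists>i k. c (Suc j) = i * f (g k) \<and> g k div r < i \<and> i \<le> g k" for j
  proof -
    have "c (Suc j) \<in> S" using c_range by blast
    moreover have "c (Suc j) > 0" using strict_monoD[OF c_mono, of 0 "Suc j"] by simp
    ultimately show ?thesis unfolding S_def by auto
  qed
  then obtain \<iota> \<kappa> where ik: "\<And>j. c (Suc j) = \<iota> j * f (g (\<kappa> j)) \<and> g (\<kappa> j) div r < \<iota> j \<and> \<iota> j \<le> g (\<kappa> j)"
    by metis
  define V where "V = (\<lambda>j. nat \<lceil>exp (\<theta>' * (real d * real (g (\<kappa> j))))\<rceil>)"
  have V: "exp (\<theta>' * (real d * real (g (\<kappa> j)))) \<le> real (V j)" "real (V j) \<le> 2 * exp (\<theta>' * (real d * real (g (\<kappa> j))))" "V j \<ge> 1" for j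
  proof -
    have e: "exp (\<theta>' * (real d * real (g (\<kappa> j)))) \<ge> 1" using \<theta> by simp
    then show "exp (\<theta>' * (real d * real (g (\<kappa> j)))) \<le> real (V j)" unfolding V_def by linarith
    then show "V j \<ge> 1" using e by linarith
    show "real (V j) \<le> 2 * exp (\<theta>' * (real d * real (g (\<kappa> j))))" unfolding V_def using e by linarith
  qed
  have lnV: "ln (real (V j)) \<le> ln 2 + \<theta>' * (real d * real (g (\<kappa> j)))" for j
  proof -
    have "ln (real (V j)) \<le> ln (2 * exp (\<theta>' * (real d * real (g (\<kappa> j)))))" using V[of j] by simp
    then show ?thesis by (simp add: ln_mult)
  qed
  interpret cf_blocks c V M s
    by unfold_locales (use c0 c_mono V(3) M s in auto)
  \<comment> \<open>Elements of \<open>S\<close> with the same \<open>k\<close> are multiples of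
    \<open>f (g k)\<close>. An element with a smaller \<open>k\<close> is at most
    \<open>g (\<kappa> j) div r\<close>, hence at most \<open>\<iota> j - 1\<close>, and the gap is
    again at least one multiple.\<close>
  have gap: "f (g (\<kappa> j)) \<le> c (Suc j) - c j" for j
  proof -
    define k i where "k = \<kappa> j" and "i = \<iota> j"
    have cS: "c (Suc j) = i * f (g k)" "g k div r < i" "i \<le> g k" using ik[of j] by (auto simp: k_def i_def)
    have lt: "c j < c (Suc j)" using strict_monoD[OF c_mono, of j "Suc j"] by simp
    have "c j + f (g k) \<le> i * f (g k)"
    proof (cases "c j = 0")
      case True
      have "1 * f (g k) \<le> i * f (g k)" using cS by (intro mult_right_mono) auto
      then show ?thesis using True by simp
    next
      case False
      have "c j \<in> S" using c_range by blast
      then obtain i' k' where ik': "c j = i' * f (g k')" "g k' div r < i'" "i' \<le> g k'" using False unfolding S_def by auto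
      consider "k' = k" | "k' < k" | "k < k'" by linarith
      then show ?thesis
      proof cases
        case 1
        then have "i' < i" using lt cS ik' by simp
        then have "Suc i' * f (g k) \<le> i * f (g k)" by (intro mult_right_mono) auto
        then show ?thesis using ik' 1 by simp
      next
        case 2
        have "c j \<le> g k' * f (g k')" unfolding ik'(1) using ik'(3) by (rule mult_right_mono) simp
        also have "\<dots> \<le> g k div r" using sep[OF 2] .
        also have "\<dots> \<le> (i - 1) * 1" using cS(2) by simp
        also have "\<dots> \<le> (i - 1) * f (g k)" using fg1[of k] by (rule mult_left_mono) simp
        finally have "c j + f (g k) \<le> Suc (i - 1) * f (g k)" by simp
        then show ?thesis using cS(2) by simp
      next
        case 3
        have "c (Suc j) \<le> g k * f (g k)" unfolding cS(1) using cS(3) by (rule mult_right_mono) simp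
        also have "\<dots> \<le> g k' div r" using sep[OF 3] .
        also have "\<dots> < i' * 1" using ik'(2) by simp
        also have "\<dots> \<le> i' * f (g k')" using fg1[of k'] by (rule mult_left_mono) simp
        also have "\<dots> = c j" using ik'(1) by simp
        finally show ?thesis using lt by simp
      qed
    qed
    then show ?thesis using cS(1) by (simp add: k_def)
  qed
  \<comment> \<open>The first two terms serve \<open>lnV\<close>, the third serves
    \<open>cost\<close>.\<close>
  define K where "K = max (max (ln 2) (\<theta>' * real d * sqrt (real r))) ((2 * s - 1) * ln 2 + l)"
  have K: "ln 2 \<le> K" "\<theta>' * real d * sqrt (real r) \<le> K" "(2 * s - 1) * ln 2 + l \<le> K" by (auto simp: K_def)
  show ?thesis
  proof (rule hausdorff_dim_ge_sparse[where K = K and l = l and z = z])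
    have "0 \<le> ln (2::real)" by simp
    then show "0 \<le> K" using K(1) by linarith
    show "z * exp (l * real n) \<le> word_sum M s n" for n by (rule Zge)
  next
    fix j
    define n where "n = g (\<kappa> j)"
    have cS: "c (Suc j) = \<iota> j * f n" "n div r < \<iota> j" "\<iota> j \<le> n" using ik[of j] by (auto simp: n_def)
    have fn: "n \<le> f n" "d * n \<le> f n" using progression_ge[of n] f[of n] by auto
    have gp: "f n \<le> c (Suc j) - c j" using gap[of j] by (simp add: n_def)
    show "c (Suc j) \<le> (c (Suc j) - c j)\<^sup>2"
    proof -
      have "c (Suc j) \<le> f n * f n" unfolding cS(1) using cS(3) fn(1) by (intro mult_right_mono) auto
      also have "\<dots> \<le> (c (Suc j) - c j) * (c (Suc j) - c j)" using gp by (intro mult_mono) auto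
      finally show ?thesis by (simp add: power2_eq_square)
    qed
    show "ln (real (V j)) \<le> K * (1 + sqrt (real (c (Suc j))))"
    proof -
      \<comment> \<open>The effect of leaving out \<open>i <= n div r\<close>: the position is at
        least \<open>n * f n / r\<close>, hence at least \<open>n^2 / r\<close>, so \<open>n\<close>
        is of the order of its square root.\<close>
      have "n < r * \<iota> j"
      proof -
        have "n = r * (n div r) + n mod r" by simp
        also have "\<dots> < r * (n div r) + r" using r by (intro add_strict_left_mono) simp
        also have "\<dots> = r * Suc (n div r)" by simp
        also have "\<dots> \<le> r * \<iota> j" using cS(2) by (intro mult_left_mono) auto
        finally show ?thesis .
      qed
      then have "n * n \<le> (r * \<iota> j) * f n" using fn(1) by (intro mult_mono) auto
      then have "n * n \<le> r * c (Suc j)" unfolding cS(1) by (simp add: mult.assoc)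
      then have "(real n)\<^sup>2 \<le> real r * real (c (Suc j))"
        by (simp add: power2_eq_square flip: of_nat_mult)
      then have "real n \<le> sqrt (real r * real (c (Suc j)))" by (intro real_le_rsqrt)
      then have nr: "real n \<le> sqrt (real r) * sqrt (real (c (Suc j)))" by (simp add: real_sqrt_mult)
      have "\<theta>' * (real d * real n) = (\<theta>' * real d) * real n" by simp
      also have "\<dots> \<le> (\<theta>' * real d) * (sqrt (real r) * sqrt (real (c (Suc j))))" using nr \<theta> by (intro mult_left_mono) auto
      also have "\<dots> = (\<theta>' * real d * sqrt (real r)) * sqrt (real (c (Suc j)))" by simp
      also have "\<dots> \<le> K * sqrt (real (c (Suc j)))" using K(2) by (intro mult_right_mono) auto
      finally have "\<theta>' * (real d * real n) \<le> K * sqrt (real (c (Suc j)))" .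
      then show ?thesis using lnV[of j] K(1) by (simp add: n_def algebra_simps)
    qed
    show "(2 * s - 1) * ln (real (V j)) \<le> K + l * real (free j)"
    proof -
      have "(2 * s - 1) * ln (real (V j)) \<le> (2 * s - 1) * (ln 2 + \<theta>' * (real d * real n))"
        using s lnV[of j] by (intro mult_left_mono) (auto simp: n_def)
      also have "\<dots> = (2 * s - 1) * ln 2 + l * real (d * n)" by (simp add: l_def algebra_simps)
      also have "\<dots> \<le> (2 * s - 1) * ln 2 + l * (real (free j) + 1)"
      proof -
        have "d * n \<le> free j + 1" using gp fn(2) by (simp add: c_Suc)
        then have "real (d * n) \<le> real (free j) + 1" by linarith
        then show ?thesis using l by (intro add_left_mono mult_left_mono) auto
      qed
      also have "\<dots> \<le> K + l * real (free j)" using K(3) by (simp add: algebra_simps)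
      finally show ?thesis .
    qed
  next
    fix a :: "nat \<Rightarrow> nat" assume a: "\<forall>k. 1 \<le> a k" and aV: "\<forall>j. V j \<le> a (c j + free j)"
    have pq: "partial_quotient m (cf_val a) = a (m - 1)" if "m \<ge> 1" for m
      using partial_quotient_cf_val[OF a, of "m - 1"] that by simp
    have large: "exp (\<theta>' * (real d * real (g k))) \<le> real (partial_quotient (i * f (g k)) (cf_val a))"
      if i: "g k div r < i" "i \<le> g k" for i k
    proof -
      obtain j' where j': "c j' = i * f (g k)" using Smem[OF i] c_range by (metis rangeE)
      have "1 * 1 \<le> i * f (g k)" using i fg1[of k] by (intro mult_mono) auto
      then obtain j where j: "j' = Suc j" using j' c0 by (cases j') auto
      \<comment> \<open>The ranges used for different \<open>k\<close> are disjoint, so the position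
        determines \<open>k\<close> and with it the size of the digit.\<close>
      have same: "\<kappa> j = k"
      proof (rule ccontr)
        assume "\<kappa> j \<noteq> k"
        then consider "\<kappa> j < k" | "k < \<kappa> j" by linarith
        then show False
        proof cases
          case 1
          have "c (Suc j) \<le> g (\<kappa> j) * f (g (\<kappa> j))" using ik[of j] by (simp add: mult_right_mono)
          also have "\<dots> < i * 1" using sep[OF 1] i by simp
          also have "\<dots> \<le> i * f (g k)" using fg1[of k] by (rule mult_left_mono) simp
          finally show False using j' j by simp
        next
          case 2
          have "i * f (g k) \<le> g k * f (g k)" using i by (simp add: mult_right_mono)
          also have "\<dots> < \<iota> j * 1" using sep[OF 2] ik[of j] by simp
          also have "\<dots> \<le> \<iota> j * f (g (\<kappa> j))" using fg1[of "\<kappa> j"] by (rule mult_left_mono) simp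
          finally show False using j' j ik[of j] by simp
        qed
      qed
      have "exp (\<theta>' * (real d * real (g k))) \<le> real (V j)" using V(1)[of j] same by simp
      also have "\<dots> \<le> real (a (c j + free j))" using aV by simp
      also have "\<dots> = real (partial_quotient (c (Suc j)) (cf_val a))" using pq[of "c (Suc j)"] by (simp add: c_Suc)
      finally show ?thesis using j' j by simp
    qed
    show "cf_val a \<in> E_set f \<psi>"
    proof (rule E_setI)
      show "cf_val a \<in> cf_domain" using a by (rule cf_val_in_cf_domain)
      show "\<exists>\<^sub>\<infinity>n. n \<ge> 1 \<and> 0 \<le> \<psi> n \<and> \<psi> n ^ n \<le> digit_product f n (cf_val a)"
        unfolding INFM_nat_le
      proof
        fix N
        define n where "n = g N"
        have n: "n \<ge> 1" "ln (\<psi> n) \<le> \<theta> * (real d * real n)" using g(1)[of N] by (auto simp: good_def n_def)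
        have psi: "\<psi> n \<ge> 1" using \<psi> n by blast
        define E where "E = exp (\<theta>' * (real d * real n))"
        have pq1: "1 \<le> real (partial_quotient (i * f n) (cf_val a))" if "i \<ge> 1" for i
        proof -
          have "1 * 1 \<le> i * f n" using that fg1[of N] by (intro mult_mono) (auto simp: n_def)
          then show ?thesis using pq[of "i * f n"] a by simp
        qed
        have "\<psi> n ^ n = exp (real n * ln (\<psi> n))" using psi by (simp add: exp_of_nat_mult)
        \<comment> \<open>By the choice of \<open>r\<close> the \<open>n - n div r\<close> large
          digits alone suffice; the remaining factors are at least 1.\<close>
        also have "\<dots> \<le> exp (real (n - n div r) * (\<theta>' * (real d * real n)))"
        proof -
          have "real (n div r) \<le> real n / real r" by (rule of_nat_div_le_of_nat)
          then have "real n * (1 - 1 / real r) \<le> real (n - n div r)" by (simp add: of_nat_diff algebra_simps)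
          then have "real n * (1 - 1 / real r) * (\<theta>' * (real d * real n)) \<le> real (n - n div r) * (\<theta>' * (real d * real n))"
            using \<theta> by (intro mult_right_mono) auto
          moreover have "real n * ln (\<psi> n) \<le> real n * (\<theta> * (real d * real n))" using n by (intro mult_left_mono) auto
          moreover have "real n * (\<theta> * (real d * real n)) \<le> real n * ((1 - 1 / real r) * \<theta>' * (real d * real n))"
            using r\<theta> by (intro mult_left_mono mult_right_mono) auto
          moreover have "real n * ((1 - 1 / real r) * \<theta>' * (real d * real n)) = real n * (1 - 1 / real r) * (\<theta>' * (real d * real n))" by simp
          ultimately show ?thesis by (simp only: exp_le_cancel_iff)
        qed
        also have "\<dots> = (\<Prod>i\<in>{n div r<..n}. E)"
          unfolding exp_of_nat_mult E_def[symmetric] by simp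
        also have "\<dots> \<le> (\<Prod>i\<in>{n div r<..n}. real (partial_quotient (i * f n) (cf_val a)))"
          using large[of N] by (intro prod_mono) (auto simp: E_def n_def)
        also have "\<dots> \<le> (\<Prod>i\<in>{1..n}. real (partial_quotient (i * f n) (cf_val a)))"
        proof (rule prod_mono2)
          show "{n div r<..n} \<subseteq> {1..n}" by auto
        qed (use pq1 in \<open>auto intro: order_trans[OF zero_le_one]\<close>)
        finally show "\<exists>n\<ge>N. n \<ge> 1 \<and> 0 \<le> \<psi> n \<and> \<psi> n ^ n \<le> digit_product f n (cf_val a)"
          using n psi gk[of N] by (intro exI[of _ n]) (auto simp: n_def)
      qed
    qed
  qed (use s' l z in auto)
qed

section \<open>From the growth of \<open>\<psi>\<close> to the two dimension formulas\<close>

lemma frequently_le_of_liminf_less: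
  fixes X :: "nat \<Rightarrow> ereal"
  assumes "liminf X < C"
  shows "\<exists>\<^sub>\<infinity>n. X n \<le> C"
proof (rule ccontr)
  assume "\<not> (\<exists>\<^sub>\<infinity>n. X n \<le> C)"
  then have "\<forall>\<^sub>F n in sequentially. \<not> X n \<le> C"
    by (simp add: not_frequently cofinite_eq_sequentially)
  then have "\<forall>\<^sub>F n in sequentially. C \<le> X n" by (rule eventually_mono) simp
  then have "C \<le> liminf X" by (rule Liminf_bounded)
  then show False using assms by simp
qed

lemma eventually_mult_le_power:
  fixes K c :: real
  assumes "c > 1"
  shows "\<forall>\<^sub>F m in sequentially. K * real m \<le> c ^ m"
proof -
  have "(\<lambda>m. real m * (1 / c) ^ m) \<longlonglongrightarrow> 0" using assms by (intro powser_times_n_limit_0) auto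
  then have "(\<lambda>m. K * (real m * (1 / c) ^ m)) \<longlonglongrightarrow> K * 0" by (intro tendsto_intros)
  then have "\<forall>\<^sub>F m in sequentially. K * (real m * (1 / c) ^ m) < 1"
    by (rule order_tendstoD(2)) simp
  then show ?thesis
  proof eventually_elim
    case (elim m)
    have "c ^ m > 0" using assms by simp
    then show ?case using elim assms by (simp add: power_divide pos_divide_less_eq)
  qed
qed

text \<open>For \<open>s <= 1 / 2\<close> the pressure is infinite, which confines the candidates to
  \<open>s > 1 / 2\<close>, where it is \<open>cf_pressure s\<close> minus the constant.\<close>

lemma pressure_le_0_iff:
  assumes "0 \<le> s"
  shows "pressure (\<lambda>x. - s * ln \<bar>deriv gauss_map x\<bar> - (2 * s - 1) * \<beta>) \<le> 0 \<longleftrightarrow>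
    s > 1 / 2 \<and> cf_pressure s \<le> (2 * s - 1) * \<beta>"
proof -
  have e: "(\<lambda>x. - s * ln \<bar>deriv gauss_map x\<bar> - (2 * s - 1) * \<beta>) = geometric_potential s ((2 * s - 1) * \<beta>)"
    by (auto simp: geometric_potential_def)
  show ?thesis
  proof (cases "s > 1 / 2")
    case True
    then show ?thesis unfolding e pressure_geometric_potential[OF True] by simp
  next
    case False
    then have "s \<le> 1 / 2" by simp
    then show ?thesis using False unfolding e pressure_geometric_potential_top[OF assms \<open>s \<le> 1 / 2\<close>] by simp
  qed
qed

text \<open>In the applications \<open>L\<close> is \<open>ln (\<psi> n)\<close> and
  \<open>D\<close> is \<open>d * n^2\<close>. The value \<open>\<psi> n = 1\<close> gives
  \<open>L = 0\<close>, whose logarithm is minus infinity, hence the case distinction.\<close>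

lemma ln_ennreal_divide:
  assumes "D > 0"
  shows "ereal (ln c) < ln_ennreal (ennreal L) / ereal D \<Longrightarrow> c > 0 \<Longrightarrow> c powr D \<le> L"
    and "ln_ennreal (ennreal L) / ereal D \<le> ereal (ln c) \<Longrightarrow> c > 0 \<Longrightarrow> L \<le> c powr D"
proof -
  have val: "ln_ennreal (ennreal L) / ereal D = (if L \<le> 0 then -\<infinity> else ereal (ln L / D))"
    using assms by (auto simp: ln_ennreal_def ennreal_eq_0_iff)
  show "c powr D \<le> L" if "ereal (ln c) < ln_ennreal (ennreal L) / ereal D" "c > 0"
  proof -
    have L: "L > 0" "ln c < ln L / D" using that(1) unfolding val by (auto split: if_splits)
    then have "D * ln c \<le> ln L" using assms by (simp add: field_simps)
    then have "exp (D * ln c) \<le> exp (ln L)" by simp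
    then show ?thesis using L that by (simp add: powr_def)
  qed
  show "L \<le> c powr D" if "ln_ennreal (ennreal L) / ereal D \<le> ereal (ln c)" "c > 0"
  proof (cases "L \<le> 0")
    case True
    then show ?thesis using powr_ge_zero[of c D] by linarith
  next
    case False
    then have "ln L \<le> D * ln c" using that(1) assms unfolding val by (simp add: field_simps)
    then have "exp (ln L) \<le> exp (D * ln c)" by simp
    then show ?thesis using False that by (simp add: powr_def)
  qed
qed

context
  fixes d t :: nat and f :: "nat \<Rightarrow> nat" and \<psi> :: "nat \<Rightarrow> real"
  assumes d: "d \<ge> 1" and f: "\<And>n. f n = d * n + t" and \<psi>: "\<And>n. n \<ge> 1 \<Longrightarrow> \<psi> n \<ge> 1"
begin

lemma progression_ge: "n \<le> f n" "n \<ge> 1 \<Longrightarrow> 1 \<le> f n"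
proof -
  have "1 * n \<le> d * n" using d by (intro mult_right_mono) auto
  then show "n \<le> f n" using f[of n] by linarith
  then show "n \<ge> 1 \<Longrightarrow> 1 \<le> f n" by linarith
qed

lemma progression_length_ge: "d * n\<^sup>2 \<le> n * f n" "n \<le> n * f n"
proof -
  show "d * n\<^sup>2 \<le> n * f n" unfolding f by (simp add: power2_eq_square algebra_simps)
  show "n \<le> n * f n" using progression_ge(2)[of n] by (cases "n = 0") auto
qed

text \<open>With \<open>\<theta>\<close> arbitrarily large, \<open>\<sigma> * \<theta>\<close>
  exceeds any pressure, so the Chebyshev bound applies at every \<open>s > 1 / 2\<close>.\<close>

lemma hausdorff_dim_le_half:
  assumes "\<And>\<theta>. \<forall>\<^sub>F n in sequentially. \<theta> * (real d * real n) \<le> ln (\<psi> n)" and s: "s > 1 / 2"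
  shows "hausdorff_dim (E_set f \<psi>) \<le> ennreal s"
proof (rule hausdorff_dim_le)
  define \<sigma> where "\<sigma> = (2 * s - 1) / 2"
  have \<sigma>: "0 < \<sigma>" "\<sigma> < 2 * s - 1" using s by (auto simp: \<sigma>_def field_simps)
  have lt: "cf_pressure s < \<sigma> * ((cf_pressure s + 1) / \<sigma>)" using \<sigma> by simp
  show "hausdorff_measure s (E_set f \<psi>) = 0"
    by (intro hausdorff_measure_E_set_eq_0[OF d f \<psi> s _ \<sigma>(2) assms(1) lt]) (use \<sigma> in auto)
qed (use s in auto)

text \<open>If the geometric mean of \<open>n\<close> digits is at least \<open>\<psi> n\<close>, so
  is one of them. Its position is at most \<open>n * f n\<close>, which exceeds
  \<open>d * n^2\<close> only by \<open>t * n\<close>; passing from \<open>c1\<close> to a smaller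
  \<open>c\<close> absorbs the excess.\<close>

lemma hausdorff_dim_le_double_exponential:
  assumes ev: "\<forall>\<^sub>F n in sequentially. c1 powr (real d * (real n)\<^sup>2) \<le> ln (\<psi> n)"
    and c: "1 < c'" "c' < c1" and s: "s > 1 / (1 + c')"
  shows "hausdorff_dim (E_set f \<psi>) \<le> ennreal s"
proof (rule hausdorff_dim_le)
  define c where "c = (c' + c1) / 2"
  have cc: "c' < c" "c < c1" "1 < c" using c by (auto simp: c_def)
  have "1 / (1 + c') > 0" using c by simp
  then show "0 \<le> s" using s by linarith
  have lnc: "ln c < ln c1" "0 < ln c" using cc by simp_all
  obtain N1 where N1: "\<And>n. n \<ge> N1 \<Longrightarrow> c1 powr (real d * (real n)\<^sup>2) \<le> ln (\<psi> n)"
    using ev unfolding eventually_sequentially by auto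
  obtain N2 :: nat where N2: "real t * ln c \<le> real N2 * (ln c1 - ln c)"
    using reals_Archimedean3[of "ln c1 - ln c"] lnc by (metis diff_gt_0_iff_gt less_imp_le)
  show "hausdorff_measure s (E_set f \<psi>) = 0"
  proof (rule hausdorff_measure_large_quotients_eq_0[OF c(1) cc(1) s])
    show "E_set f \<psi> \<subseteq> cf_domain" using E_setD(1)[of f \<psi>] progression_ge(2) \<psi> by blast
    fix x assume x: "x \<in> E_set f \<psi>"
    show "\<exists>\<^sub>\<infinity>p. c ^ p \<le> ln (real (partial_quotient p x))"
      unfolding INFM_nat_le
    proof
      fix N
      have "\<exists>\<^sub>\<infinity>n. n \<ge> 1 \<and> \<psi> n ^ n \<le> digit_product f n x"
        using E_setD(2)[of f \<psi> x] progression_ge(2) \<psi> x by blast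
      then obtain n where n: "n \<ge> max N (max N1 N2)" "n \<ge> 1" "\<psi> n ^ n \<le> digit_product f n x"
        unfolding INFM_nat_le by blast
      have psi: "\<psi> n \<ge> 1" using \<psi> n by blast
      have "\<exists>i\<in>{1..n}. \<psi> n \<le> real (partial_quotient (i * f n) x)"
      proof (rule ccontr)
        assume "\<not> ?thesis"
        then have "digit_product f n x < (\<Prod>i=1..n. \<psi> n)"
          using n psi by (intro prod_mono_strict) (auto simp: not_le less_imp_le)
        then show False using n by simp
      qed
      then obtain i where i: "1 \<le> i" "i \<le> n" "\<psi> n \<le> real (partial_quotient (i * f n) x)" by auto
      have "i * f n \<le> n * f n" using i by (intro mult_right_mono) auto
      then have "c ^ (i * f n) \<le> c ^ (n * f n)" using cc by (intro power_increasing) auto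
      also have "\<dots> = exp (real (n * f n) * ln c)" using cc by (subst exp_of_nat_mult) simp
      also have "\<dots> \<le> exp (real d * (real n)\<^sup>2 * ln c1)"
      proof -
        have "real t * ln c \<le> real n * (ln c1 - ln c)"
        proof -
          have "real N2 * (ln c1 - ln c) \<le> real n * (ln c1 - ln c)" using n lnc by (intro mult_right_mono) auto
          then show ?thesis using N2 by linarith
        qed
        also have "\<dots> \<le> real d * real n * (ln c1 - ln c)"
        proof -
          have "1 * real n \<le> real d * real n" using d by (intro mult_right_mono) auto
          then show ?thesis using lnc by (intro mult_right_mono) auto
        qed
        finally have "real n * (real t * ln c) \<le> real n * (real d * real n * (ln c1 - ln c))" by (intro mult_left_mono) auto
        then have "real (n * f n) * ln c \<le> real d * (real n)\<^sup>2 * ln c1" unfolding f by (simp add: power2_eq_square algebra_simps)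
        then show ?thesis by simp
      qed
      also have "\<dots> = c1 powr (real d * (real n)\<^sup>2)" using cc by (simp add: powr_def)
      also have "\<dots> \<le> ln (\<psi> n)" using N1[of n] n by simp
      also have "\<dots> \<le> ln (real (partial_quotient (i * f n) x))" using i psi by simp
      finally have "c ^ (i * f n) \<le> ln (real (partial_quotient (i * f n) x))" .
      moreover have "i * f n \<ge> N"
      proof -
        have "N \<le> f n" using n progression_ge(1)[of n] by simp
        also have "\<dots> \<le> i * f n" using i by simp
        finally show ?thesis .
      qed
      ultimately show "\<exists>p\<ge>N. c ^ p \<le> ln (real (partial_quotient p x))" by blast
    qed
  qed
qed

text \<open>For \<open>s < 1 / 2\<close> some \<open>b > 1\<close> satisfies
  \<open>s < 1 / (1 + b)\<close>, and doubly exponential digits with this \<open>b\<close> outgrow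
  any bound \<open>exp (\<theta> * d * n^2)\<close> for the products.\<close>

lemma hausdorff_dim_ge_of_exponential_bound:
  assumes inf: "\<exists>\<^sub>\<infinity>n. ln (\<psi> n) \<le> \<theta> * (real d * real n)" and s: "0 < s" "s < 1 / 2"
  shows "ennreal s \<le> hausdorff_dim (E_set f \<psi>)"
proof -

  obtain b where b: "1 < b" "b < 1 / s - 1"
  proof -
    have "1 < 1 / s - 1" using s by (simp add: field_simps)
    then show ?thesis using dense that by blast
  qed
  have sb: "s < 1 / (1 + b)" using b s by (simp add: field_simps)
  obtain N where N: "\<And>m. m \<ge> N \<Longrightarrow> (max 0 \<theta> * b) * real m \<le> b ^ m"
    using eventually_mult_le_power[OF b(1)] unfolding eventually_sequentially by blast
  show ?thesis
  proof (rule hausdorff_dim_ge_double_exponential[OF b(1) _ _ _ s(1) sb])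
    show "\<exists>\<^sub>\<infinity>n. n \<ge> 1 \<and> real n * ln (\<psi> n) \<le> b ^ (n * f n - 1)"
      unfolding INFM_nat_le
    proof
      fix k
      obtain n where n: "n \<ge> max k (max N 1)" "ln (\<psi> n) \<le> \<theta> * (real d * real n)"
        using inf unfolding INFM_nat_le by blast
      have nf: "n \<le> n * f n" "1 \<le> n * f n" using progression_length_ge(2)[of n] n by auto
      have "real n * ln (\<psi> n) \<le> real n * (max 0 \<theta> * (real d * real n))"
      proof -
        have "\<theta> * (real d * real n) \<le> max 0 \<theta> * (real d * real n)" by (intro mult_right_mono) auto
        then show ?thesis using n(2) by (intro mult_left_mono) auto
      qed
      also have "\<dots> = max 0 \<theta> * real (d * n\<^sup>2)" by (simp add: power2_eq_square)
      also have "\<dots> \<le> max 0 \<theta> * real (n * f n)" using progression_length_ge(1)[of n] by (intro mult_left_mono of_nat_mono) auto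
      finally have "b * (real n * ln (\<psi> n)) \<le> (max 0 \<theta> * b) * real (n * f n)" using b by simp
      also have "\<dots> \<le> b ^ (n * f n)" using n nf by (intro N) linarith
      also have "\<dots> = b * b ^ (n * f n - 1)" using nf(2) by (simp add: power_eq_if)
      finally have "real n * ln (\<psi> n) \<le> b ^ (n * f n - 1)" using b by simp
      then show "\<exists>n\<ge>k. n \<ge> 1 \<and> real n * ln (\<psi> n) \<le> b ^ (n * f n - 1)" using n by (intro exI[of _ n]) auto
    qed
  qed (use progression_ge(2) \<psi> in auto)
qed

text \<open>The step from \<open>b'\<close> to \<open>b\<close> absorbs the factor \<open>n\<close>
  in \<open>ln (\<psi> n ^ n)\<close> and the shift by one in the exponent.\<close>

lemma hausdorff_dim_ge_of_double_exponential_bound: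
  assumes inf: "\<exists>\<^sub>\<infinity>n. ln (\<psi> n) \<le> b' powr (real d * (real n)\<^sup>2)"
    and b: "1 \<le> b'" "b' < b" and s: "0 < s" "s < 1 / (1 + b)"
  shows "ennreal s \<le> hausdorff_dim (E_set f \<psi>)"
proof -
  have b1: "b > 1" using b by simp
  have "b / b' > 1" using b by simp
  then obtain N where N: "\<And>m. m \<ge> N \<Longrightarrow> b * real m \<le> (b / b') ^ m"
    using eventually_mult_le_power[of "b / b'" b] unfolding eventually_sequentially by blast
  show ?thesis
  proof (rule hausdorff_dim_ge_double_exponential[OF b1 _ _ _ s])
    show "\<exists>\<^sub>\<infinity>n. n \<ge> 1 \<and> real n * ln (\<psi> n) \<le> b ^ (n * f n - 1)"
      unfolding INFM_nat_le
    proof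
      fix k
      obtain n where n: "n \<ge> max k (max N 1)" "ln (\<psi> n) \<le> b' powr (real d * (real n)\<^sup>2)"
        using inf unfolding INFM_nat_le by blast
      define m where "m = d * n\<^sup>2"
      have nm: "n \<le> m"
      proof -
        have "1 * n \<le> d * (n * n)" using d n by (intro mult_mono) auto
        then show ?thesis by (simp add: m_def power2_eq_square)
      qed
      have mf: "m \<le> n * f n" unfolding m_def by (rule progression_length_ge(1))
      have "b' powr (real d * (real n)\<^sup>2) = b' ^ m" using b by (simp add: m_def flip: powr_realpow)
      moreover have "0 \<le> ln (\<psi> n)" using \<psi>[of n] n by simp
      ultimately have "real n * ln (\<psi> n) \<le> real m * b' ^ m" using n nm b by (intro mult_mono) auto
      then have "b * (real n * ln (\<psi> n)) \<le> b * (real m * b' ^ m)" using b1 by (intro mult_left_mono) auto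
      also have "\<dots> = (b * real m) * b' ^ m" by simp
      also have "\<dots> \<le> (b / b') ^ m * b' ^ m" using N[of m] n nm b by (intro mult_right_mono) auto
      also have "\<dots> = b ^ m" using b by (simp add: power_divide)
      also have "\<dots> \<le> b ^ (n * f n)" using mf b1 by (intro power_increasing) auto
      also have "\<dots> = b * b ^ (n * f n - 1)"
      proof -
        have "n * f n = Suc (n * f n - 1)" using mf nm n by linarith
        then show ?thesis by (metis power_Suc)
      qed
      finally have "real n * ln (\<psi> n) \<le> b ^ (n * f n - 1)" using b1 by simp
      then show "\<exists>n\<ge>k. n \<ge> 1 \<and> real n * ln (\<psi> n) \<le> b ^ (n * f n - 1)" using n by (intro exI[of _ n]) auto
    qed
  qed (use progression_ge(2) \<psi> in auto)
qed

lemma hausdorff_dim_E_set_finite: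
  assumes \<beta>: "\<beta> \<ge> 0" and lim: "liminf (\<lambda>n. ereal (ln (\<psi> n) / (real d * real n))) = ereal \<beta>"
  shows "hausdorff_dim (E_set f \<psi>) = (INF s\<in>{s. 0 \<le> s \<and> s > 1 / 2 \<and> cf_pressure s \<le> (2 * s - 1) * \<beta>}. ennreal s)"
    (is "_ = (INF s\<in>?T. ennreal s)")
proof (rule antisym)
  have ev: "\<forall>\<^sub>F n in sequentially. \<theta> * (real d * real n) \<le> ln (\<psi> n)" if "\<theta> < \<beta>" for \<theta>
  proof -
    have "\<forall>\<^sub>F n in sequentially. ereal \<theta> < ereal (ln (\<psi> n) / (real d * real n))"
      using that lim by (intro less_LiminfD) simp
    then show ?thesis using eventually_ge_at_top[of 1]
    proof eventually_elim
      case (elim n)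
      then have "real d * real n > 0" using d by simp
      then show ?case using elim by (simp add: field_simps)
    qed
  qed
  have fr: "\<exists>\<^sub>\<infinity>n. ln (\<psi> n) \<le> \<theta> * (real d * real n)" if "\<beta> < \<theta>" for \<theta>
  proof -
    have "\<exists>\<^sub>\<infinity>n. ereal (ln (\<psi> n) / (real d * real n)) \<le> ereal \<theta>"
      using that lim by (intro frequently_le_of_liminf_less) simp
    then have fr: "\<exists>\<^sub>\<infinity>n. ln (\<psi> n) / (real d * real n) \<le> \<theta>" by simp
    show ?thesis unfolding INFM_nat_le
    proof
      fix N
      obtain n where n: "n \<ge> max N 1" "ln (\<psi> n) / (real d * real n) \<le> \<theta>" using fr unfolding INFM_nat_le by blast
      then have "real d * real n > 0" using d by simp
      then have "ln (\<psi> n) \<le> \<theta> * (real d * real n)" using n by (simp add: pos_divide_le_eq)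
      then show "\<exists>n\<ge>N. ln (\<psi> n) \<le> \<theta> * (real d * real n)" using n by (intro exI[of _ n]) auto
    qed
  qed
  show "hausdorff_dim (E_set f \<psi>) \<le> (INF s\<in>?T. ennreal s)"
  proof (rule INF_greatest)
    fix s assume "s \<in> ?T"
    then have s: "s > 1 / 2" "cf_pressure s \<le> (2 * s - 1) * \<beta>" by auto
    show "hausdorff_dim (E_set f \<psi>) \<le> ennreal s"
    proof (rule ennreal_le_epsilon)
      fix e :: real assume e: "e > 0"
      define s' \<Delta> where "s' = s + e" and "\<Delta> = e * ln 2"
      have s': "s' > 1 / 2" "s' \<ge> 0" using s e by (auto simp: s'_def)
      have \<Delta>: "\<Delta> > 0" using e by (simp add: \<Delta>_def)
      \<comment> \<open>Raising \<open>s\<close> by \<open>e\<close> lowers the pressure by at least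
        \<open>\<Delta>\<close>, half of which pays for replacing \<open>\<beta>\<close> by
        \<open>\<beta> - \<epsilon>\<close>. The factor \<open>2 * s - 1\<close> is admissible as
        Chebyshev exponent at \<open>s'\<close> because it is below
        \<open>2 * s' - 1\<close>.\<close>
      define \<epsilon> where "\<epsilon> = \<Delta> / (2 * (2 * s - 1))"
      have \<epsilon>: "\<epsilon> > 0" "(2 * s - 1) * \<epsilon> = \<Delta> / 2" using \<Delta> s by (auto simp: \<epsilon>_def field_simps)
      have "cf_pressure s' \<le> cf_pressure s - (s' - s) * ln 2" using s e by (intro cf_pressure_decreasing) (auto simp: s'_def)
      also have "\<dots> < (2 * s - 1) * (\<beta> - \<epsilon>)" using s \<epsilon> \<Delta> unfolding s'_def by (simp add: right_diff_distrib \<Delta>_def)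
      finally have "cf_pressure s' < (2 * s - 1) * (\<beta> - \<epsilon>)" .
      then have "hausdorff_measure s' (E_set f \<psi>) = 0"
        using s e \<epsilon> by (intro hausdorff_measure_E_set_eq_0[OF d f \<psi> s'(1) _ _ ev]) (auto simp: s'_def)
      then have "hausdorff_dim (E_set f \<psi>) \<le> ennreal s'" using s' by (intro hausdorff_dim_le) auto
      also have "\<dots> = ennreal s + ennreal e" using s e by (simp add: s'_def ennreal_plus)
      finally show "hausdorff_dim (E_set f \<psi>) \<le> ennreal s + ennreal e" .
    qed
  qed
  have one: "(1::real) \<in> ?T" using cf_pressure_1_le_0 \<beta> by simp
  show "(INF s\<in>?T. ennreal s) \<le> hausdorff_dim (E_set f \<psi>)"
  proof (rule dense_le)
    fix x assume x: "x < (INF s\<in>?T. ennreal s)"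
    have "(INF s\<in>?T. ennreal s) \<le> ennreal 1" using one by (rule INF_lower)
    obtain y where y: "x < y" "y < (INF s\<in>?T. ennreal s)" using dense[OF x] by blast
    have "y < ennreal 1" using y(2) \<open>_ \<le> ennreal 1\<close> by (rule less_le_trans)
    \<comment> \<open>An \<open>s\<close> strictly between \<open>x\<close> and the infimum is no
      candidate: either \<open>s <= 1 / 2\<close> or the pressure at \<open>s\<close> exceeds
      \<open>(2 * s - 1) * \<beta>\<close>. In both cases a lower bound holds for every value below
      \<open>s\<close>.\<close>
    then obtain s where s: "y = ennreal s" "0 \<le> s" "s < 1" by (cases y) (auto simp: ennreal_less_iff)
    obtain r where r: "x = ennreal r" "0 \<le> r" "r < s" using y(1) s by (cases x) (auto simp: ennreal_less_iff)
    have notin: "s \<notin> ?T"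
    proof
      assume "s \<in> ?T"
      then have "(INF s\<in>?T. ennreal s) \<le> ennreal s" by (rule INF_lower)
      then show False using y(2) s(1) by simp
    qed
    show "x \<le> hausdorff_dim (E_set f \<psi>)"
    proof (cases "r = 0")
      case False
      then have r0: "r > 0" using r by simp
      show ?thesis
      proof (cases "s > 1 / 2")
        case True
        then have P: "(2 * s - 1) * \<beta> < cf_pressure s" using notin s by auto
        have "\<beta> < cf_pressure s / (2 * s - 1)" using P True by (simp add: field_simps)
        then obtain \<theta>' where th': "\<beta> < \<theta>'" "\<theta>' < cf_pressure s / (2 * s - 1)" using dense by blast
        obtain \<theta> where th: "\<beta> < \<theta>" "\<theta> < \<theta>'" using th'(1) dense by blast
        have "(2 * s - 1) * \<theta>' < cf_pressure s" using th'(2) True by (simp add: field_simps)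
        then show ?thesis unfolding r(1)
          using th \<beta> True r r0 s by (intro hausdorff_dim_ge_exponential[OF d f \<psi> fr[OF th(1)]]) auto
      next
        case False
        then show ?thesis unfolding r(1)
          using r r0 by (intro hausdorff_dim_ge_of_exponential_bound[OF fr[of "\<beta> + 1"]]) auto
      qed
    qed (simp add: r)
  qed
qed

text \<open>The upper bound has two sources, because large quotients give
  \<open>1 / (1 + c')\<close> only for \<open>c' > 1\<close>; the value 1/2 at \<open>b = 1\<close>
  comes from \<open>hausdorff_dim_le_half\<close>.\<close>

lemma hausdorff_dim_E_set_infinite:
  fixes b :: ennreal
  assumes lim: "liminf (\<lambda>n. ereal (ln (\<psi> n) / (real d * real n))) = \<infinity>"
    and b: "ln_ennreal b = liminf (\<lambda>n. ln_ennreal (ennreal (ln (\<psi> n))) / ereal (real d * (real n)\<^sup>2))"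
  shows "hausdorff_dim (E_set f \<psi>) = 1 / (1 + b)"
proof -
  have ev: "\<forall>\<^sub>F n in sequentially. \<theta> * (real d * real n) \<le> ln (\<psi> n)" for \<theta>
  proof -
    have "\<forall>\<^sub>F n in sequentially. ereal \<theta> < ereal (ln (\<psi> n) / (real d * real n))"
      using lim by (intro less_LiminfD) simp
    then show ?thesis using eventually_ge_at_top[of 1]
    proof eventually_elim
      case (elim n)
      then have "real d * real n > 0" using d by simp
      then show ?case using elim by (simp add: field_simps)
    qed
  qed
  have Dpos: "real d * (real n)\<^sup>2 > 0" if "n \<ge> 1" for n using that d by simp
  have evb: "\<forall>\<^sub>F n in sequentially. c powr (real d * (real n)\<^sup>2) \<le> ln (\<psi> n)" if "c > 0" "ereal (ln c) < ln_ennreal b" for c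
  proof -
    have "\<forall>\<^sub>F n in sequentially. ereal (ln c) < ln_ennreal (ennreal (ln (\<psi> n))) / ereal (real d * (real n)\<^sup>2)"
      using that b by (intro less_LiminfD) simp
    then show ?thesis using eventually_ge_at_top[of 1]
      by eventually_elim (use ln_ennreal_divide(1)[OF Dpos] that in blast)
  qed
  have frb: "\<exists>\<^sub>\<infinity>n. ln (\<psi> n) \<le> c powr (real d * (real n)\<^sup>2)" if "c > 0" "ln_ennreal b < ereal (ln c)" for c
  proof -
    have fr: "\<exists>\<^sub>\<infinity>n. ln_ennreal (ennreal (ln (\<psi> n))) / ereal (real d * (real n)\<^sup>2) \<le> ereal (ln c)"
      using that b by (intro frequently_le_of_liminf_less) simp
    show ?thesis unfolding INFM_nat_le
    proof
      fix N
      obtain n where n: "n \<ge> max N 1" "ln_ennreal (ennreal (ln (\<psi> n))) / ereal (real d * (real n)\<^sup>2) \<le> ereal (ln c)"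
        using fr unfolding INFM_nat_le by blast
      then have "ln (\<psi> n) \<le> c powr (real d * (real n)\<^sup>2)" using ln_ennreal_divide(2)[OF Dpos] that by simp
      then show "\<exists>n\<ge>N. ln (\<psi> n) \<le> c powr (real d * (real n)\<^sup>2)" using n by (intro exI[of _ n]) auto
    qed
  qed
  \<comment> \<open>Eventually \<open>\<psi> n\<close> is at least \<open>exp (d * n)\<close>, so
    the double logarithms are nonnegative.\<close>
  have b1: "b \<ge> 1"
  proof -
    have "\<forall>\<^sub>F n in sequentially. 0 \<le> ln_ennreal (ennreal (ln (\<psi> n))) / ereal (real d * (real n)\<^sup>2)"
      using ev[of 1] eventually_ge_at_top[of 1]
    proof eventually_elim
      case (elim n)
      have "1 * 1 \<le> real d * real n" using elim d by (intro mult_mono) auto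
      then have "1 \<le> ln (\<psi> n)" using elim by linarith
      then show ?case using Dpos elim(2) by (auto simp: ln_ennreal_def ennreal_eq_0_iff)
    qed
    then have "0 \<le> ln_ennreal b" unfolding b by (rule Liminf_bounded)
    then show ?thesis by (cases b) (auto simp: ln_ennreal_def ennreal_eq_0_iff ln_ge_zero_iff split: if_splits)
  qed
  \<comment> \<open>For \<open>s <= 1\<close> the second alternative says that \<open>s\<close>
    exceeds \<open>1 / (1 + b)\<close>, in a form that covers \<open>b = \<infinity>\<close> as
    well.\<close>
  have up: "hausdorff_dim (E_set f \<psi>) \<le> ennreal s" if s: "s > 0" "s > 1 / 2 \<or> ennreal (1 / s - 1) < b" for s
  proof (cases "s > 1 / 2")
    case True
    then show ?thesis by (intro hausdorff_dim_le_half ev)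
  next
    case False
    then have s2: "1 / s - 1 \<ge> 1" using s by (simp add: field_simps)
    have "ennreal (1 / s - 1) < b" using s False by simp
    then obtain y where y: "ennreal (1 / s - 1) < y" "y < b" using dense by blast
    then obtain c1 where c1: "y = ennreal c1" "0 \<le> c1" by (cases y) auto
    have c1': "1 / s - 1 < c1" using y(1) s2 unfolding c1(1) by (simp add: ennreal_less_iff)
    obtain c' where c': "1 / s - 1 < c'" "c' < c1" using c1' dense by blast
    have "1 < s * (1 + c')" using c'(1) s by (simp add: field_simps)
    moreover have "1 + c' > 0" using c'(1) s2 by linarith
    ultimately have sc': "s > 1 / (1 + c')" by (simp add: pos_divide_less_eq)
    have "ereal (ln c1) < ln_ennreal b"
      using y(2) c1 c1' s2 by (cases b) (auto simp: ln_ennreal_def ennreal_less_iff ennreal_eq_0_iff)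
    then have "\<forall>\<^sub>F n in sequentially. c1 powr (real d * (real n)\<^sup>2) \<le> ln (\<psi> n)"
      using c1' s2 by (intro evb) auto
    then show ?thesis using c' s2 sc' by (intro hausdorff_dim_le_double_exponential) auto
  qed
  show ?thesis
  proof (cases b)
    case top
    have "hausdorff_dim (E_set f \<psi>) \<le> 0"
    proof (rule ennreal_le_epsilon)
      fix e :: real assume "e > 0"
      then show "hausdorff_dim (E_set f \<psi>) \<le> 0 + ennreal e" using up[of e] top by simp
    qed
    then show ?thesis using top by simp
  next
    case (real r)
    have r1: "r \<ge> 1" using b1 real by (simp flip: ennreal_1)
    have lnb: "ln_ennreal b = ereal (ln r)" using real r1 by (auto simp: ln_ennreal_def)
    have eq: "1 / (1 + b) = ennreal (1 / (1 + r))"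
      using real r1 by (simp add: divide_ennreal flip: ennreal_1 ennreal_plus)
    show ?thesis unfolding eq
    proof (rule antisym)
      show "hausdorff_dim (E_set f \<psi>) \<le> ennreal (1 / (1 + r))"
      proof (rule ennreal_le_epsilon)
        fix e :: real assume e: "e > 0"
        define s where "s = 1 / (1 + r) + e"
        have s: "s > 1 / (1 + r)" "s > 0" using e r1 by (auto simp: s_def intro!: add_pos_pos)
        then have "1 / s - 1 < r" using r1 by (simp add: field_simps)
        then have "ennreal (1 / s - 1) < b" using real r1 by (simp add: ennreal_lessI)
        then have "hausdorff_dim (E_set f \<psi>) \<le> ennreal s" using s up by blast
        then show "hausdorff_dim (E_set f \<psi>) \<le> ennreal (1 / (1 + r)) + ennreal e"
          using e r1 by (simp add: s_def ennreal_plus)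
      qed
      show "ennreal (1 / (1 + r)) \<le> hausdorff_dim (E_set f \<psi>)"
      proof (rule dense_le)
        fix x assume "x < ennreal (1 / (1 + r))"
        then obtain s where s: "x = ennreal s" "0 \<le> s" "s < 1 / (1 + r)" by (cases x) (auto simp: ennreal_less_iff)
        show "x \<le> hausdorff_dim (E_set f \<psi>)"
        proof (cases "s = 0")
          case False
          then have s0: "s > 0" using s by simp
          have "r < 1 / s - 1" using s s0 r1 by (simp add: field_simps)
          then obtain q where q: "r < q" "q < 1 / s - 1" using dense by blast
          obtain q' where q': "r < q'" "q' < q" using q(1) dense by blast
          have "s < 1 / (1 + q)" using q s0 r1 by (simp add: field_simps)
          moreover have "\<exists>\<^sub>\<infinity>n. ln (\<psi> n) \<le> q' powr (real d * (real n)\<^sup>2)"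
            using q' r1 lnb by (intro frb) auto
          ultimately show ?thesis unfolding s(1)
            using q' r1 s0 by (intro hausdorff_dim_ge_of_double_exponential_bound[of q' q]) auto
        qed (simp add: s)
      qed
    qed
  qed
qed

end

theorem theorem1p3:
  fixes d t :: nat and f :: "nat \<Rightarrow> nat" and \<psi> :: "nat \<Rightarrow> real" and B b :: ennreal
  assumes "d \<ge> 1"
    and "\<And>n. f n = d * n + t"
    and "\<And>n. n \<ge> 1 \<Longrightarrow> \<psi> n \<ge> 1"
    and "ln_ennreal B = liminf (\<lambda>n. ereal (ln (\<psi> n) / (real d * real n)))"
    and "ln_ennreal b = liminf (\<lambda>n. ln_ennreal (ennreal (ln (\<psi> n))) / ereal (real d * (real n)\<^sup>2))"
  shows "(1 \<le> B \<and> B < \<infinity> \<longrightarrow>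
           hausdorff_dim (E_set f \<psi>) =
             (INF s\<in>{s :: real. 0 \<le> s \<and>
                pressure (\<lambda>x. - s * ln \<bar>deriv gauss_map x\<bar> - (2 * s - 1) * ln (enn2real B)) \<le> 0}.
              ennreal s)) \<and>
         (B = \<infinity> \<longrightarrow> hausdorff_dim (E_set f \<psi>) = 1 / (1 + b))"
proof (intro conjI impI)
  assume B: "1 \<le> B \<and> B < \<infinity>"
  then obtain r where r: "B = ennreal r" "r \<ge> 1"
    by (cases B) (auto simp flip: ennreal_1)
  have "liminf (\<lambda>n. ereal (ln (\<psi> n) / (real d * real n))) = ereal (ln r)"
    using assms(4) r by (auto simp: ln_ennreal_def)
  then have "hausdorff_dim (E_set f \<psi>) =
      (INF s\<in>{s. 0 \<le> s \<and> s > 1 / 2 \<and> cf_pressure s \<le> (2 * s - 1) * ln r}. ennreal s)"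
    using r by (intro hausdorff_dim_E_set_finite[OF assms(1-3)]) auto
  also have "{s. 0 \<le> s \<and> s > 1 / 2 \<and> cf_pressure s \<le> (2 * s - 1) * ln r} =
      {s. 0 \<le> s \<and> pressure (\<lambda>x. - s * ln \<bar>deriv gauss_map x\<bar> - (2 * s - 1) * ln (enn2real B)) \<le> 0}"
    using pressure_le_0_iff r by (intro Collect_cong) auto
  finally show "hausdorff_dim (E_set f \<psi>) =
             (INF s\<in>{s :: real. 0 \<le> s \<and>
                pressure (\<lambda>x. - s * ln \<bar>deriv gauss_map x\<bar> - (2 * s - 1) * ln (enn2real B)) \<le> 0}.
              ennreal s)" .
next
  assume "B = \<infinity>"
  then have "liminf (\<lambda>n. ereal (ln (\<psi> n) / (real d * real n))) = \<infinity>"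
    using assms(4) by (simp add: ln_ennreal_def)
  then show "hausdorff_dim (E_set f \<psi>) = 1 / (1 + b)"
    by (intro hausdorff_dim_E_set_infinite[OF assms(1,2) _ _ assms(5)]) (use assms(3) in auto)
qed

end
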